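(* For $p\in\{1,-1,2,-2\}$ the inhomogeneous non-commutative $A$-polynomial $(A^{nh}_p(E,Q,q),B_p(q^n,q))$ of the twist knot $K_p$ (normalized by clearing denominators, i.e. up to left multiplication of the pair by a nonzero element of $\mathbb{Q}(q,q^n)$) is given by the following formulas, in which $q^n$ stands for the operator $Q$ and coefficients are written to the left of powers of $E$. That is, $A^{nh}_p(E,Q,q)J_p=B_p(q^n,q)$, and $A^{nh}_p$ has minimal degree in $E$ among nonzero operators satisfying an equation of this form. (a) For $p=\pm1$: \begin{align*} A^{nh}_1 ={}& q^{3n+2}(q^n-1)+(q^{n+1}-1)E,\\ B_1 ={}& (q^{2n+1}-1)q^n,\\ A^{nh}_{-1} ={}& q^{2n+2}(q^n-1)(q^{2n+3}-1)\\ &-(q^{n+1}+1)(q^{4n+4}-q^{3n+3}-q^{2n+3}-q^{n+1}-q^{2n+1}+1)(q^{n+1}-1)^2E\\ &+q^{2n+2}(q^{2n+1}-1)(q^{n+2}-1)E^2,\\ B_{-1} ={}& q^{n+1}(q^{2n+3}-1)(q^{n+1}+1)(q^{2n+1}-1). \end{align*} (b) For $p=\pm2$: \begin{align*} A^{nh}_2 ={}& q^{7n+9}(-1+q^n)(q^{2n+4}-1)(q^{2n+5}-1)\\ &-q^{2n+5}(q^{n+1}-1)(q^{2n+2}-1)(q^{2n+5}-1)\,\bigl(q^{5n+6}-2q^{4n+5}-q^{3n+5}+q^{2n+4}-q^{2n+3}\\ &\quad -q^{2n+2}-q^{3n+2}+q^{2n+1}+q^{n+1}-1\bigr)E\\ &+q(q^{n+2}-1)(q^{2n+1}-1)(q^{2n+4}-1)\,\bigl(q^{5n+9}-q^{4n+7}-q^{3n+7}+q^{3n+6}+q^{3n+5}\\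 &\quad +q^{2n+5}-q^{3n+4}+2q^{n+2}+q^{2n+2}-1\bigr)E^2\\ &+(q^{n+3}-1)(q^{2n+1}-1)(q^{2n+2}-1)E^3,\\ B_2 ={}& (q^{n+1}+1)(q^{2n+1}-1)(q^{n+2}+1)(q^{2n+5}-1)(q^{2n+3}-1)q^{2n+4}, \end{align*} \begin{align*} A^{nh}_{-2} ={}& (-1+q^n)(q^{2n+5}-1)(q^{2n+6}-1)(q^{2n+7}-1)q^{4n+8}\\ &-q^{2n+5}(q^{n+1}-1)(q^{2n+6}-1)(q^{2n+7}-1)(q^{2n+2}-1)\,\bigl(q^{6n+9}-q^{5n+8}-q^{4n+8}+q^{4n+7}\\ &\quad +q^{3n+7}+q^{4n+6}-q^{3n+6}-q^{2n+6}-q^{3n+5}-q^{2n+5}-q^{4n+4}+q^{3n+3}\\ &\quad +q^{2n+3}-q^{n+3}-q^{2n+2}-2q^{n+2}-q^{2n+1}+q+1\bigr)E\\ &+q(q^{n+2}-1)(q^{2n+1}-1)(q^{2n+4}-1)(q^{2n+7}-1)\,\bigl(1-q^{2n+3}-2q^{n+2}-q^{n+3}+q^{2n+5}\\ &\quad +2q^{5n+8}+3q^{4n+8}-q^{3n+7}-q^{4n+6}-2q^{3n+6}-q^{2n+6}+q^{3n+5}-q^{2n+2}+q^{4n+5}+q^{2n+4}\\ &\quad -q^{6n+10}-q^{6n+14}-q^{5n+11}-q^{7n+15}-q^{6n+11}+q^{6n+12}+q^{8n+16}+q^{5n+13}\\ &\quad +q^{6n+13}+q^{5n+9}+q^{3n+9}+2q^{3n+4}-2q^{7n+14}+3q^{4n+9}+2q^{3n+8}-2q^{5n+10}+2q^{5n+12}\bigr)E^2\\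 &-(q^{n+3}-1)(q^{2n+6}-1)(q^{2n+2}-1)(q^{2n+1}-1)\,\bigl(q^{6n+16}+q^{6n+15}-q^{5n+14}-2q^{5n+13}\\ &\quad -q^{4n+13}-q^{4n+12}+q^{4n+10}+q^{3n+10}-q^{4n+9}-q^{3n+9}-q^{4n+8}-q^{3n+8}-q^{2n+7}\\ &\quad +q^{3n+6}+q^{2n+6}+q^{2n+5}-q^{2n+3}-q^{n+3}+1\bigr)E^3\\ &+q^{4n+12}(q^{n+4}-1)(q^{2n+1}-1)(q^{2n+2}-1)(q^{2n+3}-1)E^4,\\ B_{-2} ={}& (q^{n+3}+1)(q^{2n+5}-1)(q^{2n+7}-1)q^{2n+6}(q^{n+2}+1)(q^{n+1}+1)(q^{2n+1}-1)(q^{2n+3}-1). \end{align*}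
   Context: $K_p$ ($p\in\mathbb{Z}$) is the twist knot with $p$ full twists and a negative clasp; for example $K_1=3_1$, $K_{-1}=4_1$, $K_2=5_2$, $K_{-2}=6_1$ in Rolfsen's table. $J_p(n)=J_{K_p}(n)\in\mathbb{Z}[q^{\pm1}]$, $n\ge1$, is the colored Jones polynomial of the $0$-framed knot $K_p$ colored by the $n$-dimensional representation of $\mathrm{SU}(2)$, normalized so that the unknot has value $1$ for every $n$. Write $(x;q)_0=1$ and $(x;q)_m=(1-x)(1-xq)\cdots(1-xq^{m-1})$ for $m>0$. Explicitly (with all conventions, including chirality, fixed by this), $$J_p(n)=\sum_{k=0}^n c(n,k)\,\hat J_p(k),\qquad c(n,k)=(-1)^kq^{-k(k+1)/2}(q^{1-n};q)_k(q^{1+n};q)_k,$$ $$\hat J_p(n)=\sum_{k=0}^{n}q^{n(n+3)/2+pk(k+1)+k(k-1)/2}(-1)^{n+k+1}\frac{(q^{2k+1}-1)(q;q)_n}{(q;q)_{n+k+1}(q;q)_{n-k}}.$$ The operators $E,Q$ act on sequences by $(EJ)(n)=J(n+1)$ and $(QJ)(n)=q^nJ(n)$, so $EQ=qQE$. The inhomogeneous non-commutative $A$-polynomial of $K_p$ is the pair $(A^{nh}_p(E,Q,q),B_p(q^n,q))$ where $A^{nh}_p$ is a nonzero polynomial in $E$ with coefficients in $\mathbb{Q}(q,Q)$ (written on the left), of minimal degree in $E$, such that $A^{nh}_p(E,Q,q)J_p=B_p(q^n,q)$ for some $B_p(q^n,q)\in\mathbb{Q}(q^n,q)$. It is unique once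 normalized to be monic in $E$, hence unique up to left multiplication of the pair by a nonzero element of $\mathbb{Q}(q,q^n)$. *)

theory Defs
  imports "HOL-Computational_Algebra.Computational_Algebra"
begin

type_synonym ratfun = "rat poly fract"            (* Q(q) *)
type_synonym ratfun2 = "ratfun poly fract"        (* Q(q, Q) = Q(q)(Q) *)

definition qvar :: ratfun where
  "qvar = Fract [:0, 1:] 1"

definition qpoch :: "ratfun \<Rightarrow> nat \<Rightarrow> ratfun" where
  "qpoch x m = (\<Prod>i<m. 1 - x * qvar ^ i)"

(* The integer divisions by 2 below are exact. *)

definition cyclo_kernel :: "nat \<Rightarrow> nat \<Rightarrow> ratfun" where
  "cyclo_kernel n k =
     (-1) ^ k * qvar powi (- (int k * (int k + 1) div 2))
       * qpoch (qvar powi (1 - int n)) k * qpoch (qvar powi (1 + int n)) k"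

definition cyclo_jones :: "int \<Rightarrow> nat \<Rightarrow> ratfun" where
  "cyclo_jones p n =
     (\<Sum>k=0..n. qvar powi (int n * (int n + 3) div 2 + p * int k * (int k + 1)
                           + int k * (int k - 1) div 2)
        * (-1) ^ (n + k + 1)
        * ((qvar ^ (2 * k + 1) - 1) * qpoch qvar n)
        / (qpoch qvar (n + k + 1) * qpoch qvar (n - k)))"

(* Colored Jones function of the twist knot K_p with p full twists and a negative clasp (K_1 = 3_1,
   K_(-1) = 4_1), given by its cyclotomic expansion (Habiro, Masbaum): 0-framed, n is the dimension of the coloring
   representation, unknot normalized to 1.  Only the values at n >= 1 are meaningful. *)
definition colored_jones :: "int \<Rightarrow> nat \<Rightarrow> ratfun" where
  "colored_jones p n = (\<Sum>k=0..n. cyclo_kernel n k * cyclo_jones p k)"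

definition shiftE :: "(nat \<Rightarrow> ratfun) \<Rightarrow> nat \<Rightarrow> ratfun" where
  "shiftE J n = J (n + 1)"

definition multQ :: "(nat \<Rightarrow> ratfun) \<Rightarrow> nat \<Rightarrow> ratfun" where
  "multQ J n = qvar ^ n * J n"

lemma shiftE_multQ: "shiftE (multQ J) n = qvar * multQ (shiftE J) n"
  by (simp add: shiftE_def multQ_def)

(* Evaluation of an element of Q(q)(Q) at a point of Q(q) that is not a pole. *)

definition regular_at :: "ratfun2 \<Rightarrow> ratfun \<Rightarrow> bool" where
  "regular_at r x \<longleftrightarrow> (\<exists>a b. r = Fract a b \<and> poly b x \<noteq> 0)"

definition ratfun2_eval :: "ratfun2 \<Rightarrow> ratfun \<Rightarrow> ratfun" where
  "ratfun2_eval r x =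
     (THE v. \<exists>a b. r = Fract a b \<and> poly b x \<noteq> 0 \<and> v = poly a x / poly b x)"

lemma ratfun2_eval_Fract:
  assumes "poly b x \<noteq> 0"
  shows "ratfun2_eval (Fract a b) x = poly a x / poly b x"
  unfolding ratfun2_eval_def
proof (rule the_equality)
  show "\<exists>a' b'. Fract a b = Fract a' b' \<and> poly b' x \<noteq> 0 \<and> poly a x / poly b x = poly a' x / poly b' x"
    using assms by blast
next
  fix v
  assume "\<exists>a' b'. Fract a b = Fract a' b' \<and> poly b' x \<noteq> 0 \<and> v = poly a' x / poly b' x"
  then obtain a' b' where ab: "Fract a b = Fract a' b'" "poly b' x \<noteq> 0"
    and v: "v = poly a' x / poly b' x" by blast
  have "b \<noteq> 0" "b' \<noteq> 0" using assms ab(2) by auto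
  then have "a * b' = a' * b" using ab(1) by (simp add: eq_fract)
  then have "poly a x * poly b' x = poly a' x * poly b x" by (metis poly_mult)
  then show "v = poly a x / poly b x" using v assms ab(2) by (simp add: frac_eq_eq)
qed

definition coeff_op :: "ratfun2 \<Rightarrow> (nat \<Rightarrow> ratfun) \<Rightarrow> nat \<Rightarrow> ratfun" where
  "coeff_op r J n = ratfun2_eval r (qvar ^ n) * J n"

(* A polynomial in E with coefficients in Q(q, Q) written on the left of the powers of E.
   The type poly only records the coefficients; its commutative multiplication is never used
   on operators. *)
type_synonym qE_operator = "ratfun2 poly"

definition apply_op :: "qE_operator \<Rightarrow> (nat \<Rightarrow> ratfun) \<Rightarrow> nat \<Rightarrow> ratfun" where
  "apply_op A J n = (\<Sum>i\<le>degree A. coeff_op (coeff A i) ((shiftE ^^ i) J) n)"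

(* A J = B(q^n, q), read at every n >= 1 at which no coefficient has a pole.  All but finitely
   many n qualify, because a nonzero polynomial in Q has finitely many roots and the q^n are
   distinct. *)
definition inhom_relation :: "qE_operator \<Rightarrow> ratfun2 \<Rightarrow> (nat \<Rightarrow> ratfun) \<Rightarrow> bool" where
  "inhom_relation A B J \<longleftrightarrow>
     (\<forall>n\<ge>1. (\<forall>i\<le>degree A. regular_at (coeff A i) (qvar ^ n)) \<and> regular_at B (qvar ^ n)
        \<longrightarrow> apply_op A J n = ratfun2_eval B (qvar ^ n))"

(* The inhomogeneous non-commutative A-polynomial is determined only up to left multiplication
   of the pair by a nonzero element of Q(q, Q); this predicate recognizes representatives. *)
definition is_inhom_A_polynomial :: "(nat \<Rightarrow> ratfun) \<Rightarrow> qE_operator \<Rightarrow> ratfun2 \<Rightarrow> bool" where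
  "is_inhom_A_polynomial J A B \<longleftrightarrow>
     A \<noteq> 0 \<and> inhom_relation A B J \<and>
     (\<forall>A' B'. A' \<noteq> 0 \<and> inhom_relation A' B' J \<longrightarrow> degree A \<le> degree A')"

(* q and Q as elements of Q(q, Q); q^(a n + b) is written qq^b * QQ^a. *)

definition qq :: ratfun2 where
  "qq = Fract [:qvar:] 1"

definition QQ :: ratfun2 where
  "QQ = Fract [:0, 1:] 1"

lemma coeff_op_QQ: "coeff_op QQ J n = multQ J n"
  by (simp add: coeff_op_def multQ_def QQ_def ratfun2_eval_Fract)

lemma coeff_op_qq: "coeff_op qq J n = qvar * J n"
  by (simp add: coeff_op_def qq_def ratfun2_eval_Fract)

definition A_1 :: qE_operator where
  "A_1 = [:
      qq^2 * QQ^3 * (QQ - 1),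
      qq * QQ - 1 :]"

definition B_1 :: ratfun2 where
  "B_1 =
      (qq * QQ^2 - 1) * QQ"

definition A_minus1 :: qE_operator where
  "A_minus1 = [:
      qq^2 * QQ^2 * (QQ - 1) * (qq^3 * QQ^2 - 1),
      - ((qq * QQ + 1) * (qq^4 * QQ^4 - qq^3 * QQ^3 - qq^3 * QQ^2 - qq * QQ - qq * QQ^2 + 1)
        * (qq * QQ - 1)^2),
      qq^2 * QQ^2 * (qq * QQ^2 - 1) * (qq^2 * QQ - 1) :]"

definition B_minus1 :: ratfun2 where
  "B_minus1 =
      qq * QQ * (qq^3 * QQ^2 - 1) * (qq * QQ + 1) * (qq * QQ^2 - 1)"

definition A_2 :: qE_operator where
  "A_2 = [:
      qq^9 * QQ^7 * (-1 + QQ) * (qq^4 * QQ^2 - 1) * (qq^5 * QQ^2 - 1),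
      - (qq^5 * QQ^2 * (qq * QQ - 1) * (qq^2 * QQ^2 - 1) * (qq^5 * QQ^2 - 1) * (qq^6 * QQ^5
        - 2 * qq^5 * QQ^4 - qq^5 * QQ^3 + qq^4 * QQ^2 - qq^3 * QQ^2 - qq^2 * QQ^2
        - qq^2 * QQ^3 + qq * QQ^2 + qq * QQ - 1)),
      qq * (qq^2 * QQ - 1) * (qq * QQ^2 - 1) * (qq^4 * QQ^2 - 1) * (qq^9 * QQ^5
        - qq^7 * QQ^4 - qq^7 * QQ^3 + qq^6 * QQ^3 + qq^5 * QQ^3 + qq^5 * QQ^2 - qq^4 * QQ^3
        + 2 * qq^2 * QQ + qq^2 * QQ^2 - 1),
      (qq^3 * QQ - 1) * (qq * QQ^2 - 1) * (qq^2 * QQ^2 - 1) :]"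

definition B_2 :: ratfun2 where
  "B_2 =
      (qq * QQ + 1) * (qq * QQ^2 - 1) * (qq^2 * QQ + 1) * (qq^5 * QQ^2 - 1)
        * (qq^3 * QQ^2 - 1) * qq^4 * QQ^2"

definition A_minus2 :: qE_operator where
  "A_minus2 = [:
      (-1 + QQ) * (qq^5 * QQ^2 - 1) * (qq^6 * QQ^2 - 1) * (qq^7 * QQ^2 - 1) * qq^8 * QQ^4,
      - (qq^5 * QQ^2 * (qq * QQ - 1) * (qq^6 * QQ^2 - 1) * (qq^7 * QQ^2 - 1)
        * (qq^2 * QQ^2 - 1) * (qq^9 * QQ^6 - qq^8 * QQ^5 - qq^8 * QQ^4 + qq^7 * QQ^4
        + qq^7 * QQ^3 + qq^6 * QQ^4 - qq^6 * QQ^3 - qq^6 * QQ^2 - qq^5 * QQ^3 - qq^5 * QQ^2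
        - qq^4 * QQ^4 + qq^3 * QQ^3 + qq^3 * QQ^2 - qq^3 * QQ - qq^2 * QQ^2 - 2 * qq^2 * QQ
        - qq * QQ^2 + qq + 1)),
      qq * (qq^2 * QQ - 1) * (qq * QQ^2 - 1) * (qq^4 * QQ^2 - 1) * (qq^7 * QQ^2 - 1) * (1
        - qq^3 * QQ^2 - 2 * qq^2 * QQ - qq^3 * QQ + qq^5 * QQ^2 + 2 * qq^8 * QQ^5
        + 3 * qq^8 * QQ^4 - qq^7 * QQ^3 - qq^6 * QQ^4 - 2 * qq^6 * QQ^3 - qq^6 * QQ^2
        + qq^5 * QQ^3 - qq^2 * QQ^2 + qq^5 * QQ^4 + qq^4 * QQ^2 - qq^10 * QQ^6 - qq^14 * QQ^6
        - qq^11 * QQ^5 - qq^15 * QQ^7 - qq^11 * QQ^6 + qq^12 * QQ^6 + qq^16 * QQ^8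
        + qq^13 * QQ^5 + qq^13 * QQ^6 + qq^9 * QQ^5 + qq^9 * QQ^3 + 2 * qq^4 * QQ^3
        - 2 * qq^14 * QQ^7 + 3 * qq^9 * QQ^4 + 2 * qq^8 * QQ^3 - 2 * qq^10 * QQ^5
        + 2 * qq^12 * QQ^5),
      - ((qq^3 * QQ - 1) * (qq^6 * QQ^2 - 1) * (qq^2 * QQ^2 - 1) * (qq * QQ^2 - 1)
        * (qq^16 * QQ^6 + qq^15 * QQ^6 - qq^14 * QQ^5 - 2 * qq^13 * QQ^5 - qq^13 * QQ^4
        - qq^12 * QQ^4 + qq^10 * QQ^4 + qq^10 * QQ^3 - qq^9 * QQ^4 - qq^9 * QQ^3 - qq^8 * QQ^4
        - qq^8 * QQ^3 - qq^7 * QQ^2 + qq^6 * QQ^3 + qq^6 * QQ^2 + qq^5 * QQ^2 - qq^3 * QQ^2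
        - qq^3 * QQ + 1)),
      qq^12 * QQ^4 * (qq^4 * QQ - 1) * (qq * QQ^2 - 1) * (qq^2 * QQ^2 - 1)
        * (qq^3 * QQ^2 - 1) :]"

definition B_minus2 :: ratfun2 where
  "B_minus2 =
      (qq^3 * QQ + 1) * (qq^5 * QQ^2 - 1) * (qq^7 * QQ^2 - 1) * qq^6 * QQ^2
        * (qq^2 * QQ + 1) * (qq * QQ + 1) * (qq * QQ^2 - 1) * (qq^3 * QQ^2 - 1)"

end

(*
  Recurrences.  In the basis c(n,k) the shift E and the multiplication by Q + 1/Q act on the
  coefficient sequence by operators of order one in k.  The cyclotomic coefficients satisfy a
  recurrence of order one (p = 1, -1) or two (p = 2, -2), found by telescoping their Bailey-type
  sum.  So J(n), together with finitely many sums of q^(ak) times (shifted) cyclotomic coefficients,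
  satisfies an inhomogeneous first-order linear system, and eliminating the auxiliary sums one
  shift at a time yields the stated relation.

  Minimality.  Let M be a relation of least order.  Right division of skew polynomials gives
  f A = C M with f nonzero, first over Q(q,Q) and then, after clearing denominators, over Z[q,Q].
  The shift Q -> qQ becomes trivial at q = 1, so cancelling the prime q - 1 from f, C and M as often
  as possible turns this into a commutative factorization at q = 1.  Cancelling then Q - a and 11 in
  the same way gives a factorization over the field with 11 elements, where A is irreducible for
  a = 2 or 3.  Hence M has order 0 or the order of A.  Order 0 is impossible since the degree in q of
  J(n) grows quadratically in n, whereas a rational function of q and q^n has linear growth.
*)

theory Submission
  imports Defs "Berlekamp_Zassenhaus.Finite_Field"
begin

(* HOL-Algebra, loaded with the finite fields, has its own versions of these names and of the
   proof method algebra. *)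
hide_const (open) up_ring.monom up_ring.coeff module.smult

section \<open>Kernel sums\<close>

text \<open>The obstacle in the minimality part is that \<open>smult f A = skew_mult C M\<close>
  lives in a noncommutative ring with no Gauss lemma at hand, so \<open>f\<close> cannot simply be
  divided out. Something weaker suffices: a factorization of one specialization of \<open>A\<close>
  with the degrees of the factors under control. The order of the specializations is forced: q - 1
  is fixed by Q -> qQ and can be pulled out of either factor, Q - a is not fixed, so q = 1 comes
  first. Degrees may drop under specialization; they do not drop here because the leading
  coefficient of \<open>A\<close> survives, which is one condition on a and the prime. The other is
  irreducibility. For p = -2 and a = 3 the prime 11 is the smallest possible: 2 and 3 divide the
  leading coefficient 82944, and the quartic has the root 1 mod 5 and the root -1 mod 7. For p = -1
  the value a = 2 fails, since 4 E^2 + E + 4 has discriminant 3 = 5^2 mod 11. In the recurrence part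
  the order of each relation equals the number of sums in its linear system (1, 2, 3, 4). The
  certificates \<open>g\<close>, the multipliers \<open>u\<close> and the cofactors \<open>s\<close>
  are given explicitly, so that only polynomial identities remain.\<close>

lemma qvar_nz [simp]: "qvar \<noteq> 0"
  by (simp add: qvar_def Zero_fract_def eq_fract)

lemma qvar_power: "qvar ^ m = to_fract (monom 1 m)"
proof (induction m)
  case (Suc m)
  have "monom (1::rat) (Suc m) = [:0, 1:] * monom 1 m" by (simp add: monom_Suc)
  then show ?case using Suc by (simp add: qvar_def to_fract_def)
qed simp

lemma qvar_power_eq_1 [simp]: "qvar ^ m = 1 \<longleftrightarrow> m = 0"
proof
  assume "qvar ^ m = 1"
  then have "monom (1::rat) m = 1" by (metis qvar_power to_fract_1 to_fract_eq_iff)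
  then have "degree (monom (1::rat) m) = 0" by simp
  then show "m = 0" by (simp add: degree_monom_eq)
qed simp

lemma qpoch_Suc: "qpoch x (Suc m) = qpoch x m * (1 - x * qvar ^ m)"
  by (simp add: qpoch_def)

lemma qpoch_qvar_nz [simp]: "qpoch qvar m \<noteq> 0"
proof -
  have "qvar * qvar ^ i \<noteq> 1" for i by (metis qvar_power_eq_1 power_Suc nat.simps(3))
  then show ?thesis by (auto simp: qpoch_def)
qed

lemma triangle_div_Suc: "(int k + 1) * (int k + 2) div 2 = int k * (int k + 1) div 2 + (int k + 1)"
proof -
  have "(int k + 1) * (int k + 2) = int k * (int k + 1) + (int k + 1) * 2" by (simp add: algebra_simps)
  then show ?thesis by simp
qed

lemma cyclo_kernel_0 [simp]: "cyclo_kernel n 0 = 1"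
  by (simp add: cyclo_kernel_def qpoch_def)

text \<open>This is (Q + 1/Q) - (q^(k+1) + q^(-k-1)) at Q = q^n: the kernels form a Newton basis in
  the variable Q + 1/Q, with nodes at n = 1, 2, 3, ...\<close>

definition kernel_factor :: "nat \<Rightarrow> nat \<Rightarrow> ratfun" where
  "kernel_factor n k = qvar ^ n + 1 / qvar ^ n - qvar * qvar ^ k - 1 / (qvar * qvar ^ k)"

text \<open>Each of the two Pochhammer symbols gains one factor, and -q^(-k-1) (1 - q^(k+1-n)) (1 -
  q^(k+1+n)) expands to \<open>kernel_factor n k\<close>.\<close>

lemma cyclo_kernel_Suc: "cyclo_kernel n (Suc k) = cyclo_kernel n k * kernel_factor n k"
proof -
  have 1: "qvar powi (- (int (Suc k) * (int (Suc k) + 1) div 2))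
      = qvar powi (- (int k * (int k + 1) div 2)) * (1 / (qvar * qvar ^ k))"
  proof -
    have e: "- (int (Suc k) * (int (Suc k) + 1) div 2) = - (int k * (int k + 1) div 2) + (- int (Suc
      k))"
      using triangle_div_Suc[of k] by (simp add: algebra_simps)
    show ?thesis unfolding e
      by (subst power_int_add) (simp_all only: power_int_minus power_int_of_nat power_Suc, simp_all add:
        divide_inverse)
  qed
  have 2: "qvar powi (1 - int n) = qvar / qvar ^ n"
    by (subst power_int_diff) simp_all
  have 3: "qvar powi (1 + int n) = qvar * qvar ^ n"
    by (subst power_int_add) simp_all
  define c where "c = (-1) ^ k * qvar powi (- (int k * (int k + 1) div 2))
       * qpoch (qvar powi (1 - int n)) k * qpoch (qvar powi (1 + int n)) k"
  have "cyclo_kernel n (Suc k) = c * (- (1 / (qvar * qvar ^ k)) *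
     (1 - qvar / qvar ^ n * qvar ^ k) * (1 - qvar * qvar ^ n * qvar ^ k))"
    unfolding cyclo_kernel_def 1 qpoch_Suc c_def 2 3 by (simp only: power_Suc) (simp add: mult_ac)
  moreover have "- (1 / (qvar * qvar ^ k)) *
     (1 - qvar / qvar ^ n * qvar ^ k) * (1 - qvar * qvar ^ n * qvar ^ k)
     = qvar ^ n + 1 / qvar ^ n - qvar * qvar ^ k - 1 / (qvar * qvar ^ k)"
    by (simp add: field_simps)
  ultimately show ?thesis by (simp only: c_def cyclo_kernel_def kernel_factor_def)
qed

text \<open>The factor with index n - 1 vanishes and stays in the product from there on. For n = 0
  no factor vanishes, hence the condition \<open>0 < n\<close>.\<close>

lemma cyclo_kernel_eq_0: "0 < n \<Longrightarrow> n \<le> k \<Longrightarrow> cyclo_kernel n k = 0"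
proof (induction k)
  case (Suc k)
  show ?case
  proof (cases "n = Suc k")
    case True
    then show ?thesis by (simp add: cyclo_kernel_Suc kernel_factor_def)
  next
    case False
    then show ?thesis using Suc by (simp add: cyclo_kernel_Suc kernel_factor_def)
  qed
qed simp

text \<open>Raising n and k together only moves the two product ranges: 1 - q^(-n) enters one range,
  1 - q^(n+k+1) and 1 - q^(n+k+2) enter the other, and 1 - q^(n+1) leaves it. The last one is the
  denominator 1 - qQ that accompanies every shift of n below.\<close>

lemma cyclo_kernel_shift:
  "(1 - qvar * qvar ^ n) * cyclo_kernel (Suc n) (Suc k) =
     - (1 / (qvar * qvar ^ k)) * (1 - 1 / qvar ^ n) * (1 - qvar * qvar ^ k * qvar ^ n)
       * (1 - qvar ^ 2 * qvar ^ k * qvar ^ n) * cyclo_kernel n k"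
proof (induction k)
  case 0
  show ?case by (simp add: cyclo_kernel_Suc kernel_factor_def field_simps power2_eq_square)
next
  case (Suc k)
  define Q where "Q = qvar ^ n"
  define K where "K = qvar ^ k"
  define q where "q = qvar"
  have nz: "Q \<noteq> 0" "K \<noteq> 0" "q \<noteq> 0" by (simp_all add: Q_def K_def q_def)
  have "(1 - qvar * qvar ^ n) * cyclo_kernel (Suc n) (Suc (Suc k))
      = ((1 - qvar * qvar ^ n) * cyclo_kernel (Suc n) (Suc k))
        * (q * Q + 1 / (q * Q) - q * (q * K) - 1 / (q * (q * K)))"
    by (subst cyclo_kernel_Suc) (simp add: kernel_factor_def Q_def K_def q_def)
  also have "\<dots> = - (1 / (q * K)) * (1 - 1 / Q) * (1 - q * K * Q) * (1 - q ^ 2 * K * Q)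
      * (q * Q + 1 / (q * Q) - q * (q * K) - 1 / (q * (q * K))) * cyclo_kernel n k"
    unfolding Suc Q_def K_def q_def by simp
  also have "- (1 / (q * K)) * (1 - 1 / Q) * (1 - q * K * Q) * (1 - q ^ 2 * K * Q)
      * (q * Q + 1 / (q * Q) - q * (q * K) - 1 / (q * (q * K)))
    = - (1 / (q * (q * K))) * (1 - 1 / Q) * (1 - q * (q * K) * Q) * (1 - q ^ 2 * (q * K) * Q)
      * (Q + 1 / Q - q * K - 1 / (q * K))"
    using nz by (simp add: field_simps power2_eq_square)
  also have "\<dots> * cyclo_kernel n k = - (1 / (q * (q * K))) * (1 - 1 / Q) * (1 - q * (q * K) * Q)
      * (1 - q ^ 2 * (q * K) * Q) * cyclo_kernel n (Suc k)"
    by (subst cyclo_kernel_Suc) (simp add: kernel_factor_def Q_def K_def q_def)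
  finally show ?case by (simp add: Q_def K_def q_def)
qed

text \<open>The range stops before k = n because the kernel vanishes from there on when n is
  positive; the vanishing kernel at k = n is also the upper boundary value in telescoping.\<close>

definition kernel_sum :: "(nat \<Rightarrow> ratfun) \<Rightarrow> nat \<Rightarrow> ratfun" where
  "kernel_sum w n = (\<Sum>k<n. w k * cyclo_kernel n k)"

lemma kernel_sum_add: "kernel_sum (\<lambda>k. f k + g k) n = kernel_sum f n + kernel_sum g n"
  by (simp add: kernel_sum_def sum.distrib algebra_simps)

lemma kernel_sum_scale: "kernel_sum (\<lambda>k. c * f k) n = c * kernel_sum f n"
  by (simp add: kernel_sum_def sum_distrib_left algebra_simps)

lemma colored_jones_eq_kernel_sum:
  assumes "n \<ge> 1"
  shows "colored_jones p n = kernel_sum (cyclo_jones p) n"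
proof -
  have "{0..n} = insert n {..<n}" by auto
  then have "colored_jones p n = cyclo_kernel n n * cyclo_jones p n + (\<Sum>k<n. cyclo_kernel n k *
    cyclo_jones p k)"
    by (simp add: colored_jones_def)
  then show ?thesis using assms by (simp add: cyclo_kernel_eq_0 kernel_sum_def mult.commute)
qed

text \<open>Since the kernel at k + 1 is the kernel at k times \<open>kernel_factor n k\<close>, the
  difference of the weights \<open>f\<close> and \<open>g\<close> contributes a telescoping sum. Its
  upper end contains the kernel at k = n, which is 0; its lower end is \<open>- u 0\<close>. This is
  the freedom with which weights are reduced to a finite set.\<close>

lemma kernel_sum_telescope:
  assumes "n \<ge> 1"
    and "\<And>k. f k = g k + u (Suc k) * kernel_factor n k - u k"
  shows "kernel_sum f n = kernel_sum g n - u 0"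
proof -
  have "kernel_sum f n - kernel_sum g n = (\<Sum>k<n. u (Suc k) * cyclo_kernel n (Suc k) - u k *
    cyclo_kernel n k)"
    unfolding kernel_sum_def sum_subtractf[symmetric]
    by (rule sum.cong[OF refl], subst assms(2), subst cyclo_kernel_Suc) (simp add: algebra_simps)
  also have "\<dots> = - u 0"
    using assms(1) by (subst sum_lessThan_telescope) (simp add: cyclo_kernel_eq_0)
  finally show ?thesis by (simp add: algebra_simps)
qed

definition shifted_weight :: "(nat \<Rightarrow> ratfun) \<Rightarrow> nat \<Rightarrow> nat
  \<Rightarrow> ratfun" where
  "shifted_weight w n k = - (1 / (qvar * qvar ^ k)) * (1 - 1 / qvar ^ n)
     * (1 - qvar * qvar ^ k * qvar ^ n) * (1 - qvar ^ 2 * qvar ^ k * qvar ^ n) * w (Suc k)"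

text \<open>The term k = 0 is split off and the others are reindexed, so that both arguments of the
  kernel rise by one and \<open>cyclo_kernel_shift\<close> applies.\<close>

lemma kernel_sum_shift:
  "(1 - qvar * qvar ^ n) * kernel_sum w (Suc n)
     = (1 - qvar * qvar ^ n) * w 0 + kernel_sum (shifted_weight w n) n"
proof -
  have "(1 - qvar * qvar ^ n) * kernel_sum w (Suc n) = (1 - qvar * qvar ^ n) * w 0 +
     (\<Sum>k<n. w (Suc k) * ((1 - qvar * qvar ^ n) * cyclo_kernel (Suc n) (Suc k)))"
    unfolding kernel_sum_def
    by (simp add: sum.lessThan_Suc_shift sum_distrib_left algebra_simps del: sum.lessThan_Suc)
  then show ?thesis unfolding cyclo_kernel_shift kernel_sum_def shifted_weight_def by (simp add:
    mult_ac)
qed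

lemma kernel_sum_step:
  assumes "n \<ge> 1"
    and "\<And>k. shifted_weight w n k
      = g k + u (Suc k) * kernel_factor n k - u k"
  shows "(1 - qvar * qvar ^ n) * kernel_sum w (Suc n)
     = (1 - qvar * qvar ^ n) * w 0 - u 0 + kernel_sum g n"
  using kernel_sum_shift[of n w] kernel_sum_telescope[OF assms] by simp

section \<open>Recurrences of the cyclotomic coefficients\<close>

text \<open>The reciprocal of \<open>(q;q)\<^sub>m\<close>, continued by 0 to negative \<open>m\<close>:
  this truncates the sums below by itself.\<close>

definition inv_qpoch :: "int \<Rightarrow> ratfun" where
  "inv_qpoch m = (if m < 0 then 0 else 1 / qpoch qvar (nat m))"

text \<open>At m = 0 the factor 1 - q^0 vanishes, in agreement with the value 0 at -1, and below
  that both sides are 0. Hence the continuation by 0 obeys the recursion without boundary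
  cases.\<close>

lemma inv_qpoch_pred: "inv_qpoch (m - 1) = (1 - qvar powi m) * inv_qpoch m"
proof (cases "m \<ge> 1")
  case True
  define j where "j = nat (m - 1)"
  have m: "m = int (Suc j)" using True by (simp add: j_def)
  have "qpoch qvar (Suc j) = qpoch qvar j * (1 - qvar powi m)"
    unfolding m power_int_of_nat by (simp add: qpoch_Suc)
  moreover have "1 - qvar powi m \<noteq> 0"
    unfolding m power_int_of_nat by (metis right_minus_eq qvar_power_eq_1 nat.simps(3))
  ultimately show ?thesis
    by (simp add: inv_qpoch_def m nat_add_distrib del: of_nat_Suc) (simp add: m)
next
  case False
  then show ?thesis by (cases "m = 0") (auto simp: inv_qpoch_def)
qed

definition bailey_weight :: "int \<Rightarrow> nat \<Rightarrow> ratfun" where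
  "bailey_weight p k = (-1) ^ k * qvar powi (p * int k * (int k + 1) + int k * (int k - 1) div 2)"

lemma bailey_weight_Suc:
  "bailey_weight p (Suc k) = - (qvar powi (2 * p) * (qvar ^ k) powi (2 * p) * qvar ^ k) * bailey_weight
    p k"
proof -
  have "int (Suc k) * (int (Suc k) - 1) = int k * (int k - 1) + int k * 2"
    by (simp add: algebra_simps)
  then have "int (Suc k) * (int (Suc k) - 1) div 2 = int k * (int k - 1) div 2 + int k"
    by simp
  then have e: "p * int (Suc k) * (int (Suc k) + 1) + int (Suc k) * (int (Suc k) - 1) div 2
     = (p * int k * (int k + 1) + int k * (int k - 1) div 2) + (2 * p + (int k * (2 * p) + int k))"
    by (simp add: algebra_simps)
  have "qvar powi (2 * p + (int k * (2 * p) + int k)) = qvar powi (2 * p) * (qvar ^ k) powi (2 * p) *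
    qvar ^ k"
    by (subst power_int_add, simp, subst power_int_add, simp)
      (simp add: power_int_mult)
  then show ?thesis
    unfolding bailey_weight_def e by (subst power_int_add) simp_all
qed


text \<open>The summand of the cyclotomic coefficient without its prefactor (-1)^n q^(n(n+3)/2),
  written so that it also makes sense, and vanishes, for k > n.\<close>

definition bailey_term :: "int \<Rightarrow> nat \<Rightarrow> nat \<Rightarrow> ratfun" where
  "bailey_term p n k = - bailey_weight p k * (qvar ^ (2 * k + 1) - 1) * qpoch qvar n
      * inv_qpoch (int n + int k + 1) * inv_qpoch (int n - int k)"

definition bailey_sum :: "int \<Rightarrow> nat \<Rightarrow> ratfun" where
  "bailey_sum p n = (\<Sum>k\<le>n. bailey_term p n k)"

lemma cyclo_jones_bailey_sum:
  "cyclo_jones p n = (-1) ^ n * qvar powi (int n * (int n + 3) div 2) * bailey_sum p n"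
proof -
  have "qvar powi (int n * (int n + 3) div 2 + p * int k * (int k + 1) + int k * (int k - 1) div 2)
        * (-1) ^ (n + k + 1) * ((qvar ^ (2 * k + 1) - 1) * qpoch qvar n)
        / (qpoch qvar (n + k + 1) * qpoch qvar (n - k))
     = (-1) ^ n * qvar powi (int n * (int n + 3) div 2) * bailey_term p n k" if "k \<le> n" for k
  proof -
    have 1: "inv_qpoch (int n + int k + 1) = 1 / qpoch qvar (n + k + 1)"
      by (simp add: inv_qpoch_def nat_add_distrib)
    have 2: "inv_qpoch (int n - int k) = 1 / qpoch qvar (n - k)"
      using that by (simp add: inv_qpoch_def nat_diff_distrib)
    have 3: "qvar powi (int n * (int n + 3) div 2 + p * int k * (int k + 1) + int k * (int k - 1) div 2)
      = qvar powi (int n * (int n + 3) div 2) * qvar powi (p * int k * (int k + 1) + int k * (int k - 1)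
        div 2)"
      by (subst power_int_add[symmetric]) (simp_all add: add.assoc)
    show ?thesis unfolding bailey_term_def 1 2 3 bailey_weight_def by (simp add: power_add)
  qed
  then show ?thesis
    unfolding cyclo_jones_def bailey_sum_def atMost_atLeast0 sum_distrib_left by (intro sum.cong) auto
qed

text \<open>For k > n the factor \<open>inv_qpoch (int n - int k)\<close> is 0. A common range is
  what allows the sums at n, n + 1 and n + 2 to be combined term by term.\<close>

lemma bailey_sum_extend:
  assumes "n \<le> N"
  shows "bailey_sum p n = (\<Sum>k\<le>N. bailey_term p n k)"
  unfolding bailey_sum_def
  by (rule sum.mono_neutral_left) (use assms in \<open>auto simp: inv_qpoch_def bailey_term_def\<close>)

lemma sum_atMost_telescope_up:
  fixes G :: "nat \<Rightarrow> 'a :: ab_group_add"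
  shows "(\<Sum>k\<le>N. G (Suc k) - G k) = G (Suc N) - G 0"
  by (induction N) auto

lemma inv_qpoch_up:
  "inv_qpoch (int n + int k + int j) =
     (1 - qvar ^ n * qvar ^ k * qvar ^ (Suc j)) * inv_qpoch (int n + int k + int (Suc j))"
proof -
  have "qvar powi (int n + int k + int (Suc j)) = qvar ^ n * qvar ^ k * qvar ^ (Suc j)"
    by (simp only: of_nat_add[symmetric] power_int_of_nat power_add)
  moreover have "int n + int k + int j = int n + int k + int (Suc j) - 1" by simp
  ultimately show ?thesis using inv_qpoch_pred[of "int n + int k + int (Suc j)"] by metis
qed

lemma inv_qpoch_down:
  "inv_qpoch (int n - int k + int j) =
     (1 - qvar ^ n / qvar ^ k * qvar ^ (Suc j)) * inv_qpoch (int n - int k + int (Suc j))"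
proof -
  have "qvar powi (int n - int k + int (Suc j)) = qvar ^ n / qvar ^ k * qvar ^ (Suc j)"
    by (subst power_int_add, simp, subst power_int_diff, simp, simp only: power_int_of_nat)
  moreover have "int n - int k + int j = int n - int k + int (Suc j) - 1" by simp
  ultimately show ?thesis using inv_qpoch_pred[of "int n - int k + int (Suc j)"] by metis
qed

text \<open>Creative telescoping; the hypothesis is the telescoping identity for the certificate
  \<open>g\<close>, divided by
  the common hypergeometric factor.\<close>

lemma bailey_sum_recurrence:
  assumes cert: "\<And>K k. K = qvar ^ k \<Longrightarrow>
     - (qvar * K ^ 2 - 1) * (c2 * (1 - qvar * qvar ^ n) * (1 - qvar ^ 2 * qvar ^ n)
        + c1 * (1 - qvar * qvar ^ n) * (1 - qvar ^ 3 * qvar ^ n * K) * (1 - qvar ^ 2 * qvar ^ n / K)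
        + c0 * (1 - qvar ^ 2 * qvar ^ n * K) * (1 - qvar ^ 3 * qvar ^ n * K)
             * (1 - qvar * qvar ^ n / K) * (1 - qvar ^ 2 * qvar ^ n / K))
     = - (qvar powi (2 * p) * K powi (2 * p) * K) * g (Suc k) * (1 - qvar ^ 2 * qvar ^ n / K)
       - g k * (1 - qvar ^ 3 * qvar ^ n * K)"
    and g0: "g 0 = 0"
  shows "c2 * bailey_sum p (n + 2) + c1 * bailey_sum p (n + 1) + c0 * bailey_sum p n = 0"
proof -
  define q N where "q = qvar" and "N = qvar ^ n"
  \<comment> \<open>The denominators are chosen so that \<open>G k\<close> and
    \<open>G (Suc k)\<close>, with indices (n + k + 2, n - k + 2) and (n + k + 3, n - k + 1), are
    both multiples of the factor with indices (n + k + 3, n - k + 2). That factor, called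
    \<open>b\<close> below, divides all three summands as well.\<close>
  define G where "G k = bailey_weight p k * g k * qpoch qvar n
    * inv_qpoch (int n + int k + int 2) * inv_qpoch (int n - int k + int 2)" for k
  have "c2 * bailey_sum p (n + 2) + c1 * bailey_sum p (n + 1) + c0 * bailey_sum p n
      = (\<Sum>k\<le>n + 2. c2 * bailey_term p (n + 2) k + c1 * bailey_term p (n + 1) k + c0 *
        bailey_term p n k)"
    by (subst (1 2 3) bailey_sum_extend[of _ "n + 2"], simp, simp, simp)
      (simp only: sum.distrib sum_distrib_left)
  also have "\<dots> = (\<Sum>k\<le>n + 2. G (Suc k) - G k)"
  proof (rule sum.cong[OF refl])
    fix k
    define K where "K = qvar ^ k"
    define b where "b = bailey_weight p k * qpoch qvar n * inv_qpoch (int n + int k + int 3) * inv_qpoch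
      (int n - int k + int 2)"
    have e: "qvar ^ (2 * k + 1) - 1 = q * K ^ 2 - 1"
      by (simp add: q_def K_def power_even_eq)
    have u1: "inv_qpoch (int n + int k + int 1) = (1 - q ^ 2 * N * K) * inv_qpoch (int n + int k + int
      2)"
      using inv_qpoch_up[of n k 1] by (simp add: N_def K_def q_def mult_ac numeral_2_eq_2)
    have u2: "inv_qpoch (int n + int k + int 2) = (1 - q ^ 3 * N * K) * inv_qpoch (int n + int k + int
      3)"
      using inv_qpoch_up[of n k 2] by (simp add: N_def K_def q_def mult_ac numeral_3_eq_3
        numeral_2_eq_2)
    have d0: "inv_qpoch (int n - int k) = (1 - q * N / K) * inv_qpoch (int n - int k + int 1)"
      using inv_qpoch_down[of n k 0] by (simp add: N_def K_def q_def mult_ac)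
    have d1: "inv_qpoch (int n - int k + int 1) = (1 - q ^ 2 * N / K) * inv_qpoch (int n - int k + int
      2)"
      using inv_qpoch_down[of n k 1] by (simp add: N_def K_def q_def mult_ac numeral_2_eq_2)
    have 0: "bailey_term p (n + 2) k = - (q * K ^ 2 - 1) * ((1 - q * N) * (1 - q ^ 2 * N)) * b"
    proof -
      have "int (n + 2) + int k + 1 = int n + int k + int 3" "int (n + 2) - int k = int n - int k + int
        2"
        by simp_all
      moreover have "qpoch qvar (n + 2) = qpoch qvar n * ((1 - q * N) * (1 - q ^ 2 * N))"
        by (simp add: qpoch_Suc numeral_2_eq_2 q_def N_def mult_ac)
      ultimately have "bailey_term p (n + 2) k = - bailey_weight p k * (qvar ^ (2 * k + 1) - 1)
        * (qpoch qvar n * ((1 - q * N) * (1 - q ^ 2 * N)))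
        * inv_qpoch (int n + int k + int 3) * inv_qpoch (int n - int k + int 2)"
        unfolding bailey_term_def by (simp only:)
      then show ?thesis unfolding b_def e by (simp only: mult_minus_left mult_minus_right mult_ac)
    qed
    have 1: "bailey_term p (n + 1) k = - (q * K ^ 2 - 1) * ((1 - q * N) * (1 - q ^ 3 * N * K) * (1 - q ^
      2 * N / K)) * b"
    proof -
      have "int (n + 1) + int k + 1 = int n + int k + int 2" "int (n + 1) - int k = int n - int k + int
        1"
        by simp_all
      moreover have "qpoch qvar (n + 1) = qpoch qvar n * (1 - q * N)"
        by (simp add: qpoch_Suc q_def N_def)
      ultimately have "bailey_term p (n + 1) k = - bailey_weight p k * (qvar ^ (2 * k + 1) - 1)
        * (qpoch qvar n * (1 - q * N)) * inv_qpoch (int n + int k + int 2) * inv_qpoch (int n - int k +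
          int 1)"
        unfolding bailey_term_def by (simp only:)
      then show ?thesis unfolding u2 d1 b_def e by (simp only: mult_minus_left mult_minus_right mult_ac)
    qed
    have 2: "bailey_term p n k = - (q * K ^ 2 - 1) * ((1 - q ^ 2 * N * K) * (1 - q ^ 3 * N * K)
        * (1 - q * N / K) * (1 - q ^ 2 * N / K)) * b"
    proof -
      have "bailey_term p n k = - bailey_weight p k * (qvar ^ (2 * k + 1) - 1) * qpoch qvar n
        * inv_qpoch (int n + int k + int 1) * inv_qpoch (int n - int k)"
        by (simp add: bailey_term_def)
      then show ?thesis unfolding u1 u2 d0 d1 b_def e by (simp only: mult_minus_left mult_minus_right
        mult_ac)
    qed
    have 3: "G k = g k * (1 - q ^ 3 * N * K) * b"
      unfolding G_def u2 b_def by (simp add: mult_ac)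
    have 4: "G (Suc k) = - (q powi (2 * p) * K powi (2 * p) * K) * g (Suc k) * (1 - q ^ 2 * N / K) * b"
    proof -
      have "int n + int (Suc k) + int 2 = int n + int k + int 3"
        "int n - int (Suc k) + int 2 = int n - int k + int 1"
        by simp_all
      then show ?thesis unfolding G_def bailey_weight_Suc b_def
        unfolding K_def[symmetric] unfolding q_def[symmetric]
        by (simp only: d1 mult_minus_left mult_minus_right mult_ac)
    qed
    have "c2 * bailey_term p (n + 2) k + c1 * bailey_term p (n + 1) k + c0 * bailey_term p n k
       = (- (q * K ^ 2 - 1) * (c2 * (1 - q * N) * (1 - q ^ 2 * N)
        + c1 * (1 - q * N) * (1 - q ^ 3 * N * K) * (1 - q ^ 2 * N / K)
        + c0 * (1 - q ^ 2 * N * K) * (1 - q ^ 3 * N * K) * (1 - q * N / K) * (1 - q ^ 2 * N / K))) * b"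
      unfolding 0 1 2 by (simp only: distrib_left distrib_right mult_ac)
    also have "\<dots> = G (Suc k) - G k"
      unfolding 3 4 q_def N_def cert[OF K_def] by (rule left_diff_distrib)
    finally show "c2 * bailey_term p (n + 2) k + c1 * bailey_term p (n + 1) k + c0 * bailey_term p n k
      = G (Suc k) - G k" .
  qed
  \<comment> \<open>\<open>G (n + 3)\<close> contains \<open>inv_qpoch (- 1) = 0\<close>, and
    \<open>G 0\<close> vanishes because \<open>g 0\<close> does.\<close>
  also have "\<dots> = 0"
    unfolding sum_atMost_telescope_up by (simp add: G_def inv_qpoch_def g0)
  finally show ?thesis .
qed

text \<open>A recurrence of order one, padded with the coefficient 0 to fit the three-term form. The
  last two factors of the certificate turn the denominators with n + k + 2 and n - k + 2 into those
  with n + k + 1 and n - k + 1 that are natural for order one.\<close>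

lemma bailey_sum_pos1: "0 * bailey_sum 1 (n + 2) + 1 * bailey_sum 1 (n + 1) + (-1) * bailey_sum 1 n = 0"
proof (rule bailey_sum_recurrence[where g = "\<lambda>k. - (qvar * qvar ^ n) * (1 / qvar ^ k - 1)
    * (1 - qvar ^ 2 * qvar ^ n * qvar ^ k) * (1 - qvar ^ 2 * qvar ^ n / qvar ^ k)"], goal_cases)
  case (1 K k)
  define N where "N = qvar ^ n"
  have nz: "K \<noteq> 0" "N \<noteq> 0" using 1 by (simp_all add: N_def)
  show ?case
    unfolding power_Suc 1[symmetric] N_def[symmetric] using nz
    by (simp add: power_int_numeral) (simp add: divide_simps, Groebner_Basis.algebra)
qed simp

lemma bailey_sum_neg1:
  "0 * bailey_sum (-1) (n + 2) + qvar ^ 2 * qvar ^ n * bailey_sum (-1) (n + 1) + 1 * bailey_sum (-1) n =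
    0"
proof (rule bailey_sum_recurrence[where g = "\<lambda>k. - qvar * (qvar ^ k - (qvar ^ k) ^ 2)
    * (1 - qvar ^ 2 * qvar ^ n * qvar ^ k) * (1 - qvar ^ 2 * qvar ^ n / qvar ^ k)"], goal_cases)
  case (1 K k)
  define N where "N = qvar ^ n"
  have nz: "K \<noteq> 0" "N \<noteq> 0" using 1 by (simp_all add: N_def)
  show ?case
    unfolding power_Suc 1[symmetric] N_def[symmetric] using nz
    by (simp add: power_int_minus power_int_numeral) (simp add: divide_simps, Groebner_Basis.algebra)
qed simp

text \<open>Here the order is really two, and the certificate needs no factors that adapt the
  denominators.\<close>

lemma bailey_sum_pos2:
  "1 * bailey_sum 2 (n + 2)
   + (- (1 + qvar * (1 - qvar * qvar ^ n) + qvar ^ 4 * (qvar ^ n) ^ 2)) * bailey_sum 2 (n + 1)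
   + qvar * (1 - qvar * qvar ^ n) * bailey_sum 2 n = 0"
proof (rule bailey_sum_recurrence[where g = "\<lambda>k. - (qvar ^ 4 * (qvar ^ n) ^ 2 * (1 - qvar * qvar
  ^ n))
    * (1 / (qvar ^ k) ^ 2 - 1 / qvar ^ k)"], goal_cases)
  case (1 K k)
  define N where "N = qvar ^ n"
  have nz: "K \<noteq> 0" "N \<noteq> 0" using 1 by (simp_all add: N_def)
  show ?case
    unfolding power_Suc 1[symmetric] N_def[symmetric] using nz
    by (simp add: power_int_numeral) (simp add: divide_simps, Groebner_Basis.algebra)
qed simp

lemma bailey_sum_neg2:
  "qvar ^ 5 * (qvar ^ n) ^ 2 * bailey_sum (-2) (n + 2)
   + qvar ^ 2 * qvar ^ n * (1 + 1 / qvar - 1 / (qvar ^ 2 * qvar ^ n) + 1 / (qvar ^ 4 * (qvar ^ n) ^ 2))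
     * bailey_sum (-2) (n + 1)
   + (1 / qvar - 1 / (qvar ^ 2 * qvar ^ n)) * bailey_sum (-2) n = 0"
proof (rule bailey_sum_recurrence[where g = "\<lambda>k. (qvar ^ 2 * qvar ^ n - qvar)
    * ((qvar ^ k) ^ 2 - (qvar ^ k) ^ 3)"], goal_cases)
  case (1 K k)
  define N where "N = qvar ^ n"
  have nz: "K \<noteq> 0" "N \<noteq> 0" using 1 by (simp_all add: N_def)
  show ?case
    unfolding power_Suc 1[symmetric] N_def[symmetric] using nz
    by (simp add: power_int_minus power_int_numeral) (simp add: divide_simps, Groebner_Basis.algebra)
qed simp

lemma qpower_Suc_ne_1: "1 - qvar * qvar ^ n \<noteq> 0"
  by (metis right_minus_eq qvar_power_eq_1 power_Suc nat.simps(3))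

lemma cyclo_prefactor_Suc:
  "(-1) ^ Suc n * qvar powi (int (Suc n) * (int (Suc n) + 3) div 2)
     = - (qvar ^ 2 * qvar ^ n) * ((-1) ^ n * qvar powi (int n * (int n + 3) div 2))"
proof -
  have "int (Suc n) * (int (Suc n) + 3) = int n * (int n + 3) + (2 + int n) * 2"
    by (simp add: algebra_simps)
  then have e: "int (Suc n) * (int (Suc n) + 3) div 2 = int n * (int n + 3) div 2 + int (2 + n)"
    by simp
  show ?thesis unfolding e
    by (subst power_int_add, simp, simp only: power_int_of_nat power_add) simp
qed

lemma bailey_sum_0: "bailey_sum p 0 = 1"
proof -
  have "(1 - qvar) \<noteq> 0" using qpower_Suc_ne_1[of 0] by simp
  then show ?thesis
    by (simp add: bailey_sum_def bailey_term_def bailey_weight_def inv_qpoch_def qpoch_def field_simps)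
qed

text \<open>The second initial value for the recurrences of order two.\<close>

lemma bailey_sum_1: "bailey_sum p 1 = (1 - qvar powi (2 * p)) / (1 - qvar ^ 2)"
proof -
  have nz: "1 - qvar \<noteq> 0" "1 - qvar ^ 2 \<noteq> 0" "1 - qvar ^ 3 \<noteq> 0"
    using qpower_Suc_ne_1[of 0] qpower_Suc_ne_1[of 1] qpower_Suc_ne_1[of 2]
    by (simp_all add: numeral_2_eq_2 numeral_3_eq_3)
  have w: "bailey_weight p 0 = 1" "bailey_weight p 1 = - (qvar powi (2 * p))"
    by (simp_all add: bailey_weight_def mult.commute)
  have p: "qpoch qvar 0 = 1" "qpoch qvar 1 = 1 - qvar" "qpoch qvar 2 = (1 - qvar) * (1 - qvar ^ 2)"
    "qpoch qvar 3 = (1 - qvar) * (1 - qvar ^ 2) * (1 - qvar ^ 3)"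
    by (simp_all add: qpoch_def numeral_2_eq_2 numeral_3_eq_3)
  have i: "inv_qpoch 0 = 1" "inv_qpoch 1 = 1 / (1 - qvar)" "inv_qpoch 2 = 1 / ((1 - qvar) * (1 - qvar ^
    2))"
    "inv_qpoch 3 = 1 / ((1 - qvar) * (1 - qvar ^ 2) * (1 - qvar ^ 3))"
    using p by (simp_all add: inv_qpoch_def)
  have 0: "bailey_term p 1 0 = 1 / (1 - qvar ^ 2)"
    unfolding bailey_term_def using nz by (simp add: w i p[simplified])
  have 1: "bailey_term p 1 1 = - (qvar powi (2 * p)) / (1 - qvar ^ 2)"
    unfolding bailey_term_def using nz by (simp add: w[simplified] i p[simplified]) (simp add:
      divide_simps, simp add: algebra_simps)
  have "bailey_sum p 1 = bailey_term p 1 0 + bailey_term p 1 1"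
    by (simp add: bailey_sum_def)
  then show ?thesis unfolding 0 1 by (simp add: diff_divide_distrib)
qed

lemma cyclo_jones_0: "cyclo_jones p 0 = 1"
  by (simp add: cyclo_jones_bailey_sum bailey_sum_0)

lemma cyclo_jones_1: "cyclo_jones p 1 = - (qvar ^ 2 * (1 - qvar powi (2 * p)) / (1 - qvar ^ 2))"
  by (simp add: cyclo_jones_bailey_sum bailey_sum_1[simplified])

lemma cyclo_jones_pos1_Suc: "cyclo_jones 1 (Suc n) = - (qvar ^ 2 * qvar ^ n) * cyclo_jones 1 n"
  unfolding cyclo_jones_bailey_sum cyclo_prefactor_Suc using bailey_sum_pos1[of n] by simp

text \<open>The ratio \<open>- (qvar ^ 2 * qvar ^ n)\<close> of consecutive prefactors is the
  inverse of the ratio of consecutive Bailey sums, so the coefficients are constant: the well-known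
  cyclotomic expansion of the figure eight knot.\<close>

lemma cyclo_jones_neg1: "cyclo_jones (-1) n = 1"
proof (induction n)
  case (Suc n)
  have "bailey_sum (-1) n = - (qvar ^ 2 * qvar ^ n) * bailey_sum (-1) (Suc n)"
    using bailey_sum_neg1[of n] by (simp add: eq_neg_iff_add_eq_0 add.commute)
  then have "cyclo_jones (-1) (Suc n) = cyclo_jones (-1) n"
    unfolding cyclo_jones_bailey_sum cyclo_prefactor_Suc by simp
  then show ?case using Suc by simp
qed (rule cyclo_jones_0)

lemma cyclo_jones_pos2:
  fixes n defines "K \<equiv> qvar ^ n"
  shows "cyclo_jones 2 (Suc (Suc n)) = - (qvar ^ 3 * K * (1 + qvar - qvar ^ 2 * K + qvar ^ 4 * K ^ 2)) *
    cyclo_jones 2 (Suc n)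
    - qvar ^ 6 * K ^ 2 * (1 - qvar * K) * cyclo_jones 2 n"
proof -
  define s where "s = (-1) ^ n * qvar powi (int n * (int n + 3) div 2)"
  have 0: "cyclo_jones 2 n = s * bailey_sum 2 n"
    by (simp add: cyclo_jones_bailey_sum s_def)
  have 1: "cyclo_jones 2 (Suc n) = - (qvar ^ 2 * K) * s * bailey_sum 2 (Suc n)"
    unfolding cyclo_jones_bailey_sum cyclo_prefactor_Suc s_def K_def by simp
  \<comment> \<open>q^5 K^2 = (q^2 K)(q^3 K) is the product of two consecutive prefactor ratios;
    their signs cancel.\<close>
  have 2: "cyclo_jones 2 (Suc (Suc n)) = (qvar ^ 5 * K ^ 2) * s * bailey_sum 2 (Suc (Suc n))"
    unfolding cyclo_jones_bailey_sum cyclo_prefactor_Suc s_def K_def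
    by (simp add: power2_eq_square power_numeral_reduce)
  have "bailey_sum 2 (Suc (Suc n)) - (1 + qvar * (1 - qvar * K) + qvar ^ 4 * K ^ 2) * bailey_sum 2 (Suc
    n)
    + qvar * (1 - qvar * K) * bailey_sum 2 n = 0"
    using bailey_sum_pos2[of n] unfolding K_def[symmetric] by (simp add: algebra_simps)
  then show ?thesis unfolding 0 1 2 by Groebner_Basis.algebra
qed

lemma cyclo_jones_neg2:
  fixes n defines "K \<equiv> qvar ^ n"
  shows "cyclo_jones (-2) (Suc (Suc n)) = (1 + 1 / qvar - 1 / (qvar ^ 2 * K) + 1 / (qvar ^ 4 * K ^ 2)) *
    cyclo_jones (-2) (Suc n)
    - (1 / qvar - 1 / (qvar ^ 2 * K)) * cyclo_jones (-2) n"
proof -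
  define s where "s = (-1) ^ n * qvar powi (int n * (int n + 3) div 2)"
  have 0: "cyclo_jones (-2) n = s * bailey_sum (-2) n"
    by (simp add: cyclo_jones_bailey_sum s_def)
  have 1: "cyclo_jones (-2) (Suc n) = - (qvar ^ 2 * K) * s * bailey_sum (-2) (Suc n)"
    unfolding cyclo_jones_bailey_sum cyclo_prefactor_Suc s_def K_def by simp
  have 2: "cyclo_jones (-2) (Suc (Suc n)) = (qvar ^ 5 * K ^ 2) * s * bailey_sum (-2) (Suc (Suc n))"
    unfolding cyclo_jones_bailey_sum cyclo_prefactor_Suc s_def K_def
    by (simp add: power2_eq_square power_numeral_reduce)
  define a b where "a = 1 + 1 / qvar - 1 / (qvar ^ 2 * K) + 1 / (qvar ^ 4 * K ^ 2)"
    and "b = 1 / qvar - 1 / (qvar ^ 2 * K)"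
  have "qvar ^ 5 * K ^ 2 * bailey_sum (-2) (Suc (Suc n)) + qvar ^ 2 * K * a * bailey_sum (-2) (Suc n)
    + b * bailey_sum (-2) n = 0"
    using bailey_sum_neg2[of n] unfolding K_def[symmetric] a_def[symmetric] b_def[symmetric] by simp
  then show ?thesis
    unfolding 0 1 2 a_def[symmetric] b_def[symmetric] by Groebner_Basis.algebra
qed

lemma cyclo_jones_pos2_1: "cyclo_jones 2 (Suc 0) = - (qvar ^ 2 * (1 + qvar ^ 2))"
proof -
  have nz: "1 - qvar ^ 2 \<noteq> 0" using qpower_Suc_ne_1[of 1] by (simp add: power2_eq_square)
  have "1 - qvar ^ 4 = (1 - qvar ^ 2) * (1 + qvar ^ 2)" by Groebner_Basis.algebra
  then show ?thesis using cyclo_jones_1[of 2] nz by (simp add: power_int_numeral)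
qed

lemma cyclo_jones_neg2_1: "cyclo_jones (- 2) (Suc 0) = (1 + qvar ^ 2) / qvar ^ 2"
proof -
  have nz: "1 - qvar ^ 2 \<noteq> 0" using qpower_Suc_ne_1[of 1] by (simp add: power2_eq_square)
  have "1 - 1 / qvar ^ 4 = - ((1 - qvar ^ 2) * (1 + qvar ^ 2) / qvar ^ 4)"
    by (simp add: divide_simps) Groebner_Basis.algebra
  then show ?thesis using cyclo_jones_1[of "-2"] nz
    by (simp add: power_int_minus power_int_numeral inverse_eq_divide) (simp add: field_simps
      power4_eq_xxxx power2_eq_square)
qed

section \<open>First-order systems\<close>

text \<open>Below, \<open>xa\<close> and \<open>ya\<close> refer to the sums with weight
  \<open>q\<^sup>a\<^sup>k\<close> of the cyclotomic coefficients at
  \<open>k\<close> and at \<open>k + 1\<close>. Their shifts in \<open>n\<close> are reduced to finitely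
    many of them modulo telescoping sums;
  \<open>u\<close> collects the multipliers of the telescoping sums used.\<close>

definition jones_sum :: "int \<Rightarrow> nat \<Rightarrow> nat \<Rightarrow> nat \<Rightarrow> ratfun"
  where
  "jones_sum p a s n = kernel_sum (\<lambda>k. (qvar ^ k) ^ a * cyclo_jones p (k + s)) n"

lemma colored_jones_eq_jones_sum: "n \<ge> 1 \<Longrightarrow> colored_jones p n = jones_sum p 0 0 n"
  by (simp add: colored_jones_eq_kernel_sum jones_sum_def)

section \<open>The trefoil, p = 1: one sum\<close>

definition "step_pos1_x0_x0 (q :: ratfun) Q = - (q ^ 2 * Q ^ 3) + q ^ 2 * Q ^ 4"
text \<open>Naming scheme: after the knot comes the sum at n + 1 that is expressed, then the sum at
  n that carries the coefficient; a final \<open>1\<close> marks the inhomogeneous part.\<close>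

definition "step_pos1_x0_1 (q :: ratfun) Q = Q - q * Q ^ 3"

text \<open>With the recurrence of order one the shifted weight is a quadratic polynomial in K = q^k
  times the coefficient at k. Telescoping with \<open>u\<close> removes K and K^2, so this single
  sum is closed under the shift.\<close>

lemma jones_sum_pos1_X0_Suc:
  assumes "n \<ge> 1"
  defines "q \<equiv> qvar" and "Q \<equiv> qvar ^ n"
  shows "1 * ((1 - q * Q) * jones_sum 1 0 0 (Suc n)) =
    step_pos1_x0_x0 q Q * jones_sum 1 0 0 n + step_pos1_x0_1 q Q"
proof -
  define u where "u k = (let K = qvar ^ k in
    ((1 - Q - q * Q * K - q * Q ^ 2 + q * Q ^ 2 * K + q * Q ^ 3) * cyclo_jones 1 k) / K)" for k
  define g where "g = (\<lambda>k. step_pos1_x0_x0 q Q * ((qvar ^ k) ^ 0 * cyclo_jones 1 (k + 0)))"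
  have nz: "q \<noteq> 0" "Q \<noteq> 0" by (simp_all add: q_def Q_def)
  have "shifted_weight (\<lambda>k. ((qvar ^ k) ^ 0 * cyclo_jones 1 (k + 0))) n k
    = g k + u (Suc k) * kernel_factor n k - u k" for k
  proof -
    define K where "K = qvar ^ k"
    have nzK: "K \<noteq> 0" by (simp add: K_def)
    define w0 where "w0 = cyclo_jones 1 k"
    note rec = cyclo_jones_pos1_Suc[of k, folded K_def q_def w0_def]
    show ?thesis
      unfolding shifted_weight_def kernel_factor_def g_def u_def step_pos1_x0_x0_def Let_def add_Suc
        add_Suc_right add_0_right One_nat_def power_Suc
      unfolding K_def[symmetric] Q_def[symmetric] unfolding q_def[symmetric] w0_def[symmetric] rec
      using nz nzK by (simp add: divide_simps) Groebner_Basis.algebra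
  qed
  from kernel_sum_step[OF assms(1) this]
  have e: "(1 - q * Q) * jones_sum 1 0 0 (Suc n)
    = (1 - q * Q) * ((qvar ^ 0) ^ 0 * cyclo_jones 1 (0 + 0)) - u 0
      + (step_pos1_x0_x0 q Q * jones_sum 1 0 0 n)"
    unfolding jones_sum_def q_def Q_def g_def kernel_sum_add kernel_sum_scale .
  \<comment> \<open>The inhomogeneous part is pure boundary: the term k = 0 split off by the shift
    of n, minus \<open>u 0\<close> from the telescoping.\<close>
  show ?thesis unfolding e u_def step_pos1_x0_1_def Let_def using nz
    by (simp add: cyclo_jones_0 q_def[symmetric])
qed

lemmas step_pos1_defs =
  step_pos1_x0_x0_def step_pos1_x0_1_def

section \<open>The figure eight knot, p = -1: two sums\<close>

definition "step_neg1_x0_x0 (q :: ratfun) Q = 1 - 2 * Q + Q ^ 2 - q * Q ^ 2 + q * Q ^ 3"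
definition "step_neg1_x0_x1 (q :: ratfun) Q = - (q * Q) + q * Q ^ 2 + q ^ 2 * Q ^ 3 - q ^ 2 * Q ^ 4"
definition "step_neg1_x0_1 (q :: ratfun) Q = Q - q * Q ^ 3"

text \<open>All cyclotomic coefficients are 1, so the shifted weight is a combination of 1/K, 1 and
  K. The multiplier \<open>u\<close>, independent of k, is determined by cancelling 1/K; the
  remaining K forces the second sum x1.\<close>

lemma jones_sum_neg1_X0_Suc:
  assumes "n \<ge> 1"
  defines "q \<equiv> qvar" and "Q \<equiv> qvar ^ n"
  shows "Q ^ 2 * ((1 - q * Q) * jones_sum (- 1) 0 0 (Suc n)) =
    step_neg1_x0_x0 q Q * jones_sum (- 1) 0 0 n + step_neg1_x0_x1 q Q * jones_sum (- 1) 1 0 n +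
    step_neg1_x0_1 q Q"
proof -
  define u where "u k = (let K = qvar ^ k in
    ((- (1) + Q) * cyclo_jones (- 1) k) / Q)" for k
  define g where "g = (\<lambda>k. step_neg1_x0_x0 q Q / (Q ^ 2) * ((qvar ^ k) ^ 0 * cyclo_jones (- 1)
    (k + 0)) + step_neg1_x0_x1 q
    Q / (Q ^ 2) * ((qvar ^ k) ^ 1 * cyclo_jones (- 1) (k + 0)))"
  have nz: "q \<noteq> 0" "Q \<noteq> 0" by (simp_all add: q_def Q_def)
  have "shifted_weight (\<lambda>k. ((qvar ^ k) ^ 0 * cyclo_jones (- 1) (k + 0))) n k
    = g k + u (Suc k) * kernel_factor n k - u k" for k
  proof -
    define K where "K = qvar ^ k"
    have nzK: "K \<noteq> 0" by (simp add: K_def)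
    define w0 where "w0 = cyclo_jones (- 1) k"
    note rec = cyclo_jones_neg1
    show ?thesis
      unfolding shifted_weight_def kernel_factor_def g_def u_def step_neg1_x0_x0_def step_neg1_x0_x1_def
        Let_def add_Suc add_Suc_right add_0_right One_nat_def power_Suc
      unfolding K_def[symmetric] Q_def[symmetric] unfolding q_def[symmetric] w0_def[symmetric] rec
      using nz nzK by (simp add: divide_simps) Groebner_Basis.algebra
  qed
  from kernel_sum_step[OF assms(1) this]
  have e: "(1 - q * Q) * jones_sum (- 1) 0 0 (Suc n)
    = (1 - q * Q) * ((qvar ^ 0) ^ 0 * cyclo_jones (- 1) (0 + 0)) - u 0
      + (step_neg1_x0_x0 q Q / (Q ^ 2) * jones_sum (- 1) 0 0 n + step_neg1_x0_x1 q Q / (Q ^ 2) *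
      jones_sum (- 1) 1 0 n)"
    unfolding jones_sum_def q_def Q_def g_def kernel_sum_add kernel_sum_scale .
  show ?thesis unfolding e u_def step_neg1_x0_1_def Let_def using nz
    by (simp add: cyclo_jones_0 cyclo_jones_neg1 q_def[symmetric]) (simp add: divide_simps,
      Groebner_Basis.algebra)
qed

definition "step_neg1_x1_x0 (q :: ratfun) Q = 1 - Q - q * Q ^ 2 + q * Q ^ 3"
definition "step_neg1_x1_x1 (q :: ratfun) Q = - (q * Q) + q * Q ^ 3 + q ^ 2 * Q ^ 3 - q ^ 2 * Q ^ 4"
definition "step_neg1_x1_1 (q :: ratfun) Q = Q - q * Q ^ 3"

text \<open>Now the powers are 1, K and K^2, and \<open>u\<close>, a multiple of K, is determined by
  cancelling K^2. The system closes with x0 and x1.\<close>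

lemma jones_sum_neg1_X1_Suc:
  assumes "n \<ge> 1"
  defines "q \<equiv> qvar" and "Q \<equiv> qvar ^ n"
  shows "Q * ((1 - q * Q) * jones_sum (- 1) 1 0 (Suc n)) =
    step_neg1_x1_x0 q Q * jones_sum (- 1) 0 0 n + step_neg1_x1_x1 q Q * jones_sum (- 1) 1 0 n +
    step_neg1_x1_1 q Q"
proof -
  define u where "u k = (let K = qvar ^ k in
    ((- (q * Q * K) + q * Q ^ 2 * K) * cyclo_jones (- 1) k) / 1)" for k
  define g where "g = (\<lambda>k. step_neg1_x1_x0 q Q / (Q) * ((qvar ^ k) ^ 0 * cyclo_jones (- 1) (k +
    0)) + step_neg1_x1_x1 q Q /
    (Q) * ((qvar ^ k) ^ 1 * cyclo_jones (- 1) (k + 0)))"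
  have nz: "q \<noteq> 0" "Q \<noteq> 0" by (simp_all add: q_def Q_def)
  have "shifted_weight (\<lambda>k. ((qvar ^ k) ^ 1 * cyclo_jones (- 1) (k + 0))) n k
    = g k + u (Suc k) * kernel_factor n k - u k" for k
  proof -
    define K where "K = qvar ^ k"
    have nzK: "K \<noteq> 0" by (simp add: K_def)
    define w0 where "w0 = cyclo_jones (- 1) k"
    note rec = cyclo_jones_neg1
    show ?thesis
      unfolding shifted_weight_def kernel_factor_def g_def u_def step_neg1_x1_x0_def step_neg1_x1_x1_def
        Let_def add_Suc add_Suc_right add_0_right One_nat_def power_Suc
      unfolding K_def[symmetric] Q_def[symmetric] unfolding q_def[symmetric] w0_def[symmetric] rec
      using nz nzK by (simp add: divide_simps) Groebner_Basis.algebra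
  qed
  from kernel_sum_step[OF assms(1) this]
  have e: "(1 - q * Q) * jones_sum (- 1) 1 0 (Suc n)
    = (1 - q * Q) * ((qvar ^ 0) ^ 1 * cyclo_jones (- 1) (0 + 0)) - u 0
      + (step_neg1_x1_x0 q Q / (Q) * jones_sum (- 1) 0 0 n + step_neg1_x1_x1 q Q / (Q) * jones_sum (- 1)
      1 0 n)"
    unfolding jones_sum_def q_def Q_def g_def kernel_sum_add kernel_sum_scale .
  show ?thesis unfolding e u_def step_neg1_x1_1_def Let_def using nz
    by (simp add: cyclo_jones_0 cyclo_jones_neg1 q_def[symmetric]) (simp add: divide_simps,
      Groebner_Basis.algebra)
qed

lemmas step_neg1_defs =
  step_neg1_x0_x0_def step_neg1_x0_x1_def step_neg1_x0_1_def step_neg1_x1_x0_def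
  step_neg1_x1_x1_def step_neg1_x1_1_def

section \<open>The knot 5_2, p = 2: three sums\<close>

definition "step_pos2_x0_x0 (q :: ratfun) Q = - (Q) + Q ^ 2"
definition "step_pos2_x0_y0 (q :: ratfun) Q = 1 - Q - q * Q ^ 2 + q * Q ^ 3"
definition "step_pos2_x0_y1 (q :: ratfun) Q = - (q * Q) + q * Q ^ 2 + q ^ 2 * Q ^ 3 - q ^ 2 * Q ^ 4"
definition "step_pos2_x0_1 (q :: ratfun) Q = Q - q * Q ^ 3"

text \<open>The shifted weight is the coefficient at k + 1 times a combination of 1/K, 1 and K.
  Cancelling 1/K by \<open>u\<close> brings in the coefficient at k, which explains the sums x0, y0
  and y1.\<close>

lemma jones_sum_pos2_X0_Suc:
  assumes "n \<ge> 1"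
  defines "q \<equiv> qvar" and "Q \<equiv> qvar ^ n"
  shows "Q ^ 2 * ((1 - q * Q) * jones_sum 2 0 0 (Suc n)) =
    step_pos2_x0_x0 q Q * jones_sum 2 0 0 n + step_pos2_x0_y0 q Q * jones_sum 2 0 1 n +
    step_pos2_x0_y1 q Q * jones_sum 2 1 1 n + step_pos2_x0_1 q Q"
proof -
  define u where "u k = (let K = qvar ^ k in
    ((- (1) + Q) * cyclo_jones 2 k) / Q)" for k
  define g where "g = (\<lambda>k. step_pos2_x0_x0 q Q / (Q ^ 2) * ((qvar ^ k) ^ 0 * cyclo_jones 2 (k +
    0)) + step_pos2_x0_y0 q Q /
    (Q ^ 2) * ((qvar ^ k) ^ 0 * cyclo_jones 2 (k + 1)) + step_pos2_x0_y1 q Q / (Q ^ 2) * ((qvar ^ k)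
    ^ 1 * cyclo_jones 2 (k + 1)))"
  have nz: "q \<noteq> 0" "Q \<noteq> 0" by (simp_all add: q_def Q_def)
  have "shifted_weight (\<lambda>k. ((qvar ^ k) ^ 0 * cyclo_jones 2 (k + 0))) n k
    = g k + u (Suc k) * kernel_factor n k - u k" for k
  proof -
    define K where "K = qvar ^ k"
    have nzK: "K \<noteq> 0" by (simp add: K_def)
    define w0 w1 where "w0 = cyclo_jones 2 k" and "w1 = cyclo_jones 2 (Suc k)"
    note rec = cyclo_jones_pos2[of k, folded K_def q_def w0_def w1_def]
    show ?thesis
      unfolding shifted_weight_def kernel_factor_def g_def u_def step_pos2_x0_x0_def step_pos2_x0_y0_def
        step_pos2_x0_y1_def Let_def add_Suc add_Suc_right add_0_right One_nat_def power_Suc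
      unfolding K_def[symmetric] Q_def[symmetric] unfolding q_def[symmetric] w0_def[symmetric]
        w1_def[symmetric] rec
      using nz nzK by (simp add: divide_simps) Groebner_Basis.algebra
  qed
  from kernel_sum_step[OF assms(1) this]
  have e: "(1 - q * Q) * jones_sum 2 0 0 (Suc n)
    = (1 - q * Q) * ((qvar ^ 0) ^ 0 * cyclo_jones 2 (0 + 0)) - u 0
      + (step_pos2_x0_x0 q Q / (Q ^ 2) * jones_sum 2 0 0 n + step_pos2_x0_y0 q Q / (Q ^ 2) * jones_sum 2
      0 1 n + step_pos2_x0_y1 q Q / (Q ^ 2) * jones_sum 2 1 1 n)"
    unfolding jones_sum_def q_def Q_def g_def kernel_sum_add kernel_sum_scale .
  show ?thesis unfolding e u_def step_pos2_x0_1_def Let_def using nz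
    by (simp add: cyclo_jones_0 cyclo_jones_pos2_1 q_def[symmetric]) (simp add: divide_simps,
      Groebner_Basis.algebra)
qed

definition "step_pos2_y0_x0 (q :: ratfun) Q = - (q * Q) + q * Q ^ 2 - q ^ 3 * Q ^ 2 + q ^ 3 * Q ^ 4 + q
  ^ 4 * Q ^ 3 - q ^ 4 * Q ^ 4 + q ^ 4 *
  Q ^ 5 - q ^ 4 * Q ^ 6 + q ^ 4 * Q ^ 7 - q ^ 4 * Q ^ 8 - q ^ 5 * Q ^ 5 + 2 * q ^ 5 * Q ^ 6 - q ^
  5 * Q ^ 7"
definition "step_pos2_y0_y0 (q :: ratfun) Q = q - q * Q + q ^ 3 * Q - q ^ 3 * Q ^ 3 - q ^ 4 * Q ^ 2 + q
  ^ 4 * Q ^ 5 - q ^ 4 * Q ^ 6 + q ^ 4 *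
  Q ^ 7 - q ^ 4 * Q ^ 8 + q ^ 4 * Q ^ 9 + q ^ 5 * Q ^ 4 - q ^ 5 * Q ^ 5"
definition "step_pos2_y0_y1 (q :: ratfun) Q = - (q ^ 2 * Q) + q ^ 2 * Q ^ 2 - q ^ 4 * Q ^ 2 + q ^ 4 * Q
  ^ 4 + q ^ 5 * Q ^ 3 - q ^ 5 * Q ^ 6 +
  q ^ 5 * Q ^ 7 - q ^ 5 * Q ^ 8 - q ^ 6 * Q ^ 5 + q ^ 6 * Q ^ 6"
definition "step_pos2_y0_1 (q :: ratfun) Q = q * Q - q * Q ^ 2 - q ^ 2 * Q ^ 3 + q ^ 3 * Q ^ 2 + q ^ 3 *
  Q ^ 3 - q ^ 3 * Q ^ 4 - q ^ 4 * Q ^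
  3 - q ^ 4 * Q ^ 4 - q ^ 4 * Q ^ 5 + q ^ 4 * Q ^ 6 + q ^ 4 * Q ^ 8 + q ^ 5 * Q ^ 5"

text \<open>The weight contains the coefficient at k + 2, which the recurrence of order two turns
  into the coefficients at k and k + 1 times higher powers of K. Accordingly \<open>u\<close> has
  two parts, one for each coefficient, and the powers are lowered until only the three sums
  remain.\<close>

lemma jones_sum_pos2_Y0_Suc:
  assumes "n \<ge> 1"
  defines "q \<equiv> qvar" and "Q \<equiv> qvar ^ n"
  shows "Q * ((1 - q * Q) * jones_sum 2 0 1 (Suc n)) =
    step_pos2_y0_x0 q Q * jones_sum 2 0 0 n + step_pos2_y0_y0 q Q * jones_sum 2 0 1 n +
    step_pos2_y0_y1 q Q * jones_sum 2 1 1 n + step_pos2_y0_1 q Q"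
proof -
  define u where "u k = (let K = qvar ^ k in
    ((- (q * K ^ 3) + q * Q * K ^ 3 + q ^ 2 * Q ^ 2 * K - q ^ 2 * Q ^ 3 * K - q ^ 3 * Q * K ^ 3 - q
    ^ 3 * Q ^ 2 * K ^ 2 + q ^ 3 * Q ^ 3 * K ^ 3 - q ^ 3 * Q ^ 4 * K + q ^ 3 * Q ^ 4 * K ^ 2 + q ^ 3
    * Q ^ 5 * K + q ^ 4 * Q ^ 2 * K ^ 3 + q ^ 4 * Q ^ 4 * K ^ 2 - q ^ 4 * Q ^ 5 * K ^ 3 - q ^ 4 * Q
    ^ 6 * K ^ 2 + q ^ 4 * Q ^ 6 * K ^ 3 - q ^ 4 * Q ^ 7 * K ^ 3 - q ^ 5 * Q ^ 4 * K ^ 3 + q ^ 5 * Q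
    ^ 5 * K ^ 3) * cyclo_jones 2 k + (K ^ 2 + Q * K - Q * K ^ 2 + Q ^ 2 - Q ^ 2 * K - Q ^ 3 - q * Q
    * K ^ 3 - q * Q ^ 2 * K ^ 2 + q * Q ^ 2 * K ^ 3 - q * Q ^ 3 * K + q * Q ^ 3 * K ^ 2 - q * Q ^ 4
    + q * Q ^ 4 * K + q * Q ^ 5) * cyclo_jones 2 (Suc k)) / (K ^ 3))" for k
  define g where "g = (\<lambda>k. step_pos2_y0_x0 q Q / (Q) * ((qvar ^ k) ^ 0 * cyclo_jones 2 (k + 0))
    + step_pos2_y0_y0 q Q / (Q)
    * ((qvar ^ k) ^ 0 * cyclo_jones 2 (k + 1)) + step_pos2_y0_y1 q Q / (Q) * ((qvar ^ k) ^ 1 *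
    cyclo_jones 2 (k + 1)))"
  have nz: "q \<noteq> 0" "Q \<noteq> 0" by (simp_all add: q_def Q_def)
  have "shifted_weight (\<lambda>k. ((qvar ^ k) ^ 0 * cyclo_jones 2 (k + 1))) n k
    = g k + u (Suc k) * kernel_factor n k - u k" for k
  proof -
    define K where "K = qvar ^ k"
    have nzK: "K \<noteq> 0" by (simp add: K_def)
    define w0 w1 where "w0 = cyclo_jones 2 k" and "w1 = cyclo_jones 2 (Suc k)"
    note rec = cyclo_jones_pos2[of k, folded K_def q_def w0_def w1_def]
    show ?thesis
      unfolding shifted_weight_def kernel_factor_def g_def u_def step_pos2_y0_x0_def step_pos2_y0_y0_def
        step_pos2_y0_y1_def Let_def add_Suc add_Suc_right add_0_right One_nat_def power_Suc
      unfolding K_def[symmetric] Q_def[symmetric] unfolding q_def[symmetric] w0_def[symmetric]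
        w1_def[symmetric] rec
      using nz nzK by (simp add: divide_simps) Groebner_Basis.algebra
  qed
  from kernel_sum_step[OF assms(1) this]
  have e: "(1 - q * Q) * jones_sum 2 0 1 (Suc n)
    = (1 - q * Q) * ((qvar ^ 0) ^ 0 * cyclo_jones 2 (0 + 1)) - u 0
      + (step_pos2_y0_x0 q Q / (Q) * jones_sum 2 0 0 n + step_pos2_y0_y0 q Q / (Q) * jones_sum 2 0 1 n +
      step_pos2_y0_y1 q Q / (Q) * jones_sum 2 1 1 n)"
    unfolding jones_sum_def q_def Q_def g_def kernel_sum_add kernel_sum_scale .
  show ?thesis unfolding e u_def step_pos2_y0_1_def Let_def using nz
    by (simp add: cyclo_jones_0 cyclo_jones_pos2_1 q_def[symmetric]) (simp add: divide_simps,
      Groebner_Basis.algebra)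
qed

definition "step_pos2_y1_x0 (q :: ratfun) Q = - (q * Q) + q * Q ^ 2 - q ^ 3 * Q ^ 2 + q ^ 3 * Q ^ 4 + q
  ^ 4 * Q ^ 3 - q ^ 4 * Q ^ 4 + q ^ 4 *
  Q ^ 5 - q ^ 4 * Q ^ 6 + q ^ 4 * Q ^ 7 - q ^ 4 * Q ^ 8 - q ^ 5 * Q ^ 5 + 2 * q ^ 5 * Q ^ 6 - q ^
  5 * Q ^ 7"
definition "step_pos2_y1_y0 (q :: ratfun) Q = 1 - Q + q - q * Q + q ^ 3 * Q - q ^ 3 * Q ^ 3 - q ^ 4 * Q
  ^ 2 + q ^ 4 * Q ^ 5 - q ^ 4 * Q ^ 6 +
  q ^ 4 * Q ^ 7 - q ^ 4 * Q ^ 8 + q ^ 4 * Q ^ 9 + q ^ 5 * Q ^ 4 - q ^ 5 * Q ^ 5"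
definition "step_pos2_y1_y1 (q :: ratfun) Q = - (q * Q) + q * Q ^ 2 - q ^ 2 * Q + q ^ 2 * Q ^ 2 - q ^ 4
  * Q ^ 2 + q ^ 4 * Q ^ 4 + q ^ 5 * Q ^
  3 - q ^ 5 * Q ^ 6 + q ^ 5 * Q ^ 7 - q ^ 5 * Q ^ 8 - q ^ 6 * Q ^ 5 + q ^ 6 * Q ^ 6"
definition "step_pos2_y1_1 (q :: ratfun) Q = q * Q - q * Q ^ 2 - q ^ 2 * Q ^ 3 + q ^ 3 * Q ^ 2 + q ^ 3 *
  Q ^ 3 - q ^ 3 * Q ^ 4 - q ^ 4 * Q ^
  3 - q ^ 4 * Q ^ 4 - q ^ 4 * Q ^ 5 + q ^ 4 * Q ^ 6 + q ^ 4 * Q ^ 8 + q ^ 5 * Q ^ 5"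

text \<open>Modulo the lemma for y0 this says, with primes for n + 1, (1 - qQ)(y1' - Q y0') = (1 -
  Q)(y0 - qQ y1). The same identity holds for p = -2, both for y1, y0 and for x1, x0.\<close>

lemma jones_sum_pos2_Y1_Suc:
  assumes "n \<ge> 1"
  defines "q \<equiv> qvar" and "Q \<equiv> qvar ^ n"
  shows "1 * ((1 - q * Q) * jones_sum 2 1 1 (Suc n)) =
    step_pos2_y1_x0 q Q * jones_sum 2 0 0 n + step_pos2_y1_y0 q Q * jones_sum 2 0 1 n +
    step_pos2_y1_y1 q Q * jones_sum 2 1 1 n + step_pos2_y1_1 q Q"
proof -
  define u where "u k = (let K = qvar ^ k in
    ((- (q * Q * K ^ 3) + q * Q ^ 2 * K ^ 3 + q ^ 2 * Q ^ 3 * K - q ^ 2 * Q ^ 4 * K - q ^ 3 * Q ^ 2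
    * K ^ 3 - q ^ 3 * Q ^ 3 * K ^ 2 + q ^ 3 * Q ^ 4 * K ^ 3 - q ^ 3 * Q ^ 5 * K + q ^ 3 * Q ^ 5 * K
    ^ 2 + q ^ 3 * Q ^ 6 * K + q ^ 4 * Q ^ 3 * K ^ 3 + q ^ 4 * Q ^ 5 * K ^ 2 - q ^ 4 * Q ^ 6 * K ^ 3
    - q ^ 4 * Q ^ 7 * K ^ 2 + q ^ 4 * Q ^ 7 * K ^ 3 - q ^ 4 * Q ^ 8 * K ^ 3 - q ^ 5 * Q ^ 5 * K ^ 3
    + q ^ 5 * Q ^ 6 * K ^ 3) * cyclo_jones 2 k + (K ^ 3 + Q * K ^ 2 - Q * K ^ 3 + Q ^ 2 * K - Q ^ 2
    * K ^ 2 + Q ^ 3 - Q ^ 3 * K - Q ^ 4 - q * Q * K ^ 4 - q * Q ^ 2 * K ^ 3 + q * Q ^ 2 * K ^ 4 - q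
    * Q ^ 3 * K ^ 2 + q * Q ^ 3 * K ^ 3 - q * Q ^ 4 * K + q * Q ^ 4 * K ^ 2 - q * Q ^ 5 + q * Q ^ 5
    * K + q * Q ^ 6) * cyclo_jones 2 (Suc k)) / (K ^ 3))" for k
  define g where "g = (\<lambda>k. step_pos2_y1_x0 q Q * ((qvar ^ k) ^ 0 * cyclo_jones 2 (k + 0)) +
    step_pos2_y1_y0 q Q * ((qvar ^
    k) ^ 0 * cyclo_jones 2 (k + 1)) + step_pos2_y1_y1 q Q * ((qvar ^ k) ^ 1 * cyclo_jones 2 (k + 1)))"
  have nz: "q \<noteq> 0" "Q \<noteq> 0" by (simp_all add: q_def Q_def)
  have "shifted_weight (\<lambda>k. ((qvar ^ k) ^ 1 * cyclo_jones 2 (k + 1))) n k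
    = g k + u (Suc k) * kernel_factor n k - u k" for k
  proof -
    define K where "K = qvar ^ k"
    have nzK: "K \<noteq> 0" by (simp add: K_def)
    define w0 w1 where "w0 = cyclo_jones 2 k" and "w1 = cyclo_jones 2 (Suc k)"
    note rec = cyclo_jones_pos2[of k, folded K_def q_def w0_def w1_def]
    show ?thesis
      unfolding shifted_weight_def kernel_factor_def g_def u_def step_pos2_y1_x0_def step_pos2_y1_y0_def
        step_pos2_y1_y1_def Let_def add_Suc add_Suc_right add_0_right One_nat_def power_Suc
      unfolding K_def[symmetric] Q_def[symmetric] unfolding q_def[symmetric] w0_def[symmetric]
        w1_def[symmetric] rec
      using nz nzK by (simp add: divide_simps) Groebner_Basis.algebra
  qed
  from kernel_sum_step[OF assms(1) this]
  have e: "(1 - q * Q) * jones_sum 2 1 1 (Suc n)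
    = (1 - q * Q) * ((qvar ^ 0) ^ 1 * cyclo_jones 2 (0 + 1)) - u 0
      + (step_pos2_y1_x0 q Q * jones_sum 2 0 0 n + step_pos2_y1_y0 q Q * jones_sum 2 0 1 n +
      step_pos2_y1_y1 q Q * jones_sum 2 1 1 n)"
    unfolding jones_sum_def q_def Q_def g_def kernel_sum_add kernel_sum_scale .
  show ?thesis unfolding e u_def step_pos2_y1_1_def Let_def using nz
    by (simp add: cyclo_jones_0 cyclo_jones_pos2_1 q_def[symmetric]) Groebner_Basis.algebra
qed

lemmas step_pos2_defs =
  step_pos2_x0_x0_def step_pos2_x0_y0_def step_pos2_x0_y1_def step_pos2_x0_1_def
  step_pos2_y0_x0_def step_pos2_y0_y0_def step_pos2_y0_y1_def step_pos2_y0_1_def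
  step_pos2_y1_x0_def step_pos2_y1_y0_def step_pos2_y1_y1_def step_pos2_y1_1_def

section \<open>The knot 6_1, p = -2: four sums\<close>

definition "step_neg2_x0_x0 (q :: ratfun) Q = - (Q) + Q ^ 2"
definition "step_neg2_x0_y0 (q :: ratfun) Q = 1 - Q - q * Q ^ 2 + q * Q ^ 3"
definition "step_neg2_x0_y1 (q :: ratfun) Q = - (q * Q) + q * Q ^ 2 + q ^ 2 * Q ^ 3 - q ^ 2 * Q ^ 4"
definition "step_neg2_x0_1 (q :: ratfun) Q = Q - q * Q ^ 3"

text \<open>The coefficients agree with those for p = 2, because only the cyclotomic coefficients at
  k and k + 1 occur here.\<close>

lemma jones_sum_neg2_X0_Suc:
  assumes "n \<ge> 1"
  defines "q \<equiv> qvar" and "Q \<equiv> qvar ^ n"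
  shows "Q ^ 2 * ((1 - q * Q) * jones_sum (- 2) 0 0 (Suc n)) =
    step_neg2_x0_x0 q Q * jones_sum (- 2) 0 0 n + step_neg2_x0_y0 q Q * jones_sum (- 2) 0 1 n +
    step_neg2_x0_y1 q Q * jones_sum (- 2) 1 1 n + step_neg2_x0_1 q Q"
proof -
  define u where "u k = (let K = qvar ^ k in
    ((- (1) + Q) * cyclo_jones (- 2) k) / Q)" for k
  define g where "g = (\<lambda>k. step_neg2_x0_x0 q Q / (Q ^ 2) * ((qvar ^ k) ^ 0 * cyclo_jones (- 2)
    (k + 0)) + step_neg2_x0_y0 q
    Q / (Q ^ 2) * ((qvar ^ k) ^ 0 * cyclo_jones (- 2) (k + 1)) + step_neg2_x0_y1 q Q / (Q ^ 2) *
    ((qvar ^ k) ^ 1 * cyclo_jones (- 2) (k + 1)))"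
  have nz: "q \<noteq> 0" "Q \<noteq> 0" by (simp_all add: q_def Q_def)
  have "shifted_weight (\<lambda>k. ((qvar ^ k) ^ 0 * cyclo_jones (- 2) (k + 0))) n k
    = g k + u (Suc k) * kernel_factor n k - u k" for k
  proof -
    define K where "K = qvar ^ k"
    have nzK: "K \<noteq> 0" by (simp add: K_def)
    define w0 w1 where "w0 = cyclo_jones (- 2) k" and "w1 = cyclo_jones (- 2) (Suc k)"
    note rec = cyclo_jones_neg2[of k, folded K_def q_def w0_def w1_def]
    show ?thesis
      unfolding shifted_weight_def kernel_factor_def g_def u_def step_neg2_x0_x0_def step_neg2_x0_y0_def
        step_neg2_x0_y1_def Let_def add_Suc add_Suc_right add_0_right One_nat_def power_Suc
      unfolding K_def[symmetric] Q_def[symmetric] unfolding q_def[symmetric] w0_def[symmetric]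
        w1_def[symmetric] rec
      using nz nzK by (simp add: divide_simps) Groebner_Basis.algebra
  qed
  from kernel_sum_step[OF assms(1) this]
  have e: "(1 - q * Q) * jones_sum (- 2) 0 0 (Suc n)
    = (1 - q * Q) * ((qvar ^ 0) ^ 0 * cyclo_jones (- 2) (0 + 0)) - u 0
      + (step_neg2_x0_x0 q Q / (Q ^ 2) * jones_sum (- 2) 0 0 n + step_neg2_x0_y0 q Q / (Q ^ 2) *
      jones_sum (- 2) 0 1 n + step_neg2_x0_y1 q Q / (Q ^ 2) * jones_sum (- 2) 1 1 n)"
    unfolding jones_sum_def q_def Q_def g_def kernel_sum_add kernel_sum_scale .
  show ?thesis unfolding e u_def step_neg2_x0_1_def Let_def using nz
    by (simp add: cyclo_jones_0 cyclo_jones_neg2_1 q_def[symmetric]) (simp add: divide_simps,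
      Groebner_Basis.algebra)
qed

definition "step_neg2_x1_x1 (q :: ratfun) Q = - (q * Q ^ 2) + q * Q ^ 3"
definition "step_neg2_x1_y0 (q :: ratfun) Q = 1 - Q - q * Q ^ 2 + q * Q ^ 3"
definition "step_neg2_x1_y1 (q :: ratfun) Q = - (q * Q) + q * Q ^ 2 + q ^ 2 * Q ^ 3 - q ^ 2 * Q ^ 4"
definition "step_neg2_x1_1 (q :: ratfun) Q = Q - q * Q ^ 3"

text \<open>For p = -2 the recurrence of the cyclotomic coefficients has the denominators K and K^2.
  Reducing the weights of y0 and y1 then also leaves K times the coefficient at k, so x1 joins the
  system and needs its own step.\<close>

lemma jones_sum_neg2_X1_Suc:
  assumes "n \<ge> 1"
  defines "q \<equiv> qvar" and "Q \<equiv> qvar ^ n"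
  shows "Q * ((1 - q * Q) * jones_sum (- 2) 1 0 (Suc n)) =
    step_neg2_x1_x1 q Q * jones_sum (- 2) 1 0 n + step_neg2_x1_y0 q Q * jones_sum (- 2) 0 1 n +
    step_neg2_x1_y1 q Q * jones_sum (- 2) 1 1 n + step_neg2_x1_1 q Q"
proof -
  define u where "u k = (let K = qvar ^ k in
    ((- (q * Q * K) + q * Q ^ 2 * K) * cyclo_jones (- 2) k) / 1)" for k
  define g where "g = (\<lambda>k. step_neg2_x1_x1 q Q / (Q) * ((qvar ^ k) ^ 1 * cyclo_jones (- 2) (k +
    0)) + step_neg2_x1_y0 q Q /
    (Q) * ((qvar ^ k) ^ 0 * cyclo_jones (- 2) (k + 1)) + step_neg2_x1_y1 q Q / (Q) * ((qvar ^ k) ^ 1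
    * cyclo_jones (- 2) (k + 1)))"
  have nz: "q \<noteq> 0" "Q \<noteq> 0" by (simp_all add: q_def Q_def)
  have "shifted_weight (\<lambda>k. ((qvar ^ k) ^ 1 * cyclo_jones (- 2) (k + 0))) n k
    = g k + u (Suc k) * kernel_factor n k - u k" for k
  proof -
    define K where "K = qvar ^ k"
    have nzK: "K \<noteq> 0" by (simp add: K_def)
    define w0 w1 where "w0 = cyclo_jones (- 2) k" and "w1 = cyclo_jones (- 2) (Suc k)"
    note rec = cyclo_jones_neg2[of k, folded K_def q_def w0_def w1_def]
    show ?thesis
      unfolding shifted_weight_def kernel_factor_def g_def u_def step_neg2_x1_x1_def step_neg2_x1_y0_def
        step_neg2_x1_y1_def Let_def add_Suc add_Suc_right add_0_right One_nat_def power_Suc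
      unfolding K_def[symmetric] Q_def[symmetric] unfolding q_def[symmetric] w0_def[symmetric]
        w1_def[symmetric] rec
      using nz nzK by (simp add: divide_simps) Groebner_Basis.algebra
  qed
  from kernel_sum_step[OF assms(1) this]
  have e: "(1 - q * Q) * jones_sum (- 2) 1 0 (Suc n)
    = (1 - q * Q) * ((qvar ^ 0) ^ 1 * cyclo_jones (- 2) (0 + 0)) - u 0
      + (step_neg2_x1_x1 q Q / (Q) * jones_sum (- 2) 1 0 n + step_neg2_x1_y0 q Q / (Q) * jones_sum (- 2)
      0 1 n + step_neg2_x1_y1 q Q / (Q) * jones_sum (- 2) 1 1 n)"
    unfolding jones_sum_def q_def Q_def g_def kernel_sum_add kernel_sum_scale .
  show ?thesis unfolding e u_def step_neg2_x1_1_def Let_def using nz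
    by (simp add: cyclo_jones_0 cyclo_jones_neg2_1 q_def[symmetric]) (simp add: divide_simps,
      Groebner_Basis.algebra)
qed

definition "step_neg2_y0_x0 (q :: ratfun) Q = - (Q) + Q ^ 2 + q ^ 2 * Q ^ 5 - q ^ 2 * Q ^ 6"
definition "step_neg2_y0_x1 (q :: ratfun) Q = q ^ 2 * Q ^ 3 - q ^ 2 * Q ^ 4 - q ^ 3 * Q ^ 5 + q ^ 3 * Q
  ^ 6"
definition "step_neg2_y0_y0 (q :: ratfun) Q = 1 - Q - q * Q + q * Q ^ 2 + q ^ 2 * Q ^ 2 - q ^ 2 * Q ^ 3
  - q ^ 2 * Q ^ 4 + q ^ 2 * Q ^ 5 - q ^
  3 * Q ^ 4 + q ^ 3 * Q ^ 5"
definition "step_neg2_y0_y1 (q :: ratfun) Q = - (q * Q) + q * Q ^ 2 + q ^ 2 * Q ^ 2 - q ^ 2 * Q ^ 3 - q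
  ^ 3 * Q ^ 3 + 2 * q ^ 3 * Q ^ 5 - q ^
  3 * Q ^ 6 + q ^ 4 * Q ^ 5 - q ^ 4 * Q ^ 6"
definition "step_neg2_y0_1 (q :: ratfun) Q = Q - q * Q ^ 2 + q ^ 2 * Q ^ 3 + q ^ 2 * Q ^ 4 - q ^ 2 * Q ^
  5 - q ^ 3 * Q ^ 5"

lemma jones_sum_neg2_Y0_Suc:
  assumes "n \<ge> 1"
  defines "q \<equiv> qvar" and "Q \<equiv> qvar ^ n"
  shows "q ^ 2 * Q ^ 4 * ((1 - q * Q) * jones_sum (- 2) 0 1 (Suc n)) =
    step_neg2_y0_x0 q Q * jones_sum (- 2) 0 0 n + step_neg2_y0_x1 q Q * jones_sum (- 2) 1 0 n +
    step_neg2_y0_y0 q Q * jones_sum (- 2) 0 1 n + step_neg2_y0_y1 q Q * jones_sum (- 2) 1 1 n +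
    step_neg2_y0_1 q Q"
proof -
  define u where "u k = (let K = qvar ^ k in
    ((- (K) - Q + Q * K + Q ^ 2 + q * Q * K + q * Q ^ 3 - q * Q ^ 3 * K - q * Q ^ 4 - q ^ 2 * Q ^ 3
    * K + q ^ 2 * Q ^ 4 * K) * cyclo_jones (- 2) k + (- (q ^ 2 * Q ^ 2 * K) + q ^ 2 * Q ^ 3 * K) *
    cyclo_jones (- 2) (Suc k)) / (q ^ 2 * Q ^ 3 * K))" for k
  define g where "g = (\<lambda>k. step_neg2_y0_x0 q Q / (q ^ 2 * Q ^ 4) * ((qvar ^ k) ^ 0 * cyclo_jones
    (- 2) (k + 0)) +
    step_neg2_y0_x1 q Q / (q ^ 2 * Q ^ 4) * ((qvar ^ k) ^ 1 * cyclo_jones (- 2) (k + 0)) +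
    step_neg2_y0_y0 q Q / (q ^ 2 * Q ^ 4) * ((qvar ^ k) ^ 0 * cyclo_jones (- 2) (k + 1)) +
    step_neg2_y0_y1 q Q / (q ^ 2 * Q ^ 4) * ((qvar ^ k) ^ 1 * cyclo_jones (- 2) (k + 1)))"
  have nz: "q \<noteq> 0" "Q \<noteq> 0" by (simp_all add: q_def Q_def)
  have "shifted_weight (\<lambda>k. ((qvar ^ k) ^ 0 * cyclo_jones (- 2) (k + 1))) n k
    = g k + u (Suc k) * kernel_factor n k - u k" for k
  proof -
    define K where "K = qvar ^ k"
    have nzK: "K \<noteq> 0" by (simp add: K_def)
    define w0 w1 where "w0 = cyclo_jones (- 2) k" and "w1 = cyclo_jones (- 2) (Suc k)"
    note rec = cyclo_jones_neg2[of k, folded K_def q_def w0_def w1_def]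
    show ?thesis
      unfolding shifted_weight_def kernel_factor_def g_def u_def step_neg2_y0_x0_def step_neg2_y0_x1_def
        step_neg2_y0_y0_def step_neg2_y0_y1_def Let_def add_Suc add_Suc_right add_0_right One_nat_def
        power_Suc
      unfolding K_def[symmetric] Q_def[symmetric] unfolding q_def[symmetric] w0_def[symmetric]
        w1_def[symmetric] rec
      using nz nzK by (simp add: divide_simps) Groebner_Basis.algebra
  qed
  from kernel_sum_step[OF assms(1) this]
  have e: "(1 - q * Q) * jones_sum (- 2) 0 1 (Suc n)
    = (1 - q * Q) * ((qvar ^ 0) ^ 0 * cyclo_jones (- 2) (0 + 1)) - u 0
      + (step_neg2_y0_x0 q Q / (q ^ 2 * Q ^ 4) * jones_sum (- 2) 0 0 n + step_neg2_y0_x1 q Q / (q ^ 2 *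
        Q
      ^ 4) * jones_sum (- 2) 1 0 n + step_neg2_y0_y0 q Q / (q ^ 2 * Q ^ 4) * jones_sum (- 2) 0 1 n +
      step_neg2_y0_y1 q Q / (q ^ 2 * Q ^ 4) * jones_sum (- 2) 1 1 n)"
    unfolding jones_sum_def q_def Q_def g_def kernel_sum_add kernel_sum_scale .
  show ?thesis unfolding e u_def step_neg2_y0_1_def Let_def using nz
    by (simp add: cyclo_jones_0 cyclo_jones_neg2_1 q_def[symmetric]) (simp add: divide_simps,
      Groebner_Basis.algebra)
qed

definition "step_neg2_y1_x0 (q :: ratfun) Q = - (Q) + Q ^ 2 + q ^ 2 * Q ^ 5 - q ^ 2 * Q ^ 6"
definition "step_neg2_y1_x1 (q :: ratfun) Q = q ^ 2 * Q ^ 3 - q ^ 2 * Q ^ 4 - q ^ 3 * Q ^ 5 + q ^ 3 * Q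
  ^ 6"
definition "step_neg2_y1_y0 (q :: ratfun) Q = 1 - Q - q * Q + q * Q ^ 2 + q ^ 2 * Q ^ 2 - 2 * q ^ 2 * Q
  ^ 4 + q ^ 2 * Q ^ 5 - q ^ 3 * Q ^ 4 +
  q ^ 3 * Q ^ 5"
definition "step_neg2_y1_y1 (q :: ratfun) Q = - (q * Q) + q * Q ^ 2 + q ^ 2 * Q ^ 2 - q ^ 2 * Q ^ 3 - q
  ^ 3 * Q ^ 3 - q ^ 3 * Q ^ 4 + 3 * q ^
  3 * Q ^ 5 - q ^ 3 * Q ^ 6 + q ^ 4 * Q ^ 5 - q ^ 4 * Q ^ 6"
definition "step_neg2_y1_1 (q :: ratfun) Q = Q - q * Q ^ 2 + q ^ 2 * Q ^ 3 + q ^ 2 * Q ^ 4 - q ^ 2 * Q ^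
  5 - q ^ 3 * Q ^ 5"

lemma jones_sum_neg2_Y1_Suc:
  assumes "n \<ge> 1"
  defines "q \<equiv> qvar" and "Q \<equiv> qvar ^ n"
  shows "q ^ 2 * Q ^ 3 * ((1 - q * Q) * jones_sum (- 2) 1 1 (Suc n)) =
    step_neg2_y1_x0 q Q * jones_sum (- 2) 0 0 n + step_neg2_y1_x1 q Q * jones_sum (- 2) 1 0 n +
    step_neg2_y1_y0 q Q * jones_sum (- 2) 0 1 n + step_neg2_y1_y1 q Q * jones_sum (- 2) 1 1 n +
    step_neg2_y1_1 q Q"
proof -
  define u where "u k = (let K = qvar ^ k in
    ((- (K) - Q + Q * K + Q ^ 2 + q * Q * K + q * Q ^ 3 - q * Q ^ 3 * K - q * Q ^ 4 - q ^ 2 * Q ^ 3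
    * K + q ^ 2 * Q ^ 4 * K) * cyclo_jones (- 2) k + (- (q ^ 3 * Q ^ 3 * K ^ 2) + q ^ 3 * Q ^ 4 * K
    ^ 2) * cyclo_jones (- 2) (Suc k)) / (q ^ 2 * Q ^ 2 * K))" for k
  define g where "g = (\<lambda>k. step_neg2_y1_x0 q Q / (q ^ 2 * Q ^ 3) * ((qvar ^ k) ^ 0 * cyclo_jones
    (- 2) (k + 0)) +
    step_neg2_y1_x1 q Q / (q ^ 2 * Q ^ 3) * ((qvar ^ k) ^ 1 * cyclo_jones (- 2) (k + 0)) +
    step_neg2_y1_y0 q Q / (q ^ 2 * Q ^ 3) * ((qvar ^ k) ^ 0 * cyclo_jones (- 2) (k + 1)) +
    step_neg2_y1_y1 q Q / (q ^ 2 * Q ^ 3) * ((qvar ^ k) ^ 1 * cyclo_jones (- 2) (k + 1)))"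
  have nz: "q \<noteq> 0" "Q \<noteq> 0" by (simp_all add: q_def Q_def)
  have "shifted_weight (\<lambda>k. ((qvar ^ k) ^ 1 * cyclo_jones (- 2) (k + 1))) n k
    = g k + u (Suc k) * kernel_factor n k - u k" for k
  proof -
    define K where "K = qvar ^ k"
    have nzK: "K \<noteq> 0" by (simp add: K_def)
    define w0 w1 where "w0 = cyclo_jones (- 2) k" and "w1 = cyclo_jones (- 2) (Suc k)"
    note rec = cyclo_jones_neg2[of k, folded K_def q_def w0_def w1_def]
    show ?thesis
      unfolding shifted_weight_def kernel_factor_def g_def u_def step_neg2_y1_x0_def step_neg2_y1_x1_def
        step_neg2_y1_y0_def step_neg2_y1_y1_def Let_def add_Suc add_Suc_right add_0_right One_nat_def
        power_Suc
      unfolding K_def[symmetric] Q_def[symmetric] unfolding q_def[symmetric] w0_def[symmetric]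
        w1_def[symmetric] rec
      using nz nzK by (simp add: divide_simps) Groebner_Basis.algebra
  qed
  from kernel_sum_step[OF assms(1) this]
  have e: "(1 - q * Q) * jones_sum (- 2) 1 1 (Suc n)
    = (1 - q * Q) * ((qvar ^ 0) ^ 1 * cyclo_jones (- 2) (0 + 1)) - u 0
      + (step_neg2_y1_x0 q Q / (q ^ 2 * Q ^ 3) * jones_sum (- 2) 0 0 n + step_neg2_y1_x1 q Q / (q ^ 2 *
        Q
      ^ 3) * jones_sum (- 2) 1 0 n + step_neg2_y1_y0 q Q / (q ^ 2 * Q ^ 3) * jones_sum (- 2) 0 1 n +
      step_neg2_y1_y1 q Q / (q ^ 2 * Q ^ 3) * jones_sum (- 2) 1 1 n)"
    unfolding jones_sum_def q_def Q_def g_def kernel_sum_add kernel_sum_scale .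
  show ?thesis unfolding e u_def step_neg2_y1_1_def Let_def using nz
    by (simp add: cyclo_jones_0 cyclo_jones_neg2_1 q_def[symmetric]) (simp add: divide_simps,
      Groebner_Basis.algebra)
qed

lemmas step_neg2_defs =
  step_neg2_x0_x0_def step_neg2_x0_y0_def step_neg2_x0_y1_def step_neg2_x0_1_def
  step_neg2_x1_x1_def step_neg2_x1_y0_def step_neg2_x1_y1_def step_neg2_x1_1_def
  step_neg2_y0_x0_def step_neg2_y0_x1_def step_neg2_y0_y0_def step_neg2_y0_y1_def
  step_neg2_y0_1_def step_neg2_y1_x0_def step_neg2_y1_x1_def step_neg2_y1_y0_def
  step_neg2_y1_y1_def step_neg2_y1_1_def

section \<open>The inhomogeneous recurrences\<close>

text \<open>Generic in the ring, because the same list is read in Q(q) for the values at q^n, in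
  Z[q,Q] and Q(q,Q) for the operator, and in Z and the field with 11 elements for its
  specializations; ring homomorphisms carry one reading to the other.\<close>

definition recurrence_pos1 :: "'a::comm_ring_1 \<Rightarrow> 'a \<Rightarrow> 'a list" where
  "recurrence_pos1 q Q = [
      q^2 * Q^3 * (Q - 1),
      q * Q - 1]"

definition inhomogeneity_pos1 :: "'a::comm_ring_1 \<Rightarrow> 'a \<Rightarrow> 'a" where
  "inhomogeneity_pos1 q Q = (q * Q^2 - 1) * Q"

text \<open>Elimination from the top: the sums at \<open>n + i + 1\<close> with coefficients
  \<open>r\<close> (and \<open>a\<close>) are rewritten by the
  first-order system as sums at \<open>n + i\<close>. The factor \<open>1 - q\<^sup>i\<^sup>+\<^sup>1
    Q\<close> of each coefficient cancels the
  denominator of the system, and the powers of \<open>q\<close> and \<open>Q\<close> in \<open>m\<close>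
    make all identities polynomial.\<close>

lemma jones_recurrence_pos1:
  assumes "n \<ge> 1"
  shows "(\<Sum>i<length (recurrence_pos1 qvar (qvar ^ n)). recurrence_pos1 qvar (qvar ^ n) ! i *
    colored_jones 1 (n + i))
    = inhomogeneity_pos1 qvar (qvar ^ n)"
proof -
  define q Q where "q = qvar" and "Q = qvar ^ n"
  have nz: "q \<noteq> 0" "Q \<noteq> 0" by (simp_all add: q_def Q_def)
  define a0 where "a0 = recurrence_pos1 q Q ! 0"
  note a0_eq = a0_def[unfolded recurrence_pos1_def, simplified]
  define a1 where "a1 = recurrence_pos1 q Q ! 1"
  note a1_eq = a1_def[unfolded recurrence_pos1_def, simplified]
  define x0_0 where "x0_0 = jones_sum 1 0 0 n"
  define x0_1 where "x0_1 = jones_sum 1 0 0 (n + 1)"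
  note V_defs = q_def Q_def x0_0_def x0_1_def
  \<comment> \<open>The suffix i of a sum means its value at n + i. On such a sum, \<open>r\<close>
    is what the preceding step leaves, and \<open>s\<close> is the cofactor of 1 - q^i Q in
    \<open>r\<close> (plus the recurrence coefficient for x0). At the top nothing is left, so
    \<open>r\<close> is 0; here the top coefficient is qQ - 1, whence \<open>s\<close> is
    -1.\<close>
  define sx0_1 :: ratfun where "sx0_1 = - (1)"
  define rx0_1 :: ratfun where "rx0_1 = 0"
  define rx0_0 where "rx0_0 = - a0"
  define c0 where "c0 = - (Q) + q * Q ^ 3"
  have e0: "qvar ^ n = qvar ^ n" "Suc n = n + 1" "n \<ge> 1"
    using assms by (simp_all add: q_def Q_def power_add mult.commute power2_eq_square)
  define tx0_0 where "tx0_0 = sx0_1"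
  define m0 :: ratfun where "m0 = 1"
  have s0_x0_1: "1 * ((1 - q * Q) * x0_1) =
    step_pos1_x0_x0 q Q * x0_0 + step_pos1_x0_1 q Q"
    by (rule jones_sum_pos1_X0_Suc[OF e0(3), unfolded e0(2), folded V_defs])
  have l0_x0_1: "m0 * (rx0_1 + a1) = tx0_0 * (1 * (1 - q * Q))"
    unfolding m0_def rx0_1_def tx0_0_def sx0_1_def a1_eq by Groebner_Basis.algebra
  note D0 = m0_def c0_def a0_eq tx0_0_def sx0_1_def rx0_0_def step_pos1_defs
  have k0_x0_0: "tx0_0 * step_pos1_x0_x0 q Q = m0 * rx0_0"
    unfolding D0 by Groebner_Basis.algebra
  have k0_1: "tx0_0 * step_pos1_x0_1 q Q = m0 * c0"
    unfolding D0 by Groebner_Basis.algebra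
  have h0: "(rx0_1 + a1) * x0_1 = rx0_0 * x0_0 + c0"
  proof -
    have "m0 * ((rx0_1 + a1) * x0_1) = (m0 * (rx0_1 + a1)) * x0_1"
      by (simp only: distrib_left distrib_right mult.assoc)
    also have "\<dots> = tx0_0 * (1 * ((1 - q * Q) * x0_1))"
      unfolding l0_x0_1 by (simp only: mult.assoc)
    also have "\<dots> = (tx0_0 * step_pos1_x0_x0 q Q) * x0_0 + (tx0_0 * step_pos1_x0_1 q Q)"
      unfolding s0_x0_1 by (simp only: distrib_left distrib_right mult.assoc add_ac)
    also have "\<dots> = m0 * (rx0_0 * x0_0 + c0)"
      unfolding k0_x0_0 k0_1 by (simp only: distrib_left mult.assoc mult_zero_left add_0_left
        add_0_right)
    finally show ?thesis using nz by (simp add: m0_def)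
  qed
  have t0: "a1 * x0_1 = rx0_0 * x0_0 + c0"
    using h0 by (simp add: rx0_1_def)
  have "a0 * x0_0 + (a1 * x0_1) = c0"
    unfolding t0 rx0_0_def by simp
  also have "\<dots> = inhomogeneity_pos1 q Q"
    unfolding inhomogeneity_pos1_def c0_def by Groebner_Basis.algebra
  finally have fin: "a0 * x0_0 + (a1 * x0_1) = inhomogeneity_pos1 q Q" .
  have L: "(\<Sum>i<2. f i) = f 0 + (f 1)" for f :: "nat \<Rightarrow> ratfun"
    by (simp add: eval_nat_numeral add.assoc)
  have len: "length (recurrence_pos1 q Q) = 2" by (simp add: recurrence_pos1_def)
  have J: "colored_jones 1 (n + 0) = x0_0" "colored_jones 1 (n + 1) = x0_1"
    using assms by (simp_all add: colored_jones_eq_jones_sum x0_0_def x0_1_def)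
  show ?thesis unfolding Q_def[symmetric] unfolding q_def[symmetric] len L J
    by (rule fin[unfolded a0_def a1_def])
qed

section \<open>Elimination for the figure eight knot\<close>

definition recurrence_neg1 :: "'a::comm_ring_1 \<Rightarrow> 'a \<Rightarrow> 'a list" where
  "recurrence_neg1 q Q = [
      q^2 * Q^2 * (Q - 1) * (q^3 * Q^2 - 1),
      - ((q * Q + 1) * (q^4 * Q^4 - q^3 * Q^3 - q^3 * Q^2 - q * Q - q * Q^2 + 1) * (q * Q - 1)^2),
      q^2 * Q^2 * (q * Q^2 - 1) * (q^2 * Q - 1)]"

definition inhomogeneity_neg1 :: "'a::comm_ring_1 \<Rightarrow> 'a \<Rightarrow> 'a" where
  "inhomogeneity_neg1 q Q = q * Q * (q^3 * Q^2 - 1) * (q * Q + 1) * (q * Q^2 - 1)"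

lemma jones_recurrence_neg1:
  assumes "n \<ge> 1"
  shows "(\<Sum>i<length (recurrence_neg1 qvar (qvar ^ n)). recurrence_neg1 qvar (qvar ^ n) ! i *
    colored_jones (- 1) (n + i))
    = inhomogeneity_neg1 qvar (qvar ^ n)"
proof -
  define q Q where "q = qvar" and "Q = qvar ^ n"
  have nz: "q \<noteq> 0" "Q \<noteq> 0" by (simp_all add: q_def Q_def)
  define Q1 where "Q1 = q * Q"
  define a0 where "a0 = recurrence_neg1 q Q ! 0"
  note a0_eq = a0_def[unfolded recurrence_neg1_def, simplified]
  define a1 where "a1 = recurrence_neg1 q Q ! 1"
  note a1_eq = a1_def[unfolded recurrence_neg1_def, simplified]
  define a2 where "a2 = recurrence_neg1 q Q ! 2"
  note a2_eq = a2_def[unfolded recurrence_neg1_def, simplified]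
  define x0_0 where "x0_0 = jones_sum (- 1) 0 0 n"
  define x1_0 where "x1_0 = jones_sum (- 1) 1 0 n"
  define x0_1 where "x0_1 = jones_sum (- 1) 0 0 (n + 1)"
  define x1_1 where "x1_1 = jones_sum (- 1) 1 0 (n + 1)"
  define x0_2 where "x0_2 = jones_sum (- 1) 0 0 (n + 2)"
  define x1_2 where "x1_2 = jones_sum (- 1) 1 0 (n + 2)"
  note V_defs = q_def Q_def x0_0_def x1_0_def x0_1_def x1_1_def x0_2_def x1_2_def
  define sx0_2 where "sx0_2 = q ^ 2 * Q ^ 2 - q ^ 3 * Q ^ 4"
  define rx0_2 :: ratfun where "rx0_2 = 0"
  define sx0_1 where "sx0_1 = q ^ 2 * Q ^ 2 + q ^ 2 * Q ^ 3 - q ^ 3 * Q ^ 4 - q ^ 5 * Q ^ 4 - q ^ 5 * Q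
    ^ 5 + q ^ 6 * Q ^ 6"
  \<comment> \<open>Defined backwards, so that \<open>rx0_1 + a1\<close> is visibly a multiple of 1
    - qQ. That this is what the step from n + 2 leaves on \<open>x0_1\<close> is the content of
    \<open>k1_x0_1\<close>.\<close>
  define rx0_1 where "rx0_1 = sx0_1 * (1 - q * Q) - a1"
  define sx1_1 where "sx1_1 = - (q ^ 2 * Q) + q ^ 3 * Q ^ 3 + q ^ 5 * Q ^ 3 - q ^ 6 * Q ^ 5"
  define rx1_1 where "rx1_1 = sx1_1 * (1 - q * Q)"
  define rx0_0 where "rx0_0 = - a0"
  define c1 where "c1 = q * Q - q ^ 2 * Q ^ 3 - q ^ 4 * Q ^ 3 + q ^ 5 * Q ^ 5"
  define c0 where "c0 = q ^ 2 * Q ^ 2 - q ^ 3 * Q ^ 4 - q ^ 5 * Q ^ 4 + q ^ 6 * Q ^ 6"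
  have e1: "qvar ^ (n + 1) = Q1" "Suc (n + 1) = n + 2" "(n + 1) \<ge> 1"
    using assms by (simp_all add: Q1_def q_def Q_def power_add mult.commute power2_eq_square)
  define tx0_1 where "tx0_1 = sx0_2"
  define m1 where "m1 = q ^ 2 * Q ^ 2"
  have s1_x0_2: "Q1 ^ 2 * ((1 - q * Q1) * x0_2) =
    step_neg1_x0_x0 q Q1 * x0_1 + step_neg1_x0_x1 q Q1 * x1_1 + step_neg1_x0_1 q Q1"
    by (rule jones_sum_neg1_X0_Suc[OF e1(3), unfolded e1(1,2), folded V_defs])
  have l1_x0_2: "m1 * (rx0_2 + a2) = tx0_1 * (Q1 ^ 2 * (1 - q * Q1))"
    unfolding m1_def rx0_2_def tx0_1_def Q1_def sx0_2_def a2_eq by Groebner_Basis.algebra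
  note D1 = m1_def c1_def a1_eq tx0_1_def sx0_2_def rx0_1_def rx1_1_def sx0_1_def sx1_1_def
    step_neg1_defs
    Q1_def
  have k1_x0_1: "tx0_1 * step_neg1_x0_x0 q Q1 = m1 * rx0_1"
    unfolding D1 by Groebner_Basis.algebra
  have k1_x1_1: "tx0_1 * step_neg1_x0_x1 q Q1 = m1 * rx1_1"
    unfolding D1 by Groebner_Basis.algebra
  have k1_1: "tx0_1 * step_neg1_x0_1 q Q1 = m1 * c1"
    unfolding D1 by Groebner_Basis.algebra
  have h1: "(rx0_2 + a2) * x0_2 = rx0_1 * x0_1 + rx1_1 * x1_1 + c1"
  proof -
    have "m1 * ((rx0_2 + a2) * x0_2) = (m1 * (rx0_2 + a2)) * x0_2"
      by (simp only: distrib_left distrib_right mult.assoc)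
    also have "\<dots> = tx0_1 * (Q1 ^ 2 * ((1 - q * Q1) * x0_2))"
      unfolding l1_x0_2 by (simp only: mult.assoc)
    also have "\<dots> = (tx0_1 * step_neg1_x0_x0 q Q1) * x0_1 + (tx0_1 * step_neg1_x0_x1 q Q1) * x1_1 +
      (tx0_1 *
      step_neg1_x0_1 q Q1)"
      unfolding s1_x0_2 by (simp only: distrib_left distrib_right mult.assoc add_ac)
    also have "\<dots> = m1 * (rx0_1 * x0_1 + rx1_1 * x1_1 + c1)"
      unfolding k1_x0_1 k1_x1_1 k1_1 by (simp only: distrib_left mult.assoc mult_zero_left add_0_left
        add_0_right)
    finally show ?thesis using nz by (simp add: m1_def)
  qed
  have e0: "qvar ^ n = qvar ^ n" "Suc n = n + 1" "n \<ge> 1"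
    using assms by (simp_all add: q_def Q_def power_add mult.commute power2_eq_square)
  define tx0_0 where "tx0_0 = sx0_1"
  define tx1_0 where "tx1_0 = Q * sx1_1"
  define m0 where "m0 = Q ^ 2"
  have s0_x0_1: "Q ^ 2 * ((1 - q * Q) * x0_1) =
    step_neg1_x0_x0 q Q * x0_0 + step_neg1_x0_x1 q Q * x1_0 + step_neg1_x0_1 q Q"
    by (rule jones_sum_neg1_X0_Suc[OF e0(3), unfolded e0(2), folded V_defs])
  have l0_x0_1: "m0 * (rx0_1 + a1) = tx0_0 * (Q ^ 2 * (1 - q * Q))"
    unfolding m0_def rx0_1_def tx0_0_def by Groebner_Basis.algebra
  have s0_x1_1: "Q * ((1 - q * Q) * x1_1) =
    step_neg1_x1_x0 q Q * x0_0 + step_neg1_x1_x1 q Q * x1_0 + step_neg1_x1_1 q Q"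
    by (rule jones_sum_neg1_X1_Suc[OF e0(3), unfolded e0(2), folded V_defs])
  have l0_x1_1: "m0 * rx1_1 = tx1_0 * (Q * (1 - q * Q))"
    unfolding m0_def rx1_1_def tx1_0_def by Groebner_Basis.algebra
  note D0 = m0_def c0_def a0_eq tx0_0_def tx1_0_def sx0_1_def sx1_1_def rx0_0_def step_neg1_defs
  have k0_x0_0: "tx0_0 * step_neg1_x0_x0 q Q + tx1_0 * step_neg1_x1_x0 q Q = m0 * rx0_0"
    unfolding D0 by Groebner_Basis.algebra
  \<comment> \<open>At the last level the auxiliary sum cancels: this is where the elimination
    succeeds and the coefficients of the stated relation are pinned down.\<close>
  have k0_x1_0: "tx0_0 * step_neg1_x0_x1 q Q + tx1_0 * step_neg1_x1_x1 q Q = 0"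
    unfolding D0 by Groebner_Basis.algebra
  have k0_1: "tx0_0 * step_neg1_x0_1 q Q + tx1_0 * step_neg1_x1_1 q Q = m0 * c0"
    unfolding D0 by Groebner_Basis.algebra
  have h0: "(rx0_1 + a1) * x0_1 + rx1_1 * x1_1 = rx0_0 * x0_0 + c0"
  proof -
    have "m0 * ((rx0_1 + a1) * x0_1 + rx1_1 * x1_1) = (m0 * (rx0_1 + a1)) * x0_1 + (m0 * rx1_1) * x1_1"
      by (simp only: distrib_left distrib_right mult.assoc)
    also have "\<dots> = tx0_0 * (Q ^ 2 * ((1 - q * Q) * x0_1)) + tx1_0 * (Q * ((1 - q * Q) * x1_1))"
      unfolding l0_x0_1 l0_x1_1 by (simp only: mult.assoc)
    also have "\<dots> = (tx0_0 * step_neg1_x0_x0 q Q + tx1_0 * step_neg1_x1_x0 q Q) * x0_0 + (tx0_0 *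
      step_neg1_x0_x1 q
      Q + tx1_0 * step_neg1_x1_x1 q Q) * x1_0 + (tx0_0 * step_neg1_x0_1 q Q + tx1_0 * step_neg1_x1_1 q
      Q)"
      unfolding s0_x0_1 s0_x1_1 by (simp only: distrib_left distrib_right mult.assoc add_ac)
    also have "\<dots> = m0 * (rx0_0 * x0_0 + c0)"
      unfolding k0_x0_0 k0_x1_0 k0_1 by (simp only: distrib_left mult.assoc mult_zero_left add_0_left
        add_0_right)
    finally show ?thesis using nz by (simp add: m0_def)
  qed
  have t1: "a2 * x0_2 = rx0_1 * x0_1 + rx1_1 * x1_1 + c1"
    using h1 by (simp add: rx0_2_def)
  \<comment> \<open>Adding the term of the recurrence at the current level turns the right side of
    one step into the left side of the next; only the constants \<open>c\<close> accumulate.\<close>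
  have t0: "a1 * x0_1 + (a2 * x0_2) = (rx0_0 * x0_0 + c0) + (c1)"
    unfolding t1 h0[symmetric] by (simp only: distrib_right add_ac)
  have "a0 * x0_0 + (a1 * x0_1 + (a2 * x0_2)) = c0 + (c1)"
    unfolding t0 rx0_0_def by simp
  also have "\<dots> = inhomogeneity_neg1 q Q"
    unfolding inhomogeneity_neg1_def c0_def c1_def by Groebner_Basis.algebra
  finally have fin: "a0 * x0_0 + (a1 * x0_1 + (a2 * x0_2)) = inhomogeneity_neg1 q Q" .
  have L: "(\<Sum>i<3. f i) = f 0 + (f 1 + (f 2))" for f :: "nat \<Rightarrow> ratfun"
    by (simp add: eval_nat_numeral add.assoc)
  have len: "length (recurrence_neg1 q Q) = 3" by (simp add: recurrence_neg1_def)
  have J: "colored_jones (- 1) (n + 0) = x0_0" "colored_jones (- 1) (n + 1) = x0_1" "colored_jones (- 1)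
    (n + 2) = x0_2"
    using assms by (simp_all add: colored_jones_eq_jones_sum x0_0_def x0_1_def x0_2_def)
  show ?thesis unfolding Q_def[symmetric] unfolding q_def[symmetric] len L J
    by (rule fin[unfolded a0_def a1_def a2_def])
qed

section \<open>Elimination for p = 2\<close>

definition recurrence_pos2 :: "'a::comm_ring_1 \<Rightarrow> 'a \<Rightarrow> 'a list" where
  "recurrence_pos2 q Q = [
      q^9 * Q^7 * (-1 + Q) * (q^4 * Q^2 - 1) * (q^5 * Q^2 - 1),
      - (q^5 * Q^2 * (q * Q - 1) * (q^2 * Q^2 - 1) * (q^5 * Q^2 - 1) * (q^6 * Q^5 - 2 * q^5 * Q^4 -
      q^5 * Q^3 + q^4 * Q^2 - q^3 * Q^2 - q^2 * Q^2 - q^2 * Q^3 + q * Q^2 + q * Q - 1)),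
      q * (q^2 * Q - 1) * (q * Q^2 - 1) * (q^4 * Q^2 - 1) * (q^9 * Q^5 - q^7 * Q^4 - q^7 * Q^3 + q^6 *
      Q^3 + q^5 * Q^3 + q^5 * Q^2 - q^4 * Q^3 + 2 * q^2 * Q + q^2 * Q^2 - 1),
      (q^3 * Q - 1) * (q * Q^2 - 1) * (q^2 * Q^2 - 1)]"

definition inhomogeneity_pos2 :: "'a::comm_ring_1 \<Rightarrow> 'a \<Rightarrow> 'a" where
  "inhomogeneity_pos2 q Q = (q * Q + 1) * (q * Q^2 - 1) * (q^2 * Q + 1) * (q^5 * Q^2 - 1) * (q^3 * Q^2 -
    1) * q^4 * Q^2"

lemma jones_recurrence_pos2:
  assumes "n \<ge> 1"
  shows "(\<Sum>i<length (recurrence_pos2 qvar (qvar ^ n)). recurrence_pos2 qvar (qvar ^ n) ! i *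
    colored_jones 2 (n + i))
    = inhomogeneity_pos2 qvar (qvar ^ n)"
proof -
  define q Q where "q = qvar" and "Q = qvar ^ n"
  have nz: "q \<noteq> 0" "Q \<noteq> 0" by (simp_all add: q_def Q_def)
  define Q1 where "Q1 = q * Q"
  define Q2 where "Q2 = q ^ 2 * Q"
  define b0 where "b0 = recurrence_pos2 q Q ! 0"
  note b0_eq = b0_def[unfolded recurrence_pos2_def, simplified]
  \<comment> \<open>The whole recurrence is scaled by q^4 Q^2, since otherwise the cofactors
    \<open>s\<close> would contain negative powers of q and Q. The factor is cancelled at the
    end.\<close>
  define a0 where "a0 = q ^ 4 * Q ^ 2 * b0"
  define b1 where "b1 = recurrence_pos2 q Q ! 1"
  note b1_eq = b1_def[unfolded recurrence_pos2_def, simplified]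
  define a1 where "a1 = q ^ 4 * Q ^ 2 * b1"
  define b2 where "b2 = recurrence_pos2 q Q ! 2"
  note b2_eq = b2_def[unfolded recurrence_pos2_def, simplified]
  define a2 where "a2 = q ^ 4 * Q ^ 2 * b2"
  define b3 where "b3 = recurrence_pos2 q Q ! 3"
  note b3_eq = b3_def[unfolded recurrence_pos2_def, simplified]
  define a3 where "a3 = q ^ 4 * Q ^ 2 * b3"
  define x0_0 where "x0_0 = jones_sum 2 0 0 n"
  define y0_0 where "y0_0 = jones_sum 2 0 1 n"
  define y1_0 where "y1_0 = jones_sum 2 1 1 n"
  define x0_1 where "x0_1 = jones_sum 2 0 0 (n + 1)"
  define y0_1 where "y0_1 = jones_sum 2 0 1 (n + 1)"
  define y1_1 where "y1_1 = jones_sum 2 1 1 (n + 1)"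
  define x0_2 where "x0_2 = jones_sum 2 0 0 (n + 2)"
  define y0_2 where "y0_2 = jones_sum 2 0 1 (n + 2)"
  define y1_2 where "y1_2 = jones_sum 2 1 1 (n + 2)"
  define x0_3 where "x0_3 = jones_sum 2 0 0 (n + 3)"
  define y0_3 where "y0_3 = jones_sum 2 0 1 (n + 3)"
  define y1_3 where "y1_3 = jones_sum 2 1 1 (n + 3)"
  note V_defs = q_def Q_def x0_0_def y0_0_def y1_0_def x0_1_def y0_1_def y1_1_def x0_2_def y0_2_def
    y1_2_def x0_3_def
    y0_3_def y1_3_def
  define sx0_3 where "sx0_3 = - (q ^ 4 * Q ^ 2) + q ^ 5 * Q ^ 4 + q ^ 6 * Q ^ 4 - q ^ 7 * Q ^ 6"
  define rx0_3 :: ratfun where "rx0_3 = 0"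
  define sx0_2 where "sx0_2 = q ^ 2 * Q - q ^ 3 * Q ^ 3 - q ^ 4 * Q ^ 3 + q ^ 5 * Q ^ 2 + q ^ 5 * Q ^ 5
    - q ^ 6 * Q ^ 4 - 2 *
    q ^ 7 * Q ^ 3 - q ^ 7 * Q ^ 4 + 2 * q ^ 8 * Q ^ 5 + q ^ 8 * Q ^ 6 - q ^ 9 * Q ^ 4 + q ^ 9 * Q ^
    5 - q ^ 10 * Q ^ 4 - q ^ 10 * Q ^ 5 + q ^ 10 * Q ^ 6 - q ^ 10 * Q ^ 7 + q ^ 11 * Q ^ 5 + 2 * q ^
    11 * Q ^ 6 + q ^ 11 * Q ^ 7 + q ^ 12 * Q ^ 5 + q ^ 12 * Q ^ 6 - q ^ 12 * Q ^ 7 - q ^ 12 * Q ^ 8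
    - 2 * q ^ 13 * Q ^ 7 - q ^ 13 * Q ^ 8 + q ^ 14 * Q ^ 6 + q ^ 14 * Q ^ 9 + q ^ 15 * Q ^ 7 - q ^
    15 * Q ^ 8 - q ^ 16 * Q ^ 7 - q ^ 16 * Q ^ 8 - q ^ 16 * Q ^ 9 + q ^ 17 * Q ^ 9 + q ^ 17 * Q ^ 10
    + q ^ 18 * Q ^ 9 - q ^ 19 * Q ^ 11"
  define rx0_2 where "rx0_2 = sx0_2 * (1 - q * Q1) - a2"
  define sy0_2 where "sy0_2 = - (1) + q * Q ^ 2 + q ^ 2 * Q ^ 2 - q ^ 3 * Q ^ 4 + q ^ 5 * Q ^ 2 - q ^ 6
    * Q ^ 4 - q ^ 7 * Q ^
    4 + q ^ 8 * Q ^ 6"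
  define ry0_2 where "ry0_2 = sy0_2 * (1 - q * Q1)"
  define sy1_2 where "sy1_2 = q ^ 3 * Q - q ^ 4 * Q ^ 3 - q ^ 5 * Q ^ 3 + q ^ 6 * Q ^ 5 - q ^ 8 * Q ^ 3
    + q ^ 9 * Q ^ 5 + q ^
    10 * Q ^ 5 - q ^ 11 * Q ^ 7"
  define ry1_2 where "ry1_2 = sy1_2 * (1 - q * Q1)"
  define sx0_1 where "sx0_1 = - (q ^ 13 * Q ^ 10) + q ^ 17 * Q ^ 12 + q ^ 18 * Q ^ 12 - q ^ 22 * Q ^ 14"
  define rx0_1 where "rx0_1 = sx0_1 * (1 - q * Q) - a1"
  define sy0_1 where "sy0_1 = - (q ^ 13 * Q ^ 9) + q ^ 14 * Q ^ 11 + q ^ 17 * Q ^ 11 + q ^ 18 * Q ^ 11 -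
    q ^ 18 * Q ^ 13 - q ^
    19 * Q ^ 13 - q ^ 22 * Q ^ 13 + q ^ 23 * Q ^ 15"
  define ry0_1 where "ry0_1 = sy0_1 * (1 - q * Q)"
  define sy1_1 where "sy1_1 = q ^ 13 * Q ^ 8 - q ^ 14 * Q ^ 10 - q ^ 17 * Q ^ 10 - q ^ 18 * Q ^ 10 + q ^
    18 * Q ^ 12 + q ^ 19
    * Q ^ 12 + q ^ 22 * Q ^ 12 - q ^ 23 * Q ^ 14"
  define ry1_1 where "ry1_1 = sy1_1 * (1 - q * Q)"
  define rx0_0 where "rx0_0 = - a0"
  define c2 where "c2 = - (q ^ 2 * Q) + q ^ 3 * Q ^ 3 + q ^ 4 * Q ^ 3 - q ^ 5 * Q ^ 5 + q ^ 7 * Q ^ 3 -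
    q ^ 8 * Q ^ 5 -
    q ^ 9 * Q ^ 5 + q ^ 10 * Q ^ 7"
  define c1 where "c1 = q ^ 2 * Q - q ^ 3 * Q ^ 3 - q ^ 4 * Q ^ 3 + q ^ 5 * Q ^ 5 - q ^ 7 * Q ^ 3 - q ^
    8 * Q ^ 4 + q ^
    8 * Q ^ 5 + q ^ 9 * Q ^ 6 - q ^ 10 * Q ^ 5 + q ^ 11 * Q ^ 7 + q ^ 12 * Q ^ 7 + q ^ 13 * Q ^ 6 +
    q ^ 13 * Q ^ 7 + q ^ 14 * Q ^ 7 - q ^ 14 * Q ^ 9 - q ^ 14 * Q ^ 11 + q ^ 15 * Q ^ 7 - q ^ 15 * Q
    ^ 9 - q ^ 15 * Q ^ 10 - q ^ 16 * Q ^ 9 - q ^ 17 * Q ^ 9 - q ^ 17 * Q ^ 11 - q ^ 18 * Q ^ 9 + q ^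
    18 * Q ^ 13 - q ^ 19 * Q ^ 10 + q ^ 19 * Q ^ 11 + q ^ 19 * Q ^ 13 + q ^ 20 * Q ^ 12 + q ^ 22 * Q
    ^ 13 - q ^ 23 * Q ^ 15"
  define c0 where "c0 = - (q ^ 13 * Q ^ 9) + q ^ 14 * Q ^ 11 + q ^ 17 * Q ^ 11 + q ^ 18 * Q ^ 11 - q ^
    18 * Q ^ 13 - q ^
    19 * Q ^ 13 - q ^ 22 * Q ^ 13 + q ^ 23 * Q ^ 15"
  have e2: "qvar ^ (n + 2) = Q2" "Suc (n + 2) = n + 3" "(n + 2) \<ge> 1"
    using assms by (simp_all add: Q2_def q_def Q_def power_add mult.commute power2_eq_square)
  define tx0_2 where "tx0_2 = sx0_3"
  define m2 where "m2 = q ^ 4 * Q ^ 2"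
  have s2_x0_3: "Q2 ^ 2 * ((1 - q * Q2) * x0_3) =
    step_pos2_x0_x0 q Q2 * x0_2 + step_pos2_x0_y0 q Q2 * y0_2 + step_pos2_x0_y1 q Q2 * y1_2 +
    step_pos2_x0_1 q Q2"
    by (rule jones_sum_pos2_X0_Suc[OF e2(3), unfolded e2(1,2), folded V_defs])
  have l2_x0_3: "m2 * (rx0_3 + a3) = tx0_2 * (Q2 ^ 2 * (1 - q * Q2))"
    unfolding m2_def rx0_3_def tx0_2_def Q2_def sx0_3_def a3_def b3_eq by Groebner_Basis.algebra
  note D2 = m2_def c2_def a2_def b2_eq tx0_2_def sx0_3_def rx0_2_def ry0_2_def ry1_2_def sx0_2_def
    sy0_2_def
    sy1_2_def step_pos2_defs Q2_def Q1_def
  have k2_x0_2: "tx0_2 * step_pos2_x0_x0 q Q2 = m2 * rx0_2"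
    unfolding D2 by Groebner_Basis.algebra
  have k2_y0_2: "tx0_2 * step_pos2_x0_y0 q Q2 = m2 * ry0_2"
    unfolding D2 by Groebner_Basis.algebra
  have k2_y1_2: "tx0_2 * step_pos2_x0_y1 q Q2 = m2 * ry1_2"
    unfolding D2 by Groebner_Basis.algebra
  have k2_1: "tx0_2 * step_pos2_x0_1 q Q2 = m2 * c2"
    unfolding D2 by Groebner_Basis.algebra
  have h2: "(rx0_3 + a3) * x0_3 = rx0_2 * x0_2 + ry0_2 * y0_2 + ry1_2 * y1_2 + c2"
  proof -
    have "m2 * ((rx0_3 + a3) * x0_3) = (m2 * (rx0_3 + a3)) * x0_3"
      by (simp only: distrib_left distrib_right mult.assoc)
    also have "\<dots> = tx0_2 * (Q2 ^ 2 * ((1 - q * Q2) * x0_3))"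
      unfolding l2_x0_3 by (simp only: mult.assoc)
    also have "\<dots> = (tx0_2 * step_pos2_x0_x0 q Q2) * x0_2 + (tx0_2 * step_pos2_x0_y0 q Q2) * y0_2 +
      (tx0_2 *
      step_pos2_x0_y1 q Q2) * y1_2 + (tx0_2 * step_pos2_x0_1 q Q2)"
      unfolding s2_x0_3 by (simp only: distrib_left distrib_right mult.assoc add_ac)
    also have "\<dots> = m2 * (rx0_2 * x0_2 + ry0_2 * y0_2 + ry1_2 * y1_2 + c2)"
      unfolding k2_x0_2 k2_y0_2 k2_y1_2 k2_1 by (simp only: distrib_left mult.assoc mult_zero_left
        add_0_left add_0_right)
    finally show ?thesis using nz by (simp add: m2_def)
  qed
  have e1: "qvar ^ (n + 1) = Q1" "Suc (n + 1) = n + 2" "(n + 1) \<ge> 1"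
    using assms by (simp_all add: Q1_def q_def Q_def power_add mult.commute power2_eq_square)
  define tx0_1 where "tx0_1 = sx0_2"
  define ty0_1 where "ty0_1 = q * Q * sy0_2"
  define ty1_1 where "ty1_1 = q ^ 2 * Q ^ 2 * sy1_2"
  define m1 where "m1 = q ^ 2 * Q ^ 2"
  have s1_x0_2: "Q1 ^ 2 * ((1 - q * Q1) * x0_2) =
    step_pos2_x0_x0 q Q1 * x0_1 + step_pos2_x0_y0 q Q1 * y0_1 + step_pos2_x0_y1 q Q1 * y1_1 +
    step_pos2_x0_1 q Q1"
    by (rule jones_sum_pos2_X0_Suc[OF e1(3), unfolded e1(1,2), folded V_defs])
  have l1_x0_2: "m1 * (rx0_2 + a2) = tx0_1 * (Q1 ^ 2 * (1 - q * Q1))"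
    unfolding m1_def rx0_2_def tx0_1_def Q1_def by Groebner_Basis.algebra
  have s1_y0_2: "Q1 * ((1 - q * Q1) * y0_2) =
    step_pos2_y0_x0 q Q1 * x0_1 + step_pos2_y0_y0 q Q1 * y0_1 + step_pos2_y0_y1 q Q1 * y1_1 +
    step_pos2_y0_1 q Q1"
    by (rule jones_sum_pos2_Y0_Suc[OF e1(3), unfolded e1(1,2), folded V_defs])
  have l1_y0_2: "m1 * ry0_2 = ty0_1 * (Q1 * (1 - q * Q1))"
    unfolding m1_def ry0_2_def ty0_1_def Q1_def by Groebner_Basis.algebra
  have s1_y1_2: "1 * ((1 - q * Q1) * y1_2) =
    step_pos2_y1_x0 q Q1 * x0_1 + step_pos2_y1_y0 q Q1 * y0_1 + step_pos2_y1_y1 q Q1 * y1_1 +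
    step_pos2_y1_1 q Q1"
    by (rule jones_sum_pos2_Y1_Suc[OF e1(3), unfolded e1(1,2), folded V_defs])
  have l1_y1_2: "m1 * ry1_2 = ty1_1 * (1 * (1 - q * Q1))"
    unfolding m1_def ry1_2_def ty1_1_def Q1_def by Groebner_Basis.algebra
  note D1 = m1_def c1_def a1_def b1_eq tx0_1_def ty0_1_def ty1_1_def sx0_2_def sy0_2_def sy1_2_def
    rx0_1_def
    ry0_1_def ry1_1_def sx0_1_def sy0_1_def sy1_1_def step_pos2_defs Q1_def
  have k1_x0_1: "tx0_1 * step_pos2_x0_x0 q Q1 + ty0_1 * step_pos2_y0_x0 q Q1 + ty1_1 * step_pos2_y1_x0 q
    Q1 = m1 * rx0_1"
    unfolding D1 by Groebner_Basis.algebra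
  have k1_y0_1: "tx0_1 * step_pos2_x0_y0 q Q1 + ty0_1 * step_pos2_y0_y0 q Q1 + ty1_1 * step_pos2_y1_y0 q
    Q1 = m1 * ry0_1"
    unfolding D1 by Groebner_Basis.algebra
  have k1_y1_1: "tx0_1 * step_pos2_x0_y1 q Q1 + ty0_1 * step_pos2_y0_y1 q Q1 + ty1_1 * step_pos2_y1_y1 q
    Q1 = m1 * ry1_1"
    unfolding D1 by Groebner_Basis.algebra
  have k1_1: "tx0_1 * step_pos2_x0_1 q Q1 + ty0_1 * step_pos2_y0_1 q Q1 + ty1_1 * step_pos2_y1_1 q Q1 =
    m1 * c1"
    unfolding D1 by Groebner_Basis.algebra
  have h1: "(rx0_2 + a2) * x0_2 + ry0_2 * y0_2 + ry1_2 * y1_2 = rx0_1 * x0_1 + ry0_1 * y0_1 + ry1_1 *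
    y1_1 + c1"
  proof -
    have "m1 * ((rx0_2 + a2) * x0_2 + ry0_2 * y0_2 + ry1_2 * y1_2) = (m1 * (rx0_2 + a2)) * x0_2 + (m1 *
      ry0_2) * y0_2 + (m1 * ry1_2) * y1_2"
      by (simp only: distrib_left distrib_right mult.assoc)
    also have "\<dots> = tx0_1 * (Q1 ^ 2 * ((1 - q * Q1) * x0_2)) + ty0_1 * (Q1 * ((1 - q * Q1) * y0_2))
      + ty1_1 * (1 *
      ((1 - q * Q1) * y1_2))"
      unfolding l1_x0_2 l1_y0_2 l1_y1_2 by (simp only: mult.assoc)
    also have "\<dots> = (tx0_1 * step_pos2_x0_x0 q Q1 + ty0_1 * step_pos2_y0_x0 q Q1 + ty1_1 *
      step_pos2_y1_x0 q Q1) *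
      x0_1 + (tx0_1 * step_pos2_x0_y0 q Q1 + ty0_1 * step_pos2_y0_y0 q Q1 + ty1_1 * step_pos2_y1_y0 q
      Q1) * y0_1 + (tx0_1 * step_pos2_x0_y1 q Q1 + ty0_1 * step_pos2_y0_y1 q Q1 + ty1_1 *
      step_pos2_y1_y1 q Q1) * y1_1 + (tx0_1 * step_pos2_x0_1 q Q1 + ty0_1 * step_pos2_y0_1 q Q1 +
      ty1_1 * step_pos2_y1_1 q Q1)"
      unfolding s1_x0_2 s1_y0_2 s1_y1_2 by (simp only: distrib_left distrib_right mult.assoc add_ac)
    also have "\<dots> = m1 * (rx0_1 * x0_1 + ry0_1 * y0_1 + ry1_1 * y1_1 + c1)"
      unfolding k1_x0_1 k1_y0_1 k1_y1_1 k1_1 by (simp only: distrib_left mult.assoc mult_zero_left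
        add_0_left add_0_right)
    finally show ?thesis using nz by (simp add: m1_def)
  qed
  have e0: "qvar ^ n = qvar ^ n" "Suc n = n + 1" "n \<ge> 1"
    using assms by (simp_all add: q_def Q_def power_add mult.commute power2_eq_square)
  define tx0_0 where "tx0_0 = sx0_1"
  define ty0_0 where "ty0_0 = Q * sy0_1"
  define ty1_0 where "ty1_0 = Q ^ 2 * sy1_1"
  define m0 where "m0 = Q ^ 2"
  have s0_x0_1: "Q ^ 2 * ((1 - q * Q) * x0_1) =
    step_pos2_x0_x0 q Q * x0_0 + step_pos2_x0_y0 q Q * y0_0 + step_pos2_x0_y1 q Q * y1_0 +
    step_pos2_x0_1 q Q"
    by (rule jones_sum_pos2_X0_Suc[OF e0(3), unfolded e0(2), folded V_defs])
  have l0_x0_1: "m0 * (rx0_1 + a1) = tx0_0 * (Q ^ 2 * (1 - q * Q))"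
    unfolding m0_def rx0_1_def tx0_0_def by Groebner_Basis.algebra
  have s0_y0_1: "Q * ((1 - q * Q) * y0_1) =
    step_pos2_y0_x0 q Q * x0_0 + step_pos2_y0_y0 q Q * y0_0 + step_pos2_y0_y1 q Q * y1_0 +
    step_pos2_y0_1 q Q"
    by (rule jones_sum_pos2_Y0_Suc[OF e0(3), unfolded e0(2), folded V_defs])
  have l0_y0_1: "m0 * ry0_1 = ty0_0 * (Q * (1 - q * Q))"
    unfolding m0_def ry0_1_def ty0_0_def by Groebner_Basis.algebra
  have s0_y1_1: "1 * ((1 - q * Q) * y1_1) =
    step_pos2_y1_x0 q Q * x0_0 + step_pos2_y1_y0 q Q * y0_0 + step_pos2_y1_y1 q Q * y1_0 +
    step_pos2_y1_1 q Q"
    by (rule jones_sum_pos2_Y1_Suc[OF e0(3), unfolded e0(2), folded V_defs])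
  have l0_y1_1: "m0 * ry1_1 = ty1_0 * (1 * (1 - q * Q))"
    unfolding m0_def ry1_1_def ty1_0_def by Groebner_Basis.algebra
  note D0 = m0_def c0_def a0_def b0_eq tx0_0_def ty0_0_def ty1_0_def sx0_1_def sy0_1_def sy1_1_def
    rx0_0_def
    step_pos2_defs
  have k0_x0_0: "tx0_0 * step_pos2_x0_x0 q Q + ty0_0 * step_pos2_y0_x0 q Q + ty1_0 * step_pos2_y1_x0 q Q
    = m0 * rx0_0"
    unfolding D0 by Groebner_Basis.algebra
  have k0_y0_0: "tx0_0 * step_pos2_x0_y0 q Q + ty0_0 * step_pos2_y0_y0 q Q + ty1_0 * step_pos2_y1_y0 q Q
    = 0"
    unfolding D0 by Groebner_Basis.algebra
  have k0_y1_0: "tx0_0 * step_pos2_x0_y1 q Q + ty0_0 * step_pos2_y0_y1 q Q + ty1_0 * step_pos2_y1_y1 q Q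
    = 0"
    unfolding D0 by Groebner_Basis.algebra
  have k0_1: "tx0_0 * step_pos2_x0_1 q Q + ty0_0 * step_pos2_y0_1 q Q + ty1_0 * step_pos2_y1_1 q Q = m0
    * c0"
    unfolding D0 by Groebner_Basis.algebra
  have h0: "(rx0_1 + a1) * x0_1 + ry0_1 * y0_1 + ry1_1 * y1_1 = rx0_0 * x0_0 + c0"
  proof -
    have "m0 * ((rx0_1 + a1) * x0_1 + ry0_1 * y0_1 + ry1_1 * y1_1) = (m0 * (rx0_1 + a1)) * x0_1 + (m0 *
      ry0_1) * y0_1 + (m0 * ry1_1) * y1_1"
      by (simp only: distrib_left distrib_right mult.assoc)
    also have "\<dots> = tx0_0 * (Q ^ 2 * ((1 - q * Q) * x0_1)) + ty0_0 * (Q * ((1 - q * Q) * y0_1)) +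
      ty1_0 * (1 * ((1 -
      q * Q) * y1_1))"
      unfolding l0_x0_1 l0_y0_1 l0_y1_1 by (simp only: mult.assoc)
    also have "\<dots> = (tx0_0 * step_pos2_x0_x0 q Q + ty0_0 * step_pos2_y0_x0 q Q + ty1_0 *
      step_pos2_y1_x0 q Q) * x0_0
      + (tx0_0 * step_pos2_x0_y0 q Q + ty0_0 * step_pos2_y0_y0 q Q + ty1_0 * step_pos2_y1_y0 q Q) *
      y0_0 + (tx0_0 * step_pos2_x0_y1 q Q + ty0_0 * step_pos2_y0_y1 q Q + ty1_0 * step_pos2_y1_y1 q Q)
      * y1_0 + (tx0_0 * step_pos2_x0_1 q Q + ty0_0 * step_pos2_y0_1 q Q + ty1_0 * step_pos2_y1_1 q Q)"
      unfolding s0_x0_1 s0_y0_1 s0_y1_1 by (simp only: distrib_left distrib_right mult.assoc add_ac)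
    also have "\<dots> = m0 * (rx0_0 * x0_0 + c0)"
      unfolding k0_x0_0 k0_y0_0 k0_y1_0 k0_1 by (simp only: distrib_left mult.assoc mult_zero_left
        add_0_left add_0_right)
    finally show ?thesis using nz by (simp add: m0_def)
  qed
  have t2: "a3 * x0_3 = rx0_2 * x0_2 + ry0_2 * y0_2 + ry1_2 * y1_2 + c2"
    using h2 by (simp add: rx0_3_def)
  have t1: "a2 * x0_2 + (a3 * x0_3) = (rx0_1 * x0_1 + ry0_1 * y0_1 + ry1_1 * y1_1 + c1) + (c2)"
    unfolding t2 h1[symmetric] by (simp only: distrib_right add_ac)
  have t0: "a1 * x0_1 + (a2 * x0_2 + (a3 * x0_3)) = (rx0_0 * x0_0 + c0) + (c1 + c2)"
    unfolding t1 h0[symmetric] by (simp only: distrib_right add_ac)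
  have "a0 * x0_0 + (a1 * x0_1 + (a2 * x0_2 + (a3 * x0_3))) = c0 + (c1 + c2)"
    unfolding t0 rx0_0_def by simp
  also have "\<dots> = q ^ 4 * Q ^ 2 * inhomogeneity_pos2 q Q"
    unfolding inhomogeneity_pos2_def c0_def c1_def c2_def by Groebner_Basis.algebra
  finally have "q ^ 4 * Q ^ 2 * (b0 * x0_0 + (b1 * x0_1 + (b2 * x0_2 + (b3 * x0_3)))) = q ^ 4 * Q ^ 2 *
    inhomogeneity_pos2 q Q"
    by (simp only: a0_def a1_def a2_def a3_def distrib_left mult.assoc)
  then have fin: "b0 * x0_0 + (b1 * x0_1 + (b2 * x0_2 + (b3 * x0_3))) = inhomogeneity_pos2 q Q" using nz
    by simp
  have L: "(\<Sum>i<4. f i) = f 0 + (f 1 + (f 2 + (f 3)))" for f :: "nat \<Rightarrow> ratfun"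
    by (simp add: eval_nat_numeral add.assoc)
  have len: "length (recurrence_pos2 q Q) = 4" by (simp add: recurrence_pos2_def)
  have J: "colored_jones 2 (n + 0) = x0_0" "colored_jones 2 (n + 1) = x0_1" "colored_jones 2 (n + 2) =
    x0_2" "colored_jones 2 (n + 3) = x0_3"
    using assms by (simp_all add: colored_jones_eq_jones_sum x0_0_def x0_1_def x0_2_def x0_3_def)
  show ?thesis unfolding Q_def[symmetric] unfolding q_def[symmetric] len L J
    by (rule fin[unfolded b0_def b1_def b2_def b3_def])
qed

section \<open>Elimination for p = -2\<close>

definition recurrence_neg2 :: "'a::comm_ring_1 \<Rightarrow> 'a \<Rightarrow> 'a list" where
  "recurrence_neg2 q Q = [
      (-1 + Q) * (q^5 * Q^2 - 1) * (q^6 * Q^2 - 1) * (q^7 * Q^2 - 1) * q^8 * Q^4,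
      - (q^5 * Q^2 * (q * Q - 1) * (q^6 * Q^2 - 1) * (q^7 * Q^2 - 1) * (q^2 * Q^2 - 1) * (q^9 * Q^6 -
      q^8 * Q^5 - q^8 * Q^4 + q^7 * Q^4 + q^7 * Q^3 + q^6 * Q^4 - q^6 * Q^3 - q^6 * Q^2 - q^5 * Q^3 -
      q^5 * Q^2 - q^4 * Q^4 + q^3 * Q^3 + q^3 * Q^2 - q^3 * Q - q^2 * Q^2 - 2 * q^2 * Q - q * Q^2 + q
      + 1)),
      q * (q^2 * Q - 1) * (q * Q^2 - 1) * (q^4 * Q^2 - 1) * (q^7 * Q^2 - 1) * (1 - q^3 * Q^2 - 2 * q^2
      * Q - q^3 * Q + q^5 * Q^2 + 2 * q^8 * Q^5 + 3 * q^8 * Q^4 - q^7 * Q^3 - q^6 * Q^4 - 2 * q^6 *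
      Q^3 - q^6 * Q^2 + q^5 * Q^3 - q^2 * Q^2 + q^5 * Q^4 + q^4 * Q^2 - q^10 * Q^6 - q^14 * Q^6 - q^11
      * Q^5 - q^15 * Q^7 - q^11 * Q^6 + q^12 * Q^6 + q^16 * Q^8 + q^13 * Q^5 + q^13 * Q^6 + q^9 * Q^5
      + q^9 * Q^3 + 2 * q^4 * Q^3 - 2 * q^14 * Q^7 + 3 * q^9 * Q^4 + 2 * q^8 * Q^3 - 2 * q^10 * Q^5 +
      2 * q^12 * Q^5),
      - ((q^3 * Q - 1) * (q^6 * Q^2 - 1) * (q^2 * Q^2 - 1) * (q * Q^2 - 1) * (q^16 * Q^6 + q^15 * Q^6
      - q^14 * Q^5 - 2 * q^13 * Q^5 - q^13 * Q^4 - q^12 * Q^4 + q^10 * Q^4 + q^10 * Q^3 - q^9 * Q^4 -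
      q^9 * Q^3 - q^8 * Q^4 - q^8 * Q^3 - q^7 * Q^2 + q^6 * Q^3 + q^6 * Q^2 + q^5 * Q^2 - q^3 * Q^2 -
      q^3 * Q + 1)),
      q^12 * Q^4 * (q^4 * Q - 1) * (q * Q^2 - 1) * (q^2 * Q^2 - 1) * (q^3 * Q^2 - 1)]"

definition inhomogeneity_neg2 :: "'a::comm_ring_1 \<Rightarrow> 'a \<Rightarrow> 'a" where
  "inhomogeneity_neg2 q Q = (q^3 * Q + 1) * (q^5 * Q^2 - 1) * (q^7 * Q^2 - 1) * q^6 * Q^2 * (q^2 * Q +
    1) * (q * Q + 1) * (q
      * Q^2 - 1) * (q^3 * Q^2 - 1)"

lemma jones_recurrence_neg2:
  assumes "n \<ge> 1"
  shows "(\<Sum>i<length (recurrence_neg2 qvar (qvar ^ n)). recurrence_neg2 qvar (qvar ^ n) ! i *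
    colored_jones (- 2) (n + i))
    = inhomogeneity_neg2 qvar (qvar ^ n)"
proof -
  define q Q where "q = qvar" and "Q = qvar ^ n"
  have nz: "q \<noteq> 0" "Q \<noteq> 0" by (simp_all add: q_def Q_def)
  define Q1 where "Q1 = q * Q"
  define Q2 where "Q2 = q ^ 2 * Q"
  define Q3 where "Q3 = q ^ 3 * Q"
  define a0 where "a0 = recurrence_neg2 q Q ! 0"
  note a0_eq = a0_def[unfolded recurrence_neg2_def, simplified]
  define a1 where "a1 = recurrence_neg2 q Q ! 1"
  note a1_eq = a1_def[unfolded recurrence_neg2_def, simplified]
  define a2 where "a2 = recurrence_neg2 q Q ! 2"
  note a2_eq = a2_def[unfolded recurrence_neg2_def, simplified]
  define a3 where "a3 = recurrence_neg2 q Q ! 3"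
  note a3_eq = a3_def[unfolded recurrence_neg2_def, simplified]
  define a4 where "a4 = recurrence_neg2 q Q ! 4"
  note a4_eq = a4_def[unfolded recurrence_neg2_def, simplified]
  define x0_0 where "x0_0 = jones_sum (- 2) 0 0 n"
  define x1_0 where "x1_0 = jones_sum (- 2) 1 0 n"
  define y0_0 where "y0_0 = jones_sum (- 2) 0 1 n"
  define y1_0 where "y1_0 = jones_sum (- 2) 1 1 n"
  define x0_1 where "x0_1 = jones_sum (- 2) 0 0 (n + 1)"
  define x1_1 where "x1_1 = jones_sum (- 2) 1 0 (n + 1)"
  define y0_1 where "y0_1 = jones_sum (- 2) 0 1 (n + 1)"
  define y1_1 where "y1_1 = jones_sum (- 2) 1 1 (n + 1)"
  define x0_2 where "x0_2 = jones_sum (- 2) 0 0 (n + 2)"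
  define x1_2 where "x1_2 = jones_sum (- 2) 1 0 (n + 2)"
  define y0_2 where "y0_2 = jones_sum (- 2) 0 1 (n + 2)"
  define y1_2 where "y1_2 = jones_sum (- 2) 1 1 (n + 2)"
  define x0_3 where "x0_3 = jones_sum (- 2) 0 0 (n + 3)"
  define x1_3 where "x1_3 = jones_sum (- 2) 1 0 (n + 3)"
  define y0_3 where "y0_3 = jones_sum (- 2) 0 1 (n + 3)"
  define y1_3 where "y1_3 = jones_sum (- 2) 1 1 (n + 3)"
  define x0_4 where "x0_4 = jones_sum (- 2) 0 0 (n + 4)"
  define x1_4 where "x1_4 = jones_sum (- 2) 1 0 (n + 4)"
  define y0_4 where "y0_4 = jones_sum (- 2) 0 1 (n + 4)"
  define y1_4 where "y1_4 = jones_sum (- 2) 1 1 (n + 4)"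
  note V_defs = q_def Q_def x0_0_def x1_0_def y0_0_def y1_0_def x0_1_def x1_1_def y0_1_def y1_1_def
    x0_2_def x1_2_def
    y0_2_def y1_2_def x0_3_def x1_3_def y0_3_def y1_3_def x0_4_def x1_4_def y0_4_def y1_4_def
  define sx0_4 where "sx0_4 = q ^ 12 * Q ^ 4 - q ^ 13 * Q ^ 6 - q ^ 14 * Q ^ 6 - q ^ 15 * Q ^ 6 + q ^ 15
    * Q ^ 8 + q ^ 16 * Q
    ^ 8 + q ^ 17 * Q ^ 8 - q ^ 18 * Q ^ 10"
  define rx0_4 :: ratfun where "rx0_4 = 0"
  define sx0_3 where "sx0_3 = - (1) + q * Q ^ 2 + q ^ 2 * Q ^ 2 + q ^ 3 * Q + q ^ 3 * Q ^ 2 - q ^ 3 * Q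
    ^ 4 - q ^ 4 * Q ^ 3 -
    q ^ 4 * Q ^ 4 - q ^ 5 * Q ^ 2 - q ^ 5 * Q ^ 3 - q ^ 5 * Q ^ 4 - q ^ 6 * Q ^ 3 + q ^ 6 * Q ^ 4 +
    q ^ 6 * Q ^ 5 + q ^ 6 * Q ^ 6 + q ^ 7 * Q ^ 2 + q ^ 7 * Q ^ 4 + q ^ 7 * Q ^ 5 + q ^ 8 * Q ^ 3 +
    q ^ 8 * Q ^ 5 - q ^ 8 * Q ^ 6 - q ^ 9 * Q ^ 3 - q ^ 9 * Q ^ 4 - q ^ 9 * Q ^ 5 - q ^ 9 * Q ^ 6 -
    q ^ 9 * Q ^ 7 - q ^ 10 * Q ^ 3 - q ^ 10 * Q ^ 4 + q ^ 11 * Q ^ 4 + 2 * q ^ 11 * Q ^ 5 + q ^ 11 *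
    Q ^ 6 + q ^ 11 * Q ^ 7 + q ^ 11 * Q ^ 8 + 2 * q ^ 12 * Q ^ 4 + 3 * q ^ 12 * Q ^ 5 - q ^ 12 * Q ^
    7 + 2 * q ^ 13 * Q ^ 5 - 3 * q ^ 13 * Q ^ 6 - 3 * q ^ 13 * Q ^ 7 - q ^ 13 * Q ^ 8 - 3 * q ^ 14 *
    Q ^ 6 - 4 * q ^ 14 * Q ^ 7 + q ^ 14 * Q ^ 8 - q ^ 15 * Q ^ 5 - 2 * q ^ 15 * Q ^ 6 - 2 * q ^ 15 *
    Q ^ 7 + 3 * q ^ 15 * Q ^ 8 + 2 * q ^ 15 * Q ^ 9 + q ^ 16 * Q ^ 5 + q ^ 16 * Q ^ 7 + 3 * q ^ 16 *
    Q ^ 8 + 2 * q ^ 16 * Q ^ 9 + 2 * q ^ 17 * Q ^ 8 - q ^ 17 * Q ^ 10 - q ^ 18 * Q ^ 6 - q ^ 18 * Q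
    ^ 7 - q ^ 18 * Q ^ 9 - 2 * q ^ 18 * Q ^ 10 - q ^ 19 * Q ^ 6 - 2 * q ^ 19 * Q ^ 7 + q ^ 19 * Q ^
    8 + q ^ 19 * Q ^ 9 - q ^ 20 * Q ^ 7 + 2 * q ^ 20 * Q ^ 8 + 2 * q ^ 20 * Q ^ 9 + 2 * q ^ 21 * Q ^
    8 + 3 * q ^ 21 * Q ^ 9 - q ^ 21 * Q ^ 10 + q ^ 22 * Q ^ 8 + q ^ 22 * Q ^ 9 - 2 * q ^ 22 * Q ^ 10
    - 2 * q ^ 22 * Q ^ 11 - 2 * q ^ 23 * Q ^ 10 - q ^ 23 * Q ^ 11 - q ^ 24 * Q ^ 10 + q ^ 24 * Q ^
    12 + q ^ 25 * Q ^ 12"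
  define rx0_3 where "rx0_3 = sx0_3 * (1 - q * Q2) - a3"
  define sy0_3 where "sy0_3 = q ^ 6 * Q ^ 2 - q ^ 7 * Q ^ 4 - q ^ 8 * Q ^ 4 - q ^ 9 * Q ^ 4 + q ^ 9 * Q
    ^ 6 + q ^ 10 * Q ^ 6 +
    q ^ 11 * Q ^ 6 - q ^ 12 * Q ^ 8 - q ^ 13 * Q ^ 4 + q ^ 14 * Q ^ 6 + q ^ 15 * Q ^ 6 + q ^ 16 * Q
    ^ 6 - q ^ 16 * Q ^ 8 - q ^ 17 * Q ^ 8 - q ^ 18 * Q ^ 8 + q ^ 19 * Q ^ 10"
  define ry0_3 where "ry0_3 = sy0_3 * (1 - q * Q2)"
  define sy1_3 where "sy1_3 = - (q ^ 10 * Q ^ 3) + q ^ 11 * Q ^ 5 + q ^ 12 * Q ^ 5 + q ^ 13 * Q ^ 5 - q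
    ^ 13 * Q ^ 7 - q ^ 14
    * Q ^ 7 - q ^ 15 * Q ^ 7 + q ^ 16 * Q ^ 9 + q ^ 17 * Q ^ 5 - q ^ 18 * Q ^ 7 - q ^ 19 * Q ^ 7 - q
    ^ 20 * Q ^ 7 + q ^ 20 * Q ^ 9 + q ^ 21 * Q ^ 9 + q ^ 22 * Q ^ 9 - q ^ 23 * Q ^ 11"
  define ry1_3 where "ry1_3 = sy1_3 * (1 - q * Q2)"
  define sx0_2 where "sx0_2 = - (q ^ 3 * Q) + q ^ 4 * Q ^ 3 + q ^ 5 * Q ^ 3 - q ^ 6 * Q ^ 3 - q ^ 6 * Q
    ^ 5 - q ^ 7 * Q ^ 3 +
    q ^ 7 * Q ^ 5 + q ^ 8 * Q ^ 3 + 2 * q ^ 8 * Q ^ 4 + 2 * q ^ 8 * Q ^ 5 + q ^ 9 * Q ^ 3 + q ^ 9 *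
    Q ^ 4 - 2 * q ^ 9 * Q ^ 6 - q ^ 9 * Q ^ 7 + q ^ 10 * Q ^ 3 - 2 * q ^ 10 * Q ^ 5 - 2 * q ^ 10 * Q
    ^ 6 - q ^ 10 * Q ^ 7 - q ^ 11 * Q ^ 5 + q ^ 11 * Q ^ 7 + q ^ 11 * Q ^ 8 + q ^ 12 * Q ^ 5 + q ^
    12 * Q ^ 6 + 2 * q ^ 13 * Q ^ 5 - q ^ 13 * Q ^ 6 - 2 * q ^ 13 * Q ^ 7 - q ^ 13 * Q ^ 8 - 2 * q ^
    14 * Q ^ 6 - 4 * q ^ 14 * Q ^ 7 + q ^ 14 * Q ^ 8 + q ^ 14 * Q ^ 9 - q ^ 15 * Q ^ 5 - 3 * q ^ 15
    * Q ^ 6 - 2 * q ^ 15 * Q ^ 7 + 3 * q ^ 15 * Q ^ 8 + 2 * q ^ 15 * Q ^ 9 - q ^ 16 * Q ^ 5 - q ^ 16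
    * Q ^ 6 + q ^ 16 * Q ^ 7 + 4 * q ^ 16 * Q ^ 8 + 2 * q ^ 16 * Q ^ 9 - q ^ 16 * Q ^ 10 + q ^ 17 *
    Q ^ 7 + 2 * q ^ 17 * Q ^ 8 - q ^ 17 * Q ^ 10 - q ^ 18 * Q ^ 7 - q ^ 18 * Q ^ 8 - q ^ 18 * Q ^ 10
    - 2 * q ^ 19 * Q ^ 7 + 2 * q ^ 19 * Q ^ 9 + q ^ 19 * Q ^ 10 - q ^ 20 * Q ^ 7 + q ^ 20 * Q ^ 8 +
    4 * q ^ 20 * Q ^ 9 - q ^ 20 * Q ^ 11 + q ^ 21 * Q ^ 7 + 2 * q ^ 21 * Q ^ 8 + 3 * q ^ 21 * Q ^ 9
    - 2 * q ^ 21 * Q ^ 10 - 2 * q ^ 21 * Q ^ 11 + q ^ 22 * Q ^ 8 - 3 * q ^ 22 * Q ^ 10 - 2 * q ^ 22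
    * Q ^ 11 + q ^ 22 * Q ^ 12 - q ^ 23 * Q ^ 9 - 2 * q ^ 23 * Q ^ 10 - q ^ 23 * Q ^ 11 + q ^ 23 * Q
    ^ 12 + q ^ 24 * Q ^ 9 + q ^ 24 * Q ^ 11 + q ^ 24 * Q ^ 12 + q ^ 25 * Q ^ 9 + q ^ 25 * Q ^ 10 - q
    ^ 25 * Q ^ 11 - q ^ 26 * Q ^ 10 - 2 * q ^ 26 * Q ^ 11 - q ^ 26 * Q ^ 12 - q ^ 27 * Q ^ 11 + q ^
    27 * Q ^ 12 + q ^ 27 * Q ^ 13 + q ^ 28 * Q ^ 12 + q ^ 28 * Q ^ 13 - q ^ 29 * Q ^ 14"
  define rx0_2 where "rx0_2 = sx0_2 * (1 - q * Q1) - a2"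
  define sx1_2 where "sx1_2 = q ^ 4 * Q - q ^ 5 * Q ^ 3 - q ^ 6 * Q ^ 3 - q ^ 7 * Q ^ 3 + q ^ 7 * Q ^ 5
    + q ^ 8 * Q ^ 5 - q ^
    9 * Q ^ 3 + q ^ 9 * Q ^ 5 - q ^ 10 * Q ^ 3 + q ^ 10 * Q ^ 5 - q ^ 10 * Q ^ 7 - q ^ 11 * Q ^ 3 +
    2 * q ^ 11 * Q ^ 5 + 3 * q ^ 12 * Q ^ 5 - q ^ 12 * Q ^ 7 + 2 * q ^ 13 * Q ^ 5 - 2 * q ^ 13 * Q ^
    7 + q ^ 14 * Q ^ 5 - 3 * q ^ 14 * Q ^ 7 + q ^ 15 * Q ^ 5 - 2 * q ^ 15 * Q ^ 7 + q ^ 15 * Q ^ 9 +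
    q ^ 16 * Q ^ 5 - 2 * q ^ 16 * Q ^ 7 + q ^ 16 * Q ^ 9 + q ^ 17 * Q ^ 5 - 2 * q ^ 17 * Q ^ 7 + q ^
    17 * Q ^ 9 - 3 * q ^ 18 * Q ^ 7 + q ^ 18 * Q ^ 9 - 2 * q ^ 19 * Q ^ 7 + 2 * q ^ 19 * Q ^ 9 - q ^
    20 * Q ^ 7 + 3 * q ^ 20 * Q ^ 9 + 2 * q ^ 21 * Q ^ 9 - q ^ 21 * Q ^ 11 - q ^ 22 * Q ^ 7 + q ^ 22
    * Q ^ 9 - q ^ 22 * Q ^ 11 + q ^ 23 * Q ^ 9 - q ^ 23 * Q ^ 11 + q ^ 24 * Q ^ 9 + q ^ 25 * Q ^ 9 -
    q ^ 25 * Q ^ 11 - q ^ 26 * Q ^ 11 - q ^ 27 * Q ^ 11 + q ^ 28 * Q ^ 13"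
  define rx1_2 where "rx1_2 = sx1_2 * (1 - q * Q1)"
  define sy0_2 where "sy0_2 = q ^ 7 * Q ^ 3 + q ^ 8 * Q ^ 3 - q ^ 8 * Q ^ 5 - 2 * q ^ 9 * Q ^ 5 - q ^ 10
    * Q ^ 5 + q ^ 10 * Q
    ^ 7 + q ^ 11 * Q ^ 7 - q ^ 13 * Q ^ 5 - 2 * q ^ 14 * Q ^ 5 + q ^ 14 * Q ^ 7 - q ^ 15 * Q ^ 5 + 3
    * q ^ 15 * Q ^ 7 + 3 * q ^ 16 * Q ^ 7 - q ^ 16 * Q ^ 9 + q ^ 17 * Q ^ 7 - 2 * q ^ 17 * Q ^ 9 - q
    ^ 18 * Q ^ 9 + q ^ 20 * Q ^ 7 + q ^ 21 * Q ^ 7 - q ^ 21 * Q ^ 9 - 2 * q ^ 22 * Q ^ 9 - q ^ 23 *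
    Q ^ 9 + q ^ 23 * Q ^ 11 + q ^ 24 * Q ^ 11"
  define ry0_2 where "ry0_2 = sy0_2 * (1 - q * Q1)"
  define sy1_2 where "sy1_2 = - (q ^ 7 * Q ^ 2) + q ^ 8 * Q ^ 4 + q ^ 9 * Q ^ 4 - q ^ 10 * Q ^ 6 - q ^
    11 * Q ^ 4 + q ^ 12 * Q
    ^ 6 + q ^ 13 * Q ^ 4 + q ^ 13 * Q ^ 6 + q ^ 14 * Q ^ 4 - q ^ 14 * Q ^ 6 - q ^ 14 * Q ^ 8 - 2 * q
    ^ 15 * Q ^ 6 - q ^ 16 * Q ^ 6 + q ^ 16 * Q ^ 8 + q ^ 17 * Q ^ 6 + q ^ 17 * Q ^ 8 + q ^ 18 * Q ^
    6 - q ^ 18 * Q ^ 8 - 2 * q ^ 19 * Q ^ 8 - q ^ 20 * Q ^ 6 - q ^ 20 * Q ^ 8 + q ^ 20 * Q ^ 10 + q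
    ^ 21 * Q ^ 8 + q ^ 21 * Q ^ 10 + q ^ 22 * Q ^ 8 - q ^ 23 * Q ^ 10 - q ^ 24 * Q ^ 8 + q ^ 25 * Q
    ^ 10 + q ^ 26 * Q ^ 10 - q ^ 27 * Q ^ 12"
  define ry1_2 where "ry1_2 = sy1_2 * (1 - q * Q1)"
  define sx0_1 where "sx0_1 = q ^ 8 * Q ^ 5 - q ^ 13 * Q ^ 7 - q ^ 14 * Q ^ 7 - q ^ 15 * Q ^ 7 + q ^ 19
    * Q ^ 9 + q ^ 20 * Q ^
    9 + q ^ 21 * Q ^ 9 - q ^ 26 * Q ^ 11"
  define rx0_1 where "rx0_1 = sx0_1 * (1 - q * Q) - a1"
  define sy0_1 where "sy0_1 = q ^ 8 * Q ^ 4 - q ^ 9 * Q ^ 6 - q ^ 13 * Q ^ 6 - q ^ 14 * Q ^ 6 + q ^ 14 *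
    Q ^ 8 - q ^ 15 * Q ^
    6 + q ^ 15 * Q ^ 8 + q ^ 16 * Q ^ 8 + q ^ 19 * Q ^ 8 + q ^ 20 * Q ^ 8 - q ^ 20 * Q ^ 10 + q ^ 21
    * Q ^ 8 - q ^ 21 * Q ^ 10 - q ^ 22 * Q ^ 10 - q ^ 26 * Q ^ 10 + q ^ 27 * Q ^ 12"
  define ry0_1 where "ry0_1 = sy0_1 * (1 - q * Q)"
  define sy1_1 where "sy1_1 = - (q ^ 8 * Q ^ 3) + q ^ 9 * Q ^ 5 + q ^ 13 * Q ^ 5 + q ^ 14 * Q ^ 5 - q ^
    14 * Q ^ 7 + q ^ 15 *
    Q ^ 5 - q ^ 15 * Q ^ 7 - q ^ 16 * Q ^ 7 - q ^ 19 * Q ^ 7 - q ^ 20 * Q ^ 7 + q ^ 20 * Q ^ 9 - q ^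
    21 * Q ^ 7 + q ^ 21 * Q ^ 9 + q ^ 22 * Q ^ 9 + q ^ 26 * Q ^ 9 - q ^ 27 * Q ^ 11"
  define ry1_1 where "ry1_1 = sy1_1 * (1 - q * Q)"
  define rx0_0 where "rx0_0 = - a0"
  define c3 where "c3 = q ^ 9 * Q ^ 3 - q ^ 10 * Q ^ 5 - q ^ 11 * Q ^ 5 - q ^ 12 * Q ^ 5 + q ^ 12 * Q ^
    7 + q ^ 13 * Q ^
    7 + q ^ 14 * Q ^ 7 - q ^ 15 * Q ^ 9 - q ^ 16 * Q ^ 5 + q ^ 17 * Q ^ 7 + q ^ 18 * Q ^ 7 + q ^ 19
    * Q ^ 7 - q ^ 19 * Q ^ 9 - q ^ 20 * Q ^ 9 - q ^ 21 * Q ^ 9 + q ^ 22 * Q ^ 11"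
  define c2 where "c2 = q ^ 6 * Q ^ 2 - q ^ 7 * Q ^ 4 - q ^ 8 * Q ^ 4 + q ^ 9 * Q ^ 6 + q ^ 10 * Q ^ 4 -
    q ^ 11 * Q ^ 6
    - q ^ 12 * Q ^ 6 - q ^ 13 * Q ^ 4 + q ^ 13 * Q ^ 8 + q ^ 14 * Q ^ 6 - q ^ 16 * Q ^ 6 - q ^ 17 *
    Q ^ 6 + 2 * q ^ 17 * Q ^ 8 + 2 * q ^ 18 * Q ^ 8 - q ^ 18 * Q ^ 10 + q ^ 19 * Q ^ 8 - q ^ 19 * Q
    ^ 10 - q ^ 20 * Q ^ 10 + q ^ 22 * Q ^ 8 + q ^ 23 * Q ^ 8 - q ^ 23 * Q ^ 10 - 2 * q ^ 24 * Q ^ 10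
    - q ^ 25 * Q ^ 10 + q ^ 25 * Q ^ 12 + q ^ 26 * Q ^ 12"
  define c1 where "c1 = q ^ 7 * Q ^ 3 + q ^ 8 * Q ^ 3 - q ^ 8 * Q ^ 5 - q ^ 9 * Q ^ 5 - q ^ 10 * Q ^ 5 +
    q ^ 11 * Q ^ 7
    - q ^ 13 * Q ^ 5 - 2 * q ^ 14 * Q ^ 5 - q ^ 15 * Q ^ 5 + 2 * q ^ 15 * Q ^ 7 + q ^ 15 * Q ^ 9 + 2
    * q ^ 16 * Q ^ 7 + q ^ 17 * Q ^ 7 - q ^ 17 * Q ^ 9 - q ^ 18 * Q ^ 9 + q ^ 20 * Q ^ 7 + q ^ 20 *
    Q ^ 9 + q ^ 21 * Q ^ 7 - q ^ 21 * Q ^ 11 - q ^ 22 * Q ^ 9 - q ^ 22 * Q ^ 11 - q ^ 23 * Q ^ 9 + q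
    ^ 24 * Q ^ 11 - q ^ 27 * Q ^ 11 + q ^ 28 * Q ^ 13"
  define c0 where "c0 = q ^ 8 * Q ^ 4 - q ^ 9 * Q ^ 6 - q ^ 13 * Q ^ 6 - q ^ 14 * Q ^ 6 + q ^ 14 * Q ^ 8
    - q ^ 15 * Q ^
    6 + q ^ 15 * Q ^ 8 + q ^ 16 * Q ^ 8 + q ^ 19 * Q ^ 8 + q ^ 20 * Q ^ 8 - q ^ 20 * Q ^ 10 + q ^ 21
    * Q ^ 8 - q ^ 21 * Q ^ 10 - q ^ 22 * Q ^ 10 - q ^ 26 * Q ^ 10 + q ^ 27 * Q ^ 12"
  have e3: "qvar ^ (n + 3) = Q3" "Suc (n + 3) = n + 4" "(n + 3) \<ge> 1"
    using assms by (simp_all add: Q3_def q_def Q_def power_add mult.commute power2_eq_square)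
  define tx0_3 where "tx0_3 = sx0_4"
  define m3 where "m3 = q ^ 6 * Q ^ 2"
  have s3_x0_4: "Q3 ^ 2 * ((1 - q * Q3) * x0_4) =
    step_neg2_x0_x0 q Q3 * x0_3 + step_neg2_x0_y0 q Q3 * y0_3 + step_neg2_x0_y1 q Q3 * y1_3 +
    step_neg2_x0_1 q Q3"
    by (rule jones_sum_neg2_X0_Suc[OF e3(3), unfolded e3(1,2), folded V_defs])
  have l3_x0_4: "m3 * (rx0_4 + a4) = tx0_3 * (Q3 ^ 2 * (1 - q * Q3))"
    unfolding m3_def rx0_4_def tx0_3_def Q3_def sx0_4_def a4_eq by Groebner_Basis.algebra
  note D3 = m3_def c3_def a3_eq tx0_3_def sx0_4_def rx0_3_def ry0_3_def ry1_3_def sx0_3_def sy0_3_def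
    sy1_3_def step_neg2_defs Q3_def Q2_def
  have k3_x0_3: "tx0_3 * step_neg2_x0_x0 q Q3 = m3 * rx0_3"
    unfolding D3 by Groebner_Basis.algebra
  have k3_y0_3: "tx0_3 * step_neg2_x0_y0 q Q3 = m3 * ry0_3"
    unfolding D3 by Groebner_Basis.algebra
  have k3_y1_3: "tx0_3 * step_neg2_x0_y1 q Q3 = m3 * ry1_3"
    unfolding D3 by Groebner_Basis.algebra
  have k3_1: "tx0_3 * step_neg2_x0_1 q Q3 = m3 * c3"
    unfolding D3 by Groebner_Basis.algebra
  have h3: "(rx0_4 + a4) * x0_4 = rx0_3 * x0_3 + ry0_3 * y0_3 + ry1_3 * y1_3 + c3"
  proof -
    have "m3 * ((rx0_4 + a4) * x0_4) = (m3 * (rx0_4 + a4)) * x0_4"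
      by (simp only: distrib_left distrib_right mult.assoc)
    also have "\<dots> = tx0_3 * (Q3 ^ 2 * ((1 - q * Q3) * x0_4))"
      unfolding l3_x0_4 by (simp only: mult.assoc)
    also have "\<dots> = (tx0_3 * step_neg2_x0_x0 q Q3) * x0_3 + (tx0_3 * step_neg2_x0_y0 q Q3) * y0_3 +
      (tx0_3 *
      step_neg2_x0_y1 q Q3) * y1_3 + (tx0_3 * step_neg2_x0_1 q Q3)"
      unfolding s3_x0_4 by (simp only: distrib_left distrib_right mult.assoc add_ac)
    also have "\<dots> = m3 * (rx0_3 * x0_3 + ry0_3 * y0_3 + ry1_3 * y1_3 + c3)"
      unfolding k3_x0_3 k3_y0_3 k3_y1_3 k3_1 by (simp only: distrib_left mult.assoc mult_zero_left
        add_0_left add_0_right)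
    finally show ?thesis using nz by (simp add: m3_def)
  qed
  have e2: "qvar ^ (n + 2) = Q2" "Suc (n + 2) = n + 3" "(n + 2) \<ge> 1"
    using assms by (simp_all add: Q2_def q_def Q_def power_add mult.commute power2_eq_square)
  define tx0_2 where "tx0_2 = q ^ 6 * Q ^ 2 * sx0_3"
  define ty0_2 where "ty0_2 = sy0_3"
  define ty1_2 where "ty1_2 = q ^ 2 * Q * sy1_3"
  define m2 where "m2 = q ^ 10 * Q ^ 4"
  have s2_x0_3: "Q2 ^ 2 * ((1 - q * Q2) * x0_3) =
    step_neg2_x0_x0 q Q2 * x0_2 + step_neg2_x0_y0 q Q2 * y0_2 + step_neg2_x0_y1 q Q2 * y1_2 +
    step_neg2_x0_1 q Q2"
    by (rule jones_sum_neg2_X0_Suc[OF e2(3), unfolded e2(1,2), folded V_defs])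
  have l2_x0_3: "m2 * (rx0_3 + a3) = tx0_2 * (Q2 ^ 2 * (1 - q * Q2))"
    unfolding m2_def rx0_3_def tx0_2_def Q2_def by Groebner_Basis.algebra
  have s2_y0_3: "q ^ 2 * Q2 ^ 4 * ((1 - q * Q2) * y0_3) =
    step_neg2_y0_x0 q Q2 * x0_2 + step_neg2_y0_x1 q Q2 * x1_2 + step_neg2_y0_y0 q Q2 * y0_2 +
    step_neg2_y0_y1 q Q2 * y1_2 + step_neg2_y0_1 q Q2"
    by (rule jones_sum_neg2_Y0_Suc[OF e2(3), unfolded e2(1,2), folded V_defs])
  have l2_y0_3: "m2 * ry0_3 = ty0_2 * (q ^ 2 * Q2 ^ 4 * (1 - q * Q2))"
    unfolding m2_def ry0_3_def ty0_2_def Q2_def by Groebner_Basis.algebra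
  have s2_y1_3: "q ^ 2 * Q2 ^ 3 * ((1 - q * Q2) * y1_3) =
    step_neg2_y1_x0 q Q2 * x0_2 + step_neg2_y1_x1 q Q2 * x1_2 + step_neg2_y1_y0 q Q2 * y0_2 +
    step_neg2_y1_y1 q Q2 * y1_2 + step_neg2_y1_1 q Q2"
    by (rule jones_sum_neg2_Y1_Suc[OF e2(3), unfolded e2(1,2), folded V_defs])
  have l2_y1_3: "m2 * ry1_3 = ty1_2 * (q ^ 2 * Q2 ^ 3 * (1 - q * Q2))"
    unfolding m2_def ry1_3_def ty1_2_def Q2_def by Groebner_Basis.algebra
  note D2 = m2_def c2_def a2_eq tx0_2_def ty0_2_def ty1_2_def sx0_3_def sy0_3_def sy1_3_def rx0_2_def
    rx1_2_def ry0_2_def ry1_2_def sx0_2_def sx1_2_def sy0_2_def sy1_2_def step_neg2_defs Q2_def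
    Q1_def
  have k2_x0_2: "tx0_2 * step_neg2_x0_x0 q Q2 + ty0_2 * step_neg2_y0_x0 q Q2 + ty1_2 * step_neg2_y1_x0 q
    Q2 = m2 * rx0_2"
    unfolding D2 by Groebner_Basis.algebra
  have k2_x1_2: "ty0_2 * step_neg2_y0_x1 q Q2 + ty1_2 * step_neg2_y1_x1 q Q2 = m2 * rx1_2"
    unfolding D2 by Groebner_Basis.algebra
  have k2_y0_2: "tx0_2 * step_neg2_x0_y0 q Q2 + ty0_2 * step_neg2_y0_y0 q Q2 + ty1_2 * step_neg2_y1_y0 q
    Q2 = m2 * ry0_2"
    unfolding D2 by Groebner_Basis.algebra
  have k2_y1_2: "tx0_2 * step_neg2_x0_y1 q Q2 + ty0_2 * step_neg2_y0_y1 q Q2 + ty1_2 * step_neg2_y1_y1 q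
    Q2 = m2 * ry1_2"
    unfolding D2 by Groebner_Basis.algebra
  have k2_1: "tx0_2 * step_neg2_x0_1 q Q2 + ty0_2 * step_neg2_y0_1 q Q2 + ty1_2 * step_neg2_y1_1 q Q2 =
    m2 * c2"
    unfolding D2 by Groebner_Basis.algebra
  have h2: "(rx0_3 + a3) * x0_3 + ry0_3 * y0_3 + ry1_3 * y1_3 = rx0_2 * x0_2 + rx1_2 * x1_2 + ry0_2 *
    y0_2 + ry1_2 * y1_2 + c2"
  proof -
    have "m2 * ((rx0_3 + a3) * x0_3 + ry0_3 * y0_3 + ry1_3 * y1_3) = (m2 * (rx0_3 + a3)) * x0_3 + (m2 *
      ry0_3) * y0_3 + (m2 * ry1_3) * y1_3"
      by (simp only: distrib_left distrib_right mult.assoc)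
    also have "\<dots> = tx0_2 * (Q2 ^ 2 * ((1 - q * Q2) * x0_3)) + ty0_2 * (q ^ 2 * Q2 ^ 4 * ((1 - q *
      Q2) * y0_3)) +
      ty1_2 * (q ^ 2 * Q2 ^ 3 * ((1 - q * Q2) * y1_3))"
      unfolding l2_x0_3 l2_y0_3 l2_y1_3 by (simp only: mult.assoc)
    also have "\<dots> = (tx0_2 * step_neg2_x0_x0 q Q2 + ty0_2 * step_neg2_y0_x0 q Q2 + ty1_2 *
      step_neg2_y1_x0 q Q2) *
      x0_2 + (ty0_2 * step_neg2_y0_x1 q Q2 + ty1_2 * step_neg2_y1_x1 q Q2) * x1_2 + (tx0_2 *
      step_neg2_x0_y0 q Q2 + ty0_2 * step_neg2_y0_y0 q Q2 + ty1_2 * step_neg2_y1_y0 q Q2) * y0_2 +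
      (tx0_2 * step_neg2_x0_y1 q Q2 + ty0_2 * step_neg2_y0_y1 q Q2 + ty1_2 * step_neg2_y1_y1 q Q2) *
      y1_2 + (tx0_2 * step_neg2_x0_1 q Q2 + ty0_2 * step_neg2_y0_1 q Q2 + ty1_2 * step_neg2_y1_1 q Q2)"
      unfolding s2_x0_3 s2_y0_3 s2_y1_3 by (simp only: distrib_left distrib_right mult.assoc add_ac)
    also have "\<dots> = m2 * (rx0_2 * x0_2 + rx1_2 * x1_2 + ry0_2 * y0_2 + ry1_2 * y1_2 + c2)"
      unfolding k2_x0_2 k2_x1_2 k2_y0_2 k2_y1_2 k2_1 by (simp only: distrib_left mult.assoc
        mult_zero_left add_0_left add_0_right)
    finally show ?thesis using nz by (simp add: m2_def)
  qed
  have e1: "qvar ^ (n + 1) = Q1" "Suc (n + 1) = n + 2" "(n + 1) \<ge> 1"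
    using assms by (simp_all add: Q1_def q_def Q_def power_add mult.commute power2_eq_square)
  define tx0_1 where "tx0_1 = q ^ 4 * Q ^ 2 * sx0_2"
  define tx1_1 where "tx1_1 = q ^ 5 * Q ^ 3 * sx1_2"
  define ty0_1 where "ty0_1 = sy0_2"
  define ty1_1 where "ty1_1 = q * Q * sy1_2"
  define m1 where "m1 = q ^ 6 * Q ^ 4"
  have s1_x0_2: "Q1 ^ 2 * ((1 - q * Q1) * x0_2) =
    step_neg2_x0_x0 q Q1 * x0_1 + step_neg2_x0_y0 q Q1 * y0_1 + step_neg2_x0_y1 q Q1 * y1_1 +
    step_neg2_x0_1 q Q1"
    by (rule jones_sum_neg2_X0_Suc[OF e1(3), unfolded e1(1,2), folded V_defs])
  have l1_x0_2: "m1 * (rx0_2 + a2) = tx0_1 * (Q1 ^ 2 * (1 - q * Q1))"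
    unfolding m1_def rx0_2_def tx0_1_def Q1_def by Groebner_Basis.algebra
  have s1_x1_2: "Q1 * ((1 - q * Q1) * x1_2) =
    step_neg2_x1_x1 q Q1 * x1_1 + step_neg2_x1_y0 q Q1 * y0_1 + step_neg2_x1_y1 q Q1 * y1_1 +
    step_neg2_x1_1 q Q1"
    by (rule jones_sum_neg2_X1_Suc[OF e1(3), unfolded e1(1,2), folded V_defs])
  have l1_x1_2: "m1 * rx1_2 = tx1_1 * (Q1 * (1 - q * Q1))"
    unfolding m1_def rx1_2_def tx1_1_def Q1_def by Groebner_Basis.algebra
  have s1_y0_2: "q ^ 2 * Q1 ^ 4 * ((1 - q * Q1) * y0_2) =
    step_neg2_y0_x0 q Q1 * x0_1 + step_neg2_y0_x1 q Q1 * x1_1 + step_neg2_y0_y0 q Q1 * y0_1 +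
    step_neg2_y0_y1 q Q1 * y1_1 + step_neg2_y0_1 q Q1"
    by (rule jones_sum_neg2_Y0_Suc[OF e1(3), unfolded e1(1,2), folded V_defs])
  have l1_y0_2: "m1 * ry0_2 = ty0_1 * (q ^ 2 * Q1 ^ 4 * (1 - q * Q1))"
    unfolding m1_def ry0_2_def ty0_1_def Q1_def by Groebner_Basis.algebra
  have s1_y1_2: "q ^ 2 * Q1 ^ 3 * ((1 - q * Q1) * y1_2) =
    step_neg2_y1_x0 q Q1 * x0_1 + step_neg2_y1_x1 q Q1 * x1_1 + step_neg2_y1_y0 q Q1 * y0_1 +
    step_neg2_y1_y1 q Q1 * y1_1 + step_neg2_y1_1 q Q1"
    by (rule jones_sum_neg2_Y1_Suc[OF e1(3), unfolded e1(1,2), folded V_defs])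
  have l1_y1_2: "m1 * ry1_2 = ty1_1 * (q ^ 2 * Q1 ^ 3 * (1 - q * Q1))"
    unfolding m1_def ry1_2_def ty1_1_def Q1_def by Groebner_Basis.algebra
  note D1 = m1_def c1_def a1_eq tx0_1_def tx1_1_def ty0_1_def ty1_1_def sx0_2_def sx1_2_def sy0_2_def
    sy1_2_def rx0_1_def ry0_1_def ry1_1_def sx0_1_def sy0_1_def sy1_1_def step_neg2_defs Q1_def
  have k1_x0_1: "tx0_1 * step_neg2_x0_x0 q Q1 + ty0_1 * step_neg2_y0_x0 q Q1 + ty1_1 * step_neg2_y1_x0 q
    Q1 = m1 * rx0_1"
    unfolding D1 by Groebner_Basis.algebra
  \<comment> \<open>The sum x1 occurs with a nonzero coefficient at n + 2 only: the step for x0 does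
    not produce it at n + 3, and here it already cancels at n + 1.\<close>
  have k1_x1_1: "tx1_1 * step_neg2_x1_x1 q Q1 + ty0_1 * step_neg2_y0_x1 q Q1 + ty1_1 * step_neg2_y1_x1 q
    Q1 = 0"
    unfolding D1 by Groebner_Basis.algebra
  have k1_y0_1: "tx0_1 * step_neg2_x0_y0 q Q1 + tx1_1 * step_neg2_x1_y0 q Q1 + ty0_1 * step_neg2_y0_y0 q
    Q1 +
    ty1_1 * step_neg2_y1_y0 q Q1 = m1 * ry0_1"
    unfolding D1 by Groebner_Basis.algebra
  have k1_y1_1: "tx0_1 * step_neg2_x0_y1 q Q1 + tx1_1 * step_neg2_x1_y1 q Q1 + ty0_1 * step_neg2_y0_y1 q
    Q1 +
    ty1_1 * step_neg2_y1_y1 q Q1 = m1 * ry1_1"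
    unfolding D1 by Groebner_Basis.algebra
  have k1_1: "tx0_1 * step_neg2_x0_1 q Q1 + tx1_1 * step_neg2_x1_1 q Q1 + ty0_1 * step_neg2_y0_1 q Q1 +
    ty1_1
    * step_neg2_y1_1 q Q1 = m1 * c1"
    unfolding D1 by Groebner_Basis.algebra
  have h1: "(rx0_2 + a2) * x0_2 + rx1_2 * x1_2 + ry0_2 * y0_2 + ry1_2 * y1_2 = rx0_1 * x0_1 + ry0_1 *
    y0_1 + ry1_1 * y1_1 + c1"
  proof -
    have "m1 * ((rx0_2 + a2) * x0_2 + rx1_2 * x1_2 + ry0_2 * y0_2 + ry1_2 * y1_2) = (m1 * (rx0_2 + a2))
      * x0_2 + (m1 * rx1_2) * x1_2 + (m1 * ry0_2) * y0_2 + (m1 * ry1_2) * y1_2"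
      by (simp only: distrib_left distrib_right mult.assoc)
    also have "\<dots> = tx0_1 * (Q1 ^ 2 * ((1 - q * Q1) * x0_2)) + tx1_1 * (Q1 * ((1 - q * Q1) * x1_2))
      + ty0_1 * (q ^ 2
      * Q1 ^ 4 * ((1 - q * Q1) * y0_2)) + ty1_1 * (q ^ 2 * Q1 ^ 3 * ((1 - q * Q1) * y1_2))"
      unfolding l1_x0_2 l1_x1_2 l1_y0_2 l1_y1_2 by (simp only: mult.assoc)
    also have "\<dots> = (tx0_1 * step_neg2_x0_x0 q Q1 + ty0_1 * step_neg2_y0_x0 q Q1 + ty1_1 *
      step_neg2_y1_x0 q Q1) *
      x0_1 + (tx1_1 * step_neg2_x1_x1 q Q1 + ty0_1 * step_neg2_y0_x1 q Q1 + ty1_1 * step_neg2_y1_x1 q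
      Q1) * x1_1 + (tx0_1 * step_neg2_x0_y0 q Q1 + tx1_1 * step_neg2_x1_y0 q Q1 + ty0_1 *
      step_neg2_y0_y0 q Q1 + ty1_1 * step_neg2_y1_y0 q Q1) * y0_1 + (tx0_1 * step_neg2_x0_y1 q Q1 +
      tx1_1 * step_neg2_x1_y1 q Q1 + ty0_1 * step_neg2_y0_y1 q Q1 + ty1_1 * step_neg2_y1_y1 q Q1) *
      y1_1 + (tx0_1 * step_neg2_x0_1 q Q1 + tx1_1 * step_neg2_x1_1 q Q1 + ty0_1 * step_neg2_y0_1 q Q1
      + ty1_1 * step_neg2_y1_1 q Q1)"
      unfolding s1_x0_2 s1_x1_2 s1_y0_2 s1_y1_2 by (simp only: distrib_left distrib_right mult.assoc
        add_ac)
    also have "\<dots> = m1 * (rx0_1 * x0_1 + ry0_1 * y0_1 + ry1_1 * y1_1 + c1)"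
      unfolding k1_x0_1 k1_x1_1 k1_y0_1 k1_y1_1 k1_1 by (simp only: distrib_left mult.assoc
        mult_zero_left add_0_left add_0_right)
    finally show ?thesis using nz by (simp add: m1_def)
  qed
  have e0: "qvar ^ n = qvar ^ n" "Suc n = n + 1" "n \<ge> 1"
    using assms by (simp_all add: q_def Q_def power_add mult.commute power2_eq_square)
  define tx0_0 where "tx0_0 = q ^ 2 * Q ^ 2 * sx0_1"
  define ty0_0 where "ty0_0 = sy0_1"
  define ty1_0 where "ty1_0 = Q * sy1_1"
  define m0 where "m0 = q ^ 2 * Q ^ 4"
  have s0_x0_1: "Q ^ 2 * ((1 - q * Q) * x0_1) =
    step_neg2_x0_x0 q Q * x0_0 + step_neg2_x0_y0 q Q * y0_0 + step_neg2_x0_y1 q Q * y1_0 +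
    step_neg2_x0_1 q Q"
    by (rule jones_sum_neg2_X0_Suc[OF e0(3), unfolded e0(2), folded V_defs])
  have l0_x0_1: "m0 * (rx0_1 + a1) = tx0_0 * (Q ^ 2 * (1 - q * Q))"
    unfolding m0_def rx0_1_def tx0_0_def by Groebner_Basis.algebra
  have s0_y0_1: "q ^ 2 * Q ^ 4 * ((1 - q * Q) * y0_1) =
    step_neg2_y0_x0 q Q * x0_0 + step_neg2_y0_x1 q Q * x1_0 + step_neg2_y0_y0 q Q * y0_0 +
    step_neg2_y0_y1 q Q * y1_0 + step_neg2_y0_1 q Q"
    by (rule jones_sum_neg2_Y0_Suc[OF e0(3), unfolded e0(2), folded V_defs])
  have l0_y0_1: "m0 * ry0_1 = ty0_0 * (q ^ 2 * Q ^ 4 * (1 - q * Q))"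
    unfolding m0_def ry0_1_def ty0_0_def by Groebner_Basis.algebra
  have s0_y1_1: "q ^ 2 * Q ^ 3 * ((1 - q * Q) * y1_1) =
    step_neg2_y1_x0 q Q * x0_0 + step_neg2_y1_x1 q Q * x1_0 + step_neg2_y1_y0 q Q * y0_0 +
    step_neg2_y1_y1 q Q * y1_0 + step_neg2_y1_1 q Q"
    by (rule jones_sum_neg2_Y1_Suc[OF e0(3), unfolded e0(2), folded V_defs])
  have l0_y1_1: "m0 * ry1_1 = ty1_0 * (q ^ 2 * Q ^ 3 * (1 - q * Q))"
    unfolding m0_def ry1_1_def ty1_0_def by Groebner_Basis.algebra
  note D0 = m0_def c0_def a0_eq tx0_0_def ty0_0_def ty1_0_def sx0_1_def sy0_1_def sy1_1_def rx0_0_def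
    step_neg2_defs
  have k0_x0_0: "tx0_0 * step_neg2_x0_x0 q Q + ty0_0 * step_neg2_y0_x0 q Q + ty1_0 * step_neg2_y1_x0 q Q
    = m0 * rx0_0"
    unfolding D0 by Groebner_Basis.algebra
  have k0_x1_0: "ty0_0 * step_neg2_y0_x1 q Q + ty1_0 * step_neg2_y1_x1 q Q = 0"
    unfolding D0 by Groebner_Basis.algebra
  have k0_y0_0: "tx0_0 * step_neg2_x0_y0 q Q + ty0_0 * step_neg2_y0_y0 q Q + ty1_0 * step_neg2_y1_y0 q Q
    = 0"
    unfolding D0 by Groebner_Basis.algebra
  have k0_y1_0: "tx0_0 * step_neg2_x0_y1 q Q + ty0_0 * step_neg2_y0_y1 q Q + ty1_0 * step_neg2_y1_y1 q Q
    = 0"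
    unfolding D0 by Groebner_Basis.algebra
  have k0_1: "tx0_0 * step_neg2_x0_1 q Q + ty0_0 * step_neg2_y0_1 q Q + ty1_0 * step_neg2_y1_1 q Q = m0
    * c0"
    unfolding D0 by Groebner_Basis.algebra
  have h0: "(rx0_1 + a1) * x0_1 + ry0_1 * y0_1 + ry1_1 * y1_1 = rx0_0 * x0_0 + c0"
  proof -
    have "m0 * ((rx0_1 + a1) * x0_1 + ry0_1 * y0_1 + ry1_1 * y1_1) = (m0 * (rx0_1 + a1)) * x0_1 + (m0 *
      ry0_1) * y0_1 + (m0 * ry1_1) * y1_1"
      by (simp only: distrib_left distrib_right mult.assoc)
    also have "\<dots> = tx0_0 * (Q ^ 2 * ((1 - q * Q) * x0_1)) + ty0_0 * (q ^ 2 * Q ^ 4 * ((1 - q * Q)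
      * y0_1)) + ty1_0
      * (q ^ 2 * Q ^ 3 * ((1 - q * Q) * y1_1))"
      unfolding l0_x0_1 l0_y0_1 l0_y1_1 by (simp only: mult.assoc)
    also have "\<dots> = (tx0_0 * step_neg2_x0_x0 q Q + ty0_0 * step_neg2_y0_x0 q Q + ty1_0 *
      step_neg2_y1_x0 q Q) * x0_0
      + (ty0_0 * step_neg2_y0_x1 q Q + ty1_0 * step_neg2_y1_x1 q Q) * x1_0 + (tx0_0 * step_neg2_x0_y0
      q Q + ty0_0 * step_neg2_y0_y0 q Q + ty1_0 * step_neg2_y1_y0 q Q) * y0_0 + (tx0_0 *
      step_neg2_x0_y1 q Q + ty0_0 * step_neg2_y0_y1 q Q + ty1_0 * step_neg2_y1_y1 q Q) * y1_0 + (tx0_0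
      * step_neg2_x0_1 q Q + ty0_0 * step_neg2_y0_1 q Q + ty1_0 * step_neg2_y1_1 q Q)"
      unfolding s0_x0_1 s0_y0_1 s0_y1_1 by (simp only: distrib_left distrib_right mult.assoc add_ac)
    also have "\<dots> = m0 * (rx0_0 * x0_0 + c0)"
      unfolding k0_x0_0 k0_x1_0 k0_y0_0 k0_y1_0 k0_1 by (simp only: distrib_left mult.assoc
        mult_zero_left add_0_left add_0_right)
    finally show ?thesis using nz by (simp add: m0_def)
  qed
  have t3: "a4 * x0_4 = rx0_3 * x0_3 + ry0_3 * y0_3 + ry1_3 * y1_3 + c3"
    using h3 by (simp add: rx0_4_def)
  have t2: "a3 * x0_3 + (a4 * x0_4) = (rx0_2 * x0_2 + rx1_2 * x1_2 + ry0_2 * y0_2 + ry1_2 * y1_2 + c2) +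
    (c3)"
    unfolding t3 h2[symmetric] by (simp only: distrib_right add_ac)
  have t1: "a2 * x0_2 + (a3 * x0_3 + (a4 * x0_4)) = (rx0_1 * x0_1 + ry0_1 * y0_1 + ry1_1 * y1_1 + c1) +
    (c2 + c3)"
    unfolding t2 h1[symmetric] by (simp only: distrib_right add_ac)
  have t0: "a1 * x0_1 + (a2 * x0_2 + (a3 * x0_3 + (a4 * x0_4))) = (rx0_0 * x0_0 + c0) + (c1 + c2 + c3)"
    unfolding t1 h0[symmetric] by (simp only: distrib_right add_ac)
  have "a0 * x0_0 + (a1 * x0_1 + (a2 * x0_2 + (a3 * x0_3 + (a4 * x0_4)))) = c0 + (c1 + c2 + c3)"
    unfolding t0 rx0_0_def by simp
  also have "\<dots> = inhomogeneity_neg2 q Q"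
    unfolding inhomogeneity_neg2_def c0_def c1_def c2_def c3_def by Groebner_Basis.algebra
  finally have fin: "a0 * x0_0 + (a1 * x0_1 + (a2 * x0_2 + (a3 * x0_3 + (a4 * x0_4)))) =
    inhomogeneity_neg2 q Q" .
  have L: "(\<Sum>i<5. f i) = f 0 + (f 1 + (f 2 + (f 3 + (f 4))))" for f :: "nat \<Rightarrow> ratfun"
    by (simp add: eval_nat_numeral add.assoc)
  have len: "length (recurrence_neg2 q Q) = 5" by (simp add: recurrence_neg2_def)
  have J: "colored_jones (- 2) (n + 0) = x0_0" "colored_jones (- 2) (n + 1) = x0_1" "colored_jones (- 2)
    (n + 2) = x0_2" "colored_jones (- 2) (n + 3) = x0_3" "colored_jones (- 2) (n + 4) = x0_4"
    using assms by (simp_all add: colored_jones_eq_jones_sum x0_0_def x0_1_def x0_2_def x0_3_def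
      x0_4_def)
  show ?thesis unfolding Q_def[symmetric] unfolding q_def[symmetric] len L J
    by (rule fin[unfolded a0_def a1_def a2_def a3_def a4_def])
qed

section \<open>Skew polynomials\<close>

text \<open>The ring of polynomials in E with E a = \<open>\<sigma>\<close> a E, encoded by
  coefficients written on the left. Injectivity of \<open>\<sigma>\<close> keeps leading
  coefficients nonzero when E is applied.\<close>

locale skew_poly = inj_idom_hom \<sigma> for \<sigma> :: "'a::idom \<Rightarrow> 'a"
begin

text \<open>Left multiplication by E.\<close>

definition shift :: "'a poly \<Rightarrow> 'a poly" where
  "shift M = pCons 0 (map_poly \<sigma> M)"

definition skew_mult :: "'a poly \<Rightarrow> 'a poly \<Rightarrow> 'a poly" where
  "skew_mult C M = (\<Sum>i\<le>degree C. smult (coeff C i) ((shift ^^ i) M))"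

lemma skew_mult_extend:
  assumes "degree C \<le> N"
  shows "skew_mult C M = (\<Sum>i\<le>N. smult (coeff C i) ((shift ^^ i) M))"
  unfolding skew_mult_def
  by (rule sum.mono_neutral_left) (use assms in \<open>auto simp: coeff_eq_0\<close>)

lemma skew_mult_0_left [simp]: "skew_mult 0 M = 0"
  by (simp add: skew_mult_def)

lemma skew_mult_add_left: "skew_mult (A + B) M = skew_mult A M + skew_mult B M"
proof -
  define N where "N = max (degree A) (degree B)"
  have "degree A \<le> N" "degree B \<le> N" "degree (A + B) \<le> N"
    by (simp_all add: N_def degree_add_le_max)
  then show ?thesis
    by (simp add: skew_mult_extend smult_add_left sum.distrib)
qed

lemma skew_mult_smult_left: "skew_mult (smult c A) M = smult c (skew_mult A M)"
  by (subst (1 2) skew_mult_extend[of _ "degree A"]) (simp_all add: degree_smult_le smult_sum2)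

lemma skew_mult_monom: "skew_mult (monom a k) M = smult a ((shift ^^ k) M)"
proof -
  have "skew_mult (monom a k) M = (\<Sum>i\<le>k. smult (coeff (monom a k) i) ((shift ^^ i) M))"
    by (rule skew_mult_extend[OF degree_monom_le])
  also have "\<dots> = (\<Sum>i\<in>{k}. smult (coeff (monom a k) i) ((shift ^^ i) M))"
    by (rule sum.mono_neutral_right) auto
  finally show ?thesis by simp
qed

lemma shift_smult: "shift (smult c M) = smult (\<sigma> c) (shift M)"
  by (simp add: shift_def map_poly_hom_smult)

lemma shift_smult_fixed: "\<sigma> c = c \<Longrightarrow> (shift ^^ i) (smult c M) = smult c ((shift ^^
  i) M)"
  by (induction i) (simp_all add: shift_smult)

lemma skew_mult_smult_right: "\<sigma> c = c \<Longrightarrow> skew_mult A (smult c M) = smult c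
  (skew_mult A M)"
  by (simp add: skew_mult_def shift_smult_fixed smult_sum2 mult.commute)

lemma shift_power_degree:
  assumes "M \<noteq> 0"
  shows "degree ((shift ^^ i) M) = i + degree M \<and> (shift ^^ i) M \<noteq> 0"
proof (induction i)
  case (Suc i)
  define P where "P = (shift ^^ i) M"
  have "P \<noteq> 0" using Suc P_def by auto
  then have "degree (shift P) = Suc (degree P)" "shift P \<noteq> 0" by (simp_all add: shift_def)
  then show ?case using Suc unfolding P_def by simp
qed (use assms in simp)

text \<open>Pseudo-division from the right: with l the leading coefficient of E^k M, the difference
  of l A and lead(A) E^k M has lower degree. No inverses are taken; the scalars l are collected in
  \<open>f\<close>. The bound on the degree of C is kept because later only upper bounds on the
  factors survive reduction.\<close>

lemma skew_division:
  assumes M: "M \<noteq> 0"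
  shows "\<exists>f C R. f \<noteq> 0 \<and> smult f A = skew_mult C M + R \<and> (R = 0 \<or> degree R
    < degree M)
           \<and> degree C \<le> degree A - degree M"
proof (induction "degree A" arbitrary: A rule: less_induct)
  case less
  show ?case
  proof (cases "A = 0 \<or> degree A < degree M")
    case True
    then show ?thesis
      by (intro exI[of _ 1] exI[of _ 0] exI[of _ A]) auto
  next
    case False
    define k where "k = degree A - degree M"
    define S where "S = (shift ^^ k) M"
    define l where "l = lead_coeff S"
    have "degree S = degree A \<and> S \<noteq> 0"
      using shift_power_degree[OF M, of k] False by (simp add: S_def k_def)
    then have S: "degree S = degree A" "l \<noteq> 0" unfolding l_def leading_coeff_0_iff by blast+
    define A' where "A' = smult l A - smult (lead_coeff A) S"
    have A': "degree A' \<le> degree A" "coeff A' (degree A) = 0"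
      using S unfolding A'_def
      by (auto intro!: degree_diff_le degree_smult_le[THEN order_trans] simp: l_def)
    have eq: "smult l A = A' + smult (lead_coeff A) S" by (simp add: A'_def)
    show ?thesis
    proof (cases "A' = 0")
      case True
      then have "smult l A = skew_mult (monom (lead_coeff A) k) M + 0"
        unfolding eq skew_mult_monom S_def by simp
      then show ?thesis using S(2) degree_monom_le[of "lead_coeff A" k] unfolding k_def[symmetric]
        by blast
    next
      case nz: False
      have "degree A' < degree A"
      proof (rule ccontr)
        assume "\<not> ?thesis"
        then have "lead_coeff A' = 0" using A' by simp
        then show False using nz by simp
      qed
      from less[OF this] obtain f C R where IH: "f \<noteq> 0" "smult f A' = skew_mult C M + R"
        "R = 0 \<or> degree R < degree M" "degree C \<le> degree A' - degree M" by blast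
      have "smult (f * l) A = smult f A' + smult (f * lead_coeff A) S"
        using eq by (metis smult_add_right smult_smult)
      also have "\<dots> = skew_mult (C + monom (f * lead_coeff A) k) M + R"
        unfolding IH(2) skew_mult_add_left skew_mult_monom S_def by simp
      finally have "smult (f * l) A = skew_mult (C + monom (f * lead_coeff A) k) M + R" .
      moreover have "degree (C + monom (f * lead_coeff A) k) \<le> degree A - degree M"
        using IH(4) A'(1) by (intro degree_add_le) (auto simp: k_def intro: degree_monom_le)
      ultimately show ?thesis using IH(1,3) S(2) by (metis mult_eq_0_iff)
    qed
  qed
qed

lemma map_poly_shift:
  assumes "comm_ring_hom h" and "\<And>x. h (\<sigma> x) = h x"
  shows "map_poly h ((shift ^^ i) M) = monom 1 i * map_poly h M"
proof (induction i)
  case (Suc i)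
  interpret h: comm_ring_hom h by fact
  have "map_poly h (shift P) = monom 1 1 * map_poly h P" for P
    by (rule poly_eqI) (simp add: shift_def coeff_pCons assms(2) monom_Suc split: nat.split)
  then show ?case using Suc by (simp add: monom_Suc)
qed (simp add: monom_0)

text \<open>If h does not distinguish x from \<open>\<sigma>\<close> x, then E commutes with all
  scalars in the image, and the skew product becomes the ordinary one.\<close>

lemma map_poly_skew_mult:
  assumes "comm_ring_hom h" and "\<And>x. h (\<sigma> x) = h x"
  shows "map_poly h (skew_mult C M) = map_poly h C * map_poly h M"
proof -
  interpret h: comm_ring_hom h by fact
  interpret mh: map_poly_comm_ring_hom h ..
  have "map_poly h (skew_mult C M) = (\<Sum>i\<le>degree C. smult (h (coeff C i)) (monom 1 i * map_poly
    h M))"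
    unfolding skew_mult_def by (simp add: mh.hom_sum h.map_poly_hom_smult map_poly_shift[OF assms])
  also have "\<dots> = (\<Sum>i\<le>degree C. monom (coeff (map_poly h C) i) i) * map_poly h M"
    by (simp add: sum_distrib_right smult_monom_mult flip: mult_smult_left) (simp add: smult_monom)
  also have "(\<Sum>i\<le>degree C. monom (coeff (map_poly h C) i) i) = map_poly h C"
    by (rule poly_as_sum_of_monoms') (rule degree_map_poly_le)
  finally show ?thesis .
qed

end

text \<open>A substitute for the Gauss lemma. If h kills f, then the images of C and M multiply to 0
  over a domain, so one of them is 0; that factor is divisible by p, and p cancels against f. This
  can happen only finitely often. The product is a parameter, so that one statement serves both skew
  and ordinary polynomials.\<close>

lemma reduce_factorization:
  fixes h :: "'a::idom \<Rightarrow> 'b::idom" and mult :: "'a poly \<Rightarrow> 'a poly \<Rightarrow>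
    'a poly"
  assumes h: "comm_ring_hom h"
    and ker: "\<And>x. h x = 0 \<Longrightarrow> p dvd x" and hp: "h p = 0" and p: "p \<noteq> 0"
    and fin: "\<And>x. x \<noteq> 0 \<Longrightarrow> \<exists>N. \<not> p ^ N dvd x"
    and hom: "\<And>C M. map_poly h (mult C M) = map_poly h C * map_poly h M"
    and left: "\<And>C M. mult (smult p C) M = smult p (mult C M)"
    and right: "\<And>C M. mult C (smult p M) = smult p (mult C M)"
    and fact: "f \<noteq> 0" "smult f A = mult C M"
  shows "\<exists>f' C' M'. f' \<noteq> 0 \<and> smult f' (map_poly h A) = C' * M'
           \<and> degree C' \<le> degree C \<and> degree M' \<le> degree M"
proof -
  interpret h: comm_ring_hom h by fact
  have pull: "\<exists>D. P = smult p D \<and> degree D = degree P" if "map_poly h P = 0" for P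
  proof -
    have "h (coeff P i) = 0" for i
      using that by (metis coeff_0 h.coeff_map_poly_hom)
    then have "[:p:] dvd P" by (auto simp: const_poly_dvd_iff intro: ker)
    then obtain D where "P = smult p D" by (auto elim: dvdE)
    then show ?thesis using p by auto
  qed
  \<comment> \<open>N bounds the exponent of p in f; it drops with each cancellation, and N = 0 is
    contradictory since p^0 = 1 divides f.\<close>
  have "\<not> p ^ N dvd f \<Longrightarrow> f \<noteq> 0 \<Longrightarrow> smult f A = mult C M
    \<Longrightarrow> ?thesis" for N
  proof (induction N arbitrary: f C M)
    case (Suc N)
    show ?case
    proof (cases "h f = 0")
      case False
      have "smult (h f) (map_poly h A) = map_poly h C * map_poly h M"
        using arg_cong[OF Suc.prems(3), of "map_poly h"] by (simp add: hom h.map_poly_hom_smult)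
      then show ?thesis using False degree_map_poly_le by blast
    next
      case True
      then obtain g where g: "f = p * g" using ker by (auto elim: dvdE)
      then have g': "\<not> p ^ N dvd g" "g \<noteq> 0" using Suc.prems by auto
      have "map_poly h C * map_poly h M = 0"
        using arg_cong[OF Suc.prems(3), of "map_poly h"] by (simp add: hom h.map_poly_hom_smult True)
      then consider "map_poly h C = 0" | "map_poly h M = 0" by auto
      then show ?thesis
      proof cases
        case 1
        then obtain D where D: "C = smult p D" "degree D = degree C" using pull by blast
        then have "smult p (smult g A) = smult p (mult D M)"
          using Suc.prems(3) g by (simp add: left)
        then have "smult g A = mult D M" using p by (simp add: smult_cancel)
        from Suc.IH[OF g' this] D(2) show ?thesis by simp
      next
        case 2
        then obtain D where D: "M = smult p D" "degree D = degree M" using pull by blast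
        then have "smult p (smult g A) = smult p (mult C D)"
          using Suc.prems(3) g by (simp add: right)
        then have "smult g A = mult C D" using p by (simp add: smult_cancel)
        from Suc.IH[OF g' this] D(2) show ?thesis by simp
      qed
    qed
  qed simp
  then show ?thesis using fin fact by blast
qed

section \<open>Inhomogeneous relations\<close>

text \<open>\<open>ev n\<close> stands for the substitution Q = q^n and \<open>\<sigma>\<close> for
  Q -> qQ. The last assumption matches the operator shift with the shift of sequences, so relations
  form a left module over the skew polynomials.\<close>

locale skew_relation = skew_poly \<sigma> for \<sigma> :: "'a::idom \<Rightarrow> 'a" +
  fixes ev :: "nat \<Rightarrow> 'a \<Rightarrow> 'k::field" and J :: "nat \<Rightarrow> 'k"
  assumes ev_hom: "comm_ring_hom (ev n)" and ev_sigma: "ev n (\<sigma> x) = ev (Suc n) x"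
begin

definition act :: "'a poly \<Rightarrow> nat \<Rightarrow> 'k" where
  "act M n = (\<Sum>i\<le>degree M. ev n (coeff M i) * J (n + i))"

definition relation :: "'a poly \<Rightarrow> 'a \<Rightarrow> bool" where
  "relation M b \<longleftrightarrow> (\<forall>n\<ge>1. act M n = ev n b)"

lemma act_extend:
  assumes "degree M \<le> N"
  shows "act M n = (\<Sum>i\<le>N. ev n (coeff M i) * J (n + i))"
proof -
  interpret h: comm_ring_hom "ev n" by (rule ev_hom)
  show ?thesis unfolding act_def
    by (rule sum.mono_neutral_left) (use assms in \<open>auto simp: coeff_eq_0\<close>)
qed

lemma act_add: "act (A + B) n = act A n + act B n"
proof -
  interpret h: comm_ring_hom "ev n" by (rule ev_hom)
  define N where "N = max (degree A) (degree B)"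
  have "degree A \<le> N" "degree B \<le> N" "degree (A + B) \<le> N"
    by (simp_all add: N_def degree_add_le_max)
  then show ?thesis
    by (simp add: act_extend h.hom_add distrib_right sum.distrib)
qed

lemma act_smult: "act (smult c A) n = ev n c * act A n"
proof -
  interpret h: comm_ring_hom "ev n" by (rule ev_hom)
  show ?thesis
    by (subst (1 2) act_extend[of _ "degree A"])
      (simp_all add: degree_smult_le h.hom_mult sum_distrib_left mult.assoc)
qed

lemma act_shift: "act (shift M) n = act M (Suc n)"
proof -
  interpret h: comm_ring_hom "ev n" by (rule ev_hom)
  have "degree (shift M) \<le> Suc (degree M)"
    by (simp add: shift_def degree_pCons_le[THEN order_trans])
  then have "act (shift M) n = (\<Sum>i\<le>Suc (degree M). ev n (coeff (shift M) i) * J (n + i))"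
    by (rule act_extend)
  also have "\<dots> = (\<Sum>i\<le>degree M. ev n (coeff (shift M) (Suc i)) * J (n + Suc i))"
    by (subst sum.atMost_Suc_shift) (simp add: shift_def)
  also have "\<dots> = act M (Suc n)"
    by (simp add: act_def shift_def ev_sigma)
  finally show ?thesis .
qed

lemma relation_smult:
  assumes "relation M b"
  shows "relation (smult c M) (c * b)"
proof -
  have "ev n (c * b) = ev n c * ev n b" for n
  proof -
    interpret h: comm_ring_hom "ev n" by (rule ev_hom)
    show ?thesis by (rule h.hom_mult)
  qed
  then show ?thesis using assms by (simp add: relation_def act_smult)
qed

lemma relation_add:
  assumes "relation A a" "relation B b"
  shows "relation (A + B) (a + b)"
proof -
  have "ev n (a + b) = ev n a + ev n b" for n
  proof -
    interpret h: comm_ring_hom "ev n" by (rule ev_hom)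
    show ?thesis by (rule h.hom_add)
  qed
  then show ?thesis using assms by (simp add: relation_def act_add)
qed

lemma relation_shift: "relation M b \<Longrightarrow> relation (shift M) (\<sigma> b)"
  by (simp add: relation_def act_shift ev_sigma)

lemma relation_0: "relation 0 0"
proof -
  have "ev n 0 = 0" for n
  proof -
    interpret h: comm_ring_hom "ev n" by (rule ev_hom)
    show ?thesis by (rule h.hom_zero)
  qed
  then show ?thesis by (simp add: relation_def act_def)
qed

lemma relation_skew_mult:
  assumes "relation M b"
  shows "\<exists>b'. relation (skew_mult C M) b'"
proof -
  have s: "relation ((shift ^^ i) M) ((\<sigma> ^^ i) b)" for i
    by (induction i) (simp_all add: assms relation_shift)
  have "\<exists>b'. relation (\<Sum>i\<in>I. smult (coeff C i) ((shift ^^ i) M)) b'" if "finite I" for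
    I
    using that
  proof (induction I)
    case empty
    show ?case using relation_0 by auto
  next
    case (insert i I)
    then show ?case using relation_add[OF relation_smult[OF s]] by (simp; blast)
  qed
  then show ?thesis by (simp add: skew_mult_def)
qed

text \<open>The remainder of f A by a relation D of least order is itself a relation of lower order,
  hence 0. Then \<open>order0\<close> excludes a constant D, and \<open>irred\<close> excludes every
  degree strictly between 0 and that of A.\<close>

lemma minimal_degree:
  assumes A: "relation A B"
    and order0: "\<And>c b. c \<noteq> 0 \<Longrightarrow> \<not> relation [:c:] b"
    and irred: "\<And>f C M. f \<noteq> 0 \<Longrightarrow> smult f A = skew_mult C M \<Longrightarrow>
      0 < degree M \<Longrightarrow> degree M < degree A
       \<Longrightarrow> degree C \<le> degree A - degree M \<Longrightarrow> False"
    and M: "M \<noteq> 0" "relation M b"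
  shows "degree A \<le> degree M"
proof (rule ccontr)
  assume less: "\<not> degree A \<le> degree M"
  obtain D where D: "D \<noteq> 0" "\<exists>b. relation D b"
    and min: "\<And>D'. D' \<noteq> 0 \<and> (\<exists>b. relation D' b) \<Longrightarrow> degree D
      \<le> degree D'"
    using ex_has_least_nat[of "\<lambda>D. D \<noteq> 0 \<and> (\<exists>b. relation D b)" M degree] M
      by blast
  obtain d where d: "relation D d" using D by blast
  have DM: "degree D \<le> degree M" using min M by blast
  obtain f C R where f: "f \<noteq> 0" "smult f A = skew_mult C D + R" "R = 0 \<or> degree R < degree D"
    "degree C \<le> degree A - degree D"
    using skew_division[OF D(1)] by blast
  obtain c where "relation (skew_mult C D) c" using relation_skew_mult[OF d] by blast
  from relation_add[OF relation_smult[OF A, of f] relation_smult[OF this, of "-1"]]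
  have "relation R (f * B + - 1 * c)" using f(2) by simp
  then have "R = 0" using f(3) min[of R] by fastforce
  moreover have "0 < degree D"
  proof (rule ccontr)
    assume "\<not> 0 < degree D"
    then obtain e where "D = [:e:]" by (auto elim: degree_eq_zeroE)
    then show False using order0[of e d] D(1) d by auto
  qed
  ultimately show False using irred[of f C D] f less DM by auto
qed

end

section \<open>Clearing denominators\<close>

text \<open>Every element of the target is a quotient of two images; the division-free form composes
  well when denominators are cleared.\<close>

definition fraction_dense :: "('a::idom \<Rightarrow> 'b::idom) \<Rightarrow> bool" where
  "fraction_dense h \<longleftrightarrow> (\<forall>x. \<exists>d y. d \<noteq> 0 \<and> h d * x = h y)"

lemma fraction_dense_poly:
  assumes "inj_idom_hom h" and dense: "fraction_dense h"
  shows "\<exists>d P. d \<noteq> 0 \<and> smult (h d) p = map_poly h P"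
proof (induction p)
  case 0
  show ?case by (intro exI[of _ 1] exI[of _ 0]) simp
next
  case (pCons a p)
  interpret h: inj_idom_hom h by fact
  obtain d P where d: "d \<noteq> 0" "smult (h d) p = map_poly h P" using pCons by blast
  obtain e y where e: "e \<noteq> 0" "h e * a = h y" using dense unfolding fraction_dense_def by blast
  have "smult (h (d * e)) (pCons a p) = pCons (h d * (h e * a)) (smult (h e) (smult (h d) p))"
    by (simp add: h.hom_mult mult_ac)
  also have "\<dots> = map_poly h (pCons (d * y) (smult e P))"
    unfolding d e by (simp add: h.hom_mult h.map_poly_hom_smult h.map_poly_pCons_hom)
  finally show ?case using d(1) e(1) by (metis mult_eq_0_iff)
qed

text \<open>Adjoining a variable and passing to fractions on the target side preserves both
  properties. Starting from Z in Q, two applications give Z[q] in Q(q) and Z[q,Q] in Q(q,Q).\<close>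

lemma fraction_dense_fract:
  assumes "inj_idom_hom h" and dense: "fraction_dense h"
  shows "inj_idom_hom (\<lambda>p. to_fract (map_poly h p))" and "fraction_dense (\<lambda>p. to_fract
    (map_poly h p))"
proof -
  interpret h: inj_idom_hom h by fact
  interpret mh: map_poly_inj_idom_hom h ..
  show "inj_idom_hom (\<lambda>p. to_fract (map_poly h p))"
    by unfold_locales (auto simp: mh.hom_mult mh.hom_add to_fract_add)
  show "fraction_dense (\<lambda>p. to_fract (map_poly h p))"
    unfolding fraction_dense_def
  proof
    fix x :: "'b poly fract"
    obtain a b where x: "x = Fract a b" "b \<noteq> 0" by (cases x) auto
    obtain d A where A: "d \<noteq> 0" "smult (h d) a = map_poly h A"
      using fraction_dense_poly[OF assms] by blast
    obtain e B where B: "e \<noteq> 0" "smult (h e) b = map_poly h B"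
      using fraction_dense_poly[OF assms] by blast
    have "B \<noteq> 0" using B x(2) by auto
    have "to_fract (map_poly h (smult d B)) * x = to_fract (map_poly h (smult e A))"
      unfolding h.map_poly_hom_smult A(2)[symmetric] B(2)[symmetric] x(1) to_fract_def
      using x(2) by (simp add: eq_fract mult_ac)
    then show "\<exists>d y. d \<noteq> 0 \<and> to_fract (map_poly h d) * x = to_fract (map_poly h y)"
      using A(1) \<open>B \<noteq> 0\<close> by (metis smult_eq_0_iff)
  qed
qed

lemma fraction_dense_of_int: "fraction_dense (of_int :: int \<Rightarrow> rat)"
  unfolding fraction_dense_def
proof
  fix x :: rat
  obtain a b where "x = Rat.Fract a b" "b > 0" by (cases x) auto
  then have "of_int b * x = of_int a" "b \<noteq> 0"
    by (simp_all add: Fract_of_int_quotient)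
  then show "\<exists>d y. d \<noteq> 0 \<and> of_int d * x = of_int y" by blast
qed

definition int_poly_ratfun :: "int poly \<Rightarrow> ratfun" where
  "int_poly_ratfun p = to_fract (map_poly of_int p)"

definition int_poly_ratfun2 :: "int poly poly \<Rightarrow> ratfun2" where
  "int_poly_ratfun2 p = to_fract (map_poly int_poly_ratfun p)"

definition eval_at :: "nat \<Rightarrow> int poly poly \<Rightarrow> ratfun" where
  "eval_at n p = poly (map_poly int_poly_ratfun p) (qvar ^ n)"

text \<open>The substitution Q -> qQ: the outer variable is Q, the inner one q.\<close>

definition q_shift :: "int poly poly \<Rightarrow> int poly poly" where
  "q_shift p = pcompose p [:0, [:0, 1:]:]"

lemma int_poly_ratfun_hom: "inj_idom_hom int_poly_ratfun"
  and int_poly_ratfun_dense: "fraction_dense int_poly_ratfun"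
  using fraction_dense_fract[OF of_int_hom.inj_idom_hom_axioms fraction_dense_of_int]
  by (simp_all add: int_poly_ratfun_def[abs_def])

lemma int_poly_ratfun2_hom: "inj_idom_hom int_poly_ratfun2"
  and int_poly_ratfun2_dense: "fraction_dense int_poly_ratfun2"
  using fraction_dense_fract[OF int_poly_ratfun_hom int_poly_ratfun_dense]
  by (simp_all add: int_poly_ratfun2_def[abs_def])

interpretation int_poly_ratfun: inj_idom_hom int_poly_ratfun by (rule int_poly_ratfun_hom)
interpretation int_poly_ratfun2: inj_idom_hom int_poly_ratfun2 by (rule int_poly_ratfun2_hom)
interpretation map_int_poly_ratfun: map_poly_inj_idom_hom int_poly_ratfun ..

lemma int_poly_ratfun_q: "int_poly_ratfun [:0, 1:] = qvar"
  by (simp add: int_poly_ratfun_def qvar_def to_fract_def)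

lemma eval_at_hom: "comm_ring_hom (eval_at n)"
  by unfold_locales (simp_all add: eval_at_def map_int_poly_ratfun.hom_add map_int_poly_ratfun.hom_mult)

interpretation q_shift: inj_idom_hom q_shift
proof unfold_locales
  fix p assume "q_shift p = 0"
  then show "p = 0" unfolding q_shift_def by (rule pcompose_eq_0) simp
qed (simp_all add: q_shift_def pcompose_add pcompose_mult)

lemma eval_at_q_shift: "eval_at n (q_shift p) = eval_at (Suc n) p"
  by (simp add: eval_at_def q_shift_def int_poly_ratfun.map_poly_pcompose poly_pcompose
      int_poly_ratfun.map_poly_pCons_hom int_poly_ratfun_q mult.commute)

interpretation jones: skew_relation q_shift eval_at "colored_jones p" for p
  by (intro skew_relation.intro skew_poly.intro skew_relation_axioms.intro
      q_shift.inj_idom_hom_axioms eval_at_hom eval_at_q_shift)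

lemma ratfun2_eval_quotient:
  assumes "int_poly_ratfun2 d * r = int_poly_ratfun2 m" and "eval_at n d \<noteq> 0"
  shows "regular_at r (qvar ^ n)" and "ratfun2_eval r (qvar ^ n) = eval_at n m / eval_at n d"
proof -
  define d' m' where "d' = map_poly int_poly_ratfun d" and "m' = map_poly int_poly_ratfun m"
  have d': "poly d' (qvar ^ n) \<noteq> 0" using assms(2) by (simp add: eval_at_def d'_def)
  then have "d' \<noteq> 0" by auto
  have e: "to_fract d' * r = to_fract m'" using assms(1) by (simp add: int_poly_ratfun2_def d'_def
    m'_def)
  have "r = Fract m' d'"
  proof (cases r)
    case (Fract a b)
    then show ?thesis using e \<open>d' \<noteq> 0\<close> by (simp add: to_fract_def eq_fract mult_ac)
  qed
  then show "regular_at r (qvar ^ n)" "ratfun2_eval r (qvar ^ n) = eval_at n m / eval_at n d"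
    using d' by (auto simp: regular_at_def ratfun2_eval_Fract eval_at_def d'_def m'_def)
qed

lemma shiftE_power: "(shiftE ^^ i) J n = J (n + i)"
  by (induction i arbitrary: n) (simp_all add: shiftE_def)

lemma inhom_relation_if_relation:
  assumes "jones.relation p P b"
  shows "inhom_relation (map_poly int_poly_ratfun2 P) (int_poly_ratfun2 b) (colored_jones p)"
proof -
  interpret ev: comm_ring_hom "eval_at n" for n by (rule eval_at_hom)
  have e: "ratfun2_eval (int_poly_ratfun2 c) (qvar ^ n) = eval_at n c" for c n
    using ratfun2_eval_quotient(2)[of 1 "int_poly_ratfun2 c" c n] by simp
  show ?thesis
    using assms
    by (simp add: inhom_relation_def apply_op_def coeff_op_def e shiftE_power jones.relation_def
      jones.act_def)
qed

text \<open>The given relation speaks only about those n at which nothing has a pole, the cleared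
  one about every n >= 1. The gap is closed by one more factor.\<close>

lemma relation_if_inhom_relation:
  assumes "inhom_relation A B (colored_jones p)" and "A \<noteq> 0"
  obtains M b where "M \<noteq> 0" "degree M = degree A" "jones.relation p M b"
proof -
  obtain d M where M: "d \<noteq> 0" "smult (int_poly_ratfun2 d) A = map_poly int_poly_ratfun2 M"
    using fraction_dense_poly[OF int_poly_ratfun2_hom int_poly_ratfun2_dense] by blast
  obtain e b where b: "e \<noteq> 0" "int_poly_ratfun2 e * B = int_poly_ratfun2 b"
    using int_poly_ratfun2_dense unfolding fraction_dense_def by blast
  have degM: "degree M = degree A" "M \<noteq> 0"
  proof -
    have "degree (map_poly int_poly_ratfun2 M) = degree A"
      unfolding M(2)[symmetric] using M(1) by simp
    then show "degree M = degree A" by simp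
    have "map_poly int_poly_ratfun2 M \<noteq> 0" unfolding M(2)[symmetric] using M(1) assms(2) by simp
    then show "M \<noteq> 0" by auto
  qed
  define D where "D = d * e"
  have D: "D \<noteq> 0" using M(1) b(1) by (simp add: D_def)
  have c1: "int_poly_ratfun2 D * coeff A i = int_poly_ratfun2 (e * coeff M i)" for i
  proof -
    have "int_poly_ratfun2 d * coeff A i = int_poly_ratfun2 (coeff M i)"
      using arg_cong[OF M(2), of "\<lambda>P. coeff P i"] by simp
    then show ?thesis by (simp add: D_def int_poly_ratfun2.hom_mult mult_ac)
  qed
  have c2: "int_poly_ratfun2 D * B = int_poly_ratfun2 (d * b)"
    using b(2) by (simp add: D_def int_poly_ratfun2.hom_mult mult_ac)
  \<comment> \<open>Multiplying by e and d alone would clear the denominators. The extra factor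
    \<open>D\<close> makes both sides 0 at the points where \<open>D\<close> vanishes and the
    original relation says nothing.\<close>
  have "jones.relation p (smult (D * e) M) (D * (d * b))"
    unfolding jones.relation_def
  proof (intro allI impI)
    fix n :: nat assume n: "n \<ge> 1"
    interpret ev: comm_ring_hom "eval_at n" by (rule eval_at_hom)
    show "jones.act p (smult (D * e) M) n = eval_at n (D * (d * b))"
    proof (cases "eval_at n D = 0")
      case True
      then show ?thesis by (simp add: jones.act_smult ev.hom_mult)
    next
      case False
      have "apply_op A (colored_jones p) n = ratfun2_eval B (qvar ^ n)"
        using assms(1) n ratfun2_eval_quotient(1)[OF c1 False] ratfun2_eval_quotient(1)[OF c2 False]
        unfolding inhom_relation_def by blast
      then have "(\<Sum>i\<le>degree A. eval_at n (e * coeff M i) / eval_at n D * colored_jones p (n +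
        i))
          = eval_at n (d * b) / eval_at n D"
        by (simp add: apply_op_def coeff_op_def ratfun2_eval_quotient(2)[OF c1 False]
            ratfun2_eval_quotient(2)[OF c2 False] shiftE_power)
      then have "eval_at n D * (\<Sum>i\<le>degree A. eval_at n (e * coeff M i) / eval_at n D *
        colored_jones p (n + i))
          = eval_at n (d * b)"
        using False by simp
      moreover have "eval_at n D * (\<Sum>i\<le>degree A. eval_at n (e * coeff M i) / eval_at n D *
        colored_jones p (n + i))
          = eval_at n e * jones.act p M n"
        using False by (simp add: jones.act_def degM sum_distrib_left ev.hom_mult mult_ac)
      ultimately show ?thesis by (simp add: jones.act_smult ev.hom_mult)
    qed
  qed
  moreover have "smult (D * e) M \<noteq> 0" "degree (smult (D * e) M) = degree A"
    using D b(1) degM by simp_all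
  ultimately show ?thesis using that by blast
qed

section \<open>Degree growth\<close>

text \<open>The degree of a rational function at infinity, as a relation so that no junk value at 0
  arises.\<close>

definition has_degree :: "ratfun \<Rightarrow> int \<Rightarrow> bool" where
  "has_degree x d \<longleftrightarrow> (\<exists>a b. a \<noteq> 0 \<and> b \<noteq> 0 \<and> x = Fract
    a b \<and> d = int (degree a) - int (degree b))"

lemma has_degree_unique:
  assumes "has_degree x d" "has_degree x e"
  shows "d = e"
proof -
  obtain a b a' b' where 1: "a \<noteq> 0" "b \<noteq> 0" "x = Fract a b" "d = int (degree a) - int
    (degree b)"
    and 2: "a' \<noteq> 0" "b' \<noteq> 0" "x = Fract a' b'" "e = int (degree a') - int (degree b')"
    using assms unfolding has_degree_def by blast
  have "a * b' = a' * b" using 1 2 by (simp add: eq_fract)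
  then have "degree a + degree b' = degree a' + degree b"
    using 1 2 by (metis degree_mult_eq)
  then show ?thesis using 1(4) 2(4) by linarith
qed

lemma has_degree_nz: "has_degree x d \<Longrightarrow> x \<noteq> 0"
  by (auto simp: has_degree_def Zero_fract_def eq_fract)

lemma has_degree_to_fract: "p \<noteq> 0 \<Longrightarrow> has_degree (to_fract p) (int (degree p))"
  unfolding has_degree_def by (intro exI[of _ p] exI[of _ 1]) (simp add: to_fract_def)

lemma has_degree_mult:
  assumes "has_degree x d" "has_degree y e"
  shows "has_degree (x * y) (d + e)"
proof -
  obtain a b a' b' where 1: "a \<noteq> 0" "b \<noteq> 0" "x = Fract a b" "d = int (degree a) - int
    (degree b)"
    and 2: "a' \<noteq> 0" "b' \<noteq> 0" "y = Fract a' b'" "e = int (degree a') - int (degree b')"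
    using assms unfolding has_degree_def by blast
  then show ?thesis unfolding has_degree_def
    by (intro exI[of _ "a * a'"] exI[of _ "b * b'"]) (simp add: degree_mult_eq)
qed

lemma has_degree_inverse:
  assumes "has_degree x d"
  shows "has_degree (1 / x) (- d)"
proof -
  obtain a b where 1: "a \<noteq> 0" "b \<noteq> 0" "x = Fract a b" "d = int (degree a) - int (degree
    b)"
    using assms unfolding has_degree_def by blast
  then show ?thesis unfolding has_degree_def
    by (intro exI[of _ b] exI[of _ a]) (simp add: One_fract_def)
qed

lemma has_degree_uminus: "has_degree x d \<Longrightarrow> has_degree (- x) d"
  unfolding has_degree_def by (metis degree_minus minus_fract neg_equal_0_iff_equal)

lemma has_degree_add:
  assumes "has_degree x d" "has_degree y e" "e < d"
  shows "has_degree (x + y) d"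
proof -
  obtain a b a' b' where 1: "a \<noteq> 0" "b \<noteq> 0" "x = Fract a b" "d = int (degree a) - int
    (degree b)"
    and 2: "a' \<noteq> 0" "b' \<noteq> 0" "y = Fract a' b'" "e = int (degree a') - int (degree b')"
    using assms unfolding has_degree_def by blast
  have less: "degree (a' * b) < degree (a * b')" using 1 2 assms(3) by (simp add: degree_mult_eq)
  have deg: "degree (a * b' + a' * b) = degree (a * b')" by (rule degree_add_eq_left[OF less])
  have "a * b' + a' * b \<noteq> 0" using deg less by auto
  then show ?thesis unfolding has_degree_def
    using 1 2 deg by (intro exI[of _ "a * b' + a' * b"] exI[of _ "b * b'"]) (simp add: degree_mult_eq)
qed

lemma has_degree_diff: "has_degree x d \<Longrightarrow> has_degree y e \<Longrightarrow> e < d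
  \<Longrightarrow> has_degree (x - y) d"
  using has_degree_add[OF _ has_degree_uminus] by fastforce

lemma has_degree_qpower: "has_degree (qvar ^ m) (int m)"
  using has_degree_to_fract[of "monom 1 m"] by (simp add: qvar_power degree_monom_eq)

lemma has_degree_qvar: "has_degree qvar 1"
  using has_degree_qpower[of 1] by simp

lemma has_degree_1: "has_degree 1 0"
  using has_degree_qpower[of 0] by simp

text \<open>In each of the k factors q^n dominates, as the competing power is at most q^k with k <
  n. So every factor has degree n.\<close>

lemma has_degree_cyclo_kernel:
  "k < n \<Longrightarrow> has_degree (cyclo_kernel n k) (int n * int k)"
proof (induction k)
  case 0
  show ?case by (simp add: has_degree_1)
next
  case (Suc k)
  have q: "has_degree (qvar * qvar ^ k) (int (Suc k))" using has_degree_qpower[of "Suc k"] by simp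
  have "has_degree (qvar ^ n + 1 / qvar ^ n - qvar * qvar ^ k - 1 / (qvar * qvar ^ k)) (int n)"
    by (rule has_degree_diff[OF has_degree_diff[OF has_degree_add[OF has_degree_qpower
      has_degree_inverse[OF has_degree_qpower]] q]
        has_degree_inverse[OF q]]) (use Suc.prems in auto)
  from has_degree_mult[OF Suc.IH this] Suc.prems show ?case
    by (simp add: cyclo_kernel_Suc kernel_factor_def algebra_simps)
qed

text \<open>The degrees of the terms increase strictly with k, so the last term dominates and
  nothing can cancel.\<close>

lemma has_degree_kernel_sum:
  assumes w: "\<And>k. has_degree (w k) (e k)" and e: "\<And>k. e k \<le> e (Suc k)"
  shows "Suc j \<le> n \<Longrightarrow> has_degree (\<Sum>k<Suc j. w k * cyclo_kernel n k) (e j + int n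
    * int j)"
proof (induction j)
  case 0
  then show ?case using w[of 0] by simp
next
  case (Suc j)
  have "has_degree (w (Suc j) * cyclo_kernel n (Suc j)) (e (Suc j) + int n * int (Suc j))"
    using Suc.prems by (intro has_degree_mult w has_degree_cyclo_kernel) simp
  moreover have "e j + int n * int j < e (Suc j) + int n * int (Suc j)"
    using e[of j] Suc.prems by (simp add: algebra_simps)
  ultimately show ?case
    using has_degree_add[OF _ Suc.IH] Suc.prems by (simp add: add.commute)
qed

lemma colored_jones_degree:
  assumes w: "\<And>k. has_degree (cyclo_jones p k) (e k)" and e: "\<And>k. e k \<le> e (Suc k)"
    and n: "n \<ge> 1"
  shows "\<exists>d. has_degree (colored_jones p n) d \<and> int n * (int n - 1) \<le> d"
proof -
  obtain j where j: "n = Suc j" using n by (cases n) auto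
  have "e 0 = 0" using has_degree_unique[OF w[of 0]] has_degree_1 by (simp add: cyclo_jones_0)
  moreover have "e 0 \<le> e j" by (rule lift_Suc_mono_le[of e]) (use e in auto)
  moreover have "has_degree (colored_jones p n) (e j + int n * int j)"
    using has_degree_kernel_sum[where w = "cyclo_jones p", OF w e, of j n] n
    by (simp add: colored_jones_eq_kernel_sum kernel_sum_def j)
  ultimately show ?thesis using j by (intro exI[of _ "e j + int n * int j"]) (simp add: algebra_simps)
qed

text \<open>With Q = q^n an element of Z[q,Q] becomes a polynomial in q: its degree is nonnegative
  unless it is 0, and grows at most linearly in n.\<close>

lemma has_degree_int_poly_ratfun_bound:
  "eval_at n b = 0 \<or> (\<exists>d\<ge>0. has_degree (eval_at n b) d)"
  "has_degree (eval_at n b) d \<Longrightarrow> d \<le> int (\<Sum>i\<le>degree b. degree (coeff b i)) +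
    int n * int (degree b)"
proof -
  define g :: "rat poly" where "g = (\<Sum>i\<le>degree b. map_poly of_int (coeff b i) * monom 1 (n *
    i))"
  have g: "eval_at n b = to_fract g"
  proof -
    have "eval_at n b = (\<Sum>i\<le>degree b. int_poly_ratfun (coeff b i) * (qvar ^ n) ^ i)"
      by (simp add: eval_at_def poly_altdef)
    also have "\<dots> = (\<Sum>i\<le>degree b. to_fract (map_poly of_int (coeff b i) * monom 1 (n *
      i)))"
      unfolding int_poly_ratfun_def power_mult[symmetric] by (simp only: qvar_power to_fract_mult)
    also have "\<dots> = to_fract g"
      unfolding g_def by (simp only: to_fract_sum to_fract_mult)
    finally show ?thesis .
  qed
  then show "eval_at n b = 0 \<or> (\<exists>d\<ge>0. has_degree (eval_at n b) d)"
    using has_degree_to_fract[of g] by (cases "g = 0") auto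
  have deg: "degree g \<le> (\<Sum>i\<le>degree b. degree (coeff b i)) + n * degree b"
    unfolding g_def
  proof (rule degree_sum_le)
    fix i assume i: "i \<in> {..degree b}"
    have "degree (map_poly of_int (coeff b i) * monom (1::rat) (n * i)) \<le> degree (coeff b i) + n *
      i"
      by (rule order_trans[OF degree_mult_le]) (simp add: degree_monom_eq degree_map_poly_le)
    also have "\<dots> \<le> (\<Sum>i\<le>degree b. degree (coeff b i)) + n * degree b"
      using i by (intro add_mono member_le_sum mult_le_mono) auto
    finally show "degree (map_poly of_int (coeff b i) * monom (1::rat) (n * i))
      \<le> (\<Sum>i\<le>degree b. degree (coeff b i)) + n * degree b" .
  qed simp
  assume d: "has_degree (eval_at n b) d"
  then have "g \<noteq> 0" using has_degree_nz[OF d] g by auto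
  then have "d = int (degree g)" using d has_degree_to_fract has_degree_unique unfolding g by blast
  then show "d \<le> int (\<Sum>i\<le>degree b. degree (coeff b i)) + int n * int (degree b)"
    using deg by (metis of_nat_add of_nat_le_iff of_nat_mult)
qed

lemma eval_at_eventually_nz:
  assumes "c \<noteq> 0"
  shows "\<exists>n\<ge>N. eval_at n c \<noteq> 0"
proof (rule ccontr)
  assume "\<not> ?thesis"
  then have "(\<lambda>n. qvar ^ n) ` {N..} \<subseteq> {x. poly (map_poly int_poly_ratfun c) x = 0}"
    by (auto simp: eval_at_def)
  moreover have "finite {x. poly (map_poly int_poly_ratfun c) x = 0}"
    using assms by (intro poly_roots_finite) simp
  ultimately have "finite ((\<lambda>n. qvar ^ n) ` {N..})" by (rule finite_subset)
  moreover have "inj_on (\<lambda>n. qvar ^ n) {N..}"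
    by (rule inj_onI) (metis has_degree_qpower has_degree_unique of_nat_eq_iff)
  ultimately show False using infinite_Ici by (metis finite_imageD)
qed

lemma no_order_0_relation:
  assumes w: "\<And>k. has_degree (cyclo_jones p k) (e k)" and e: "\<And>k. e k \<le> e (Suc k)"
    and c: "c \<noteq> 0"
  shows "\<not> jones.relation p [:c:] b"
proof
  assume r: "jones.relation p [:c:] b"
  define C D where "C = (\<Sum>i\<le>degree b. degree (coeff b i))" and "D = degree b"
  \<comment> \<open>With this bound n (n - 1), a lower bound for the degree of the colored Jones
    polynomial, exceeds C + n D, the upper bound for the right side. The second condition keeps the
    coefficient c from vanishing.\<close>
  obtain n where n: "n \<ge> C + D + 2" "eval_at n c \<noteq> 0" using eval_at_eventually_nz[OF c] by
    blast
  then have n1: "n \<ge> 1" by simp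
  have eq: "eval_at n c * colored_jones p n = eval_at n b"
    using r n1 by (simp add: jones.relation_def jones.act_def)
  obtain d where d: "has_degree (colored_jones p n) d" "int n * (int n - 1) \<le> d"
    using colored_jones_degree[OF w e n1] by blast
  obtain f where f: "f \<ge> 0" "has_degree (eval_at n c) f"
    using has_degree_int_poly_ratfun_bound(1)[of n c] n(2) by blast
  have "f + d \<le> int C + int n * int D"
    using has_degree_int_poly_ratfun_bound(2)[of n b] has_degree_mult[OF f(2) d(1)] eq
    unfolding C_def D_def by simp
  moreover have "int n * (int C + int D + 1) \<le> int n * (int n - 1)"
    using n(1) by (intro mult_left_mono) auto
  moreover have "int C \<le> int n * int C" using n1 by (cases n) (auto simp: algebra_simps)
  ultimately have "int n \<le> 0" using d(2) f(1) by (simp add: algebra_simps)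
  then show False using n1 by simp
qed

lemma degree_cyclo_jones_pos1: "has_degree (cyclo_jones 1 k) (\<Sum>i<k. int i + 2)"
proof (induction k)
  case (Suc k)
  have "has_degree (- (qvar ^ 2 * qvar ^ k) * cyclo_jones 1 k) (int (2::nat) + int k + (\<Sum>i<k. int i
    + 2))"
    by (intro has_degree_mult has_degree_uminus has_degree_qpower Suc)
  then show ?case by (simp add: cyclo_jones_pos1_Suc add_ac)
qed (simp add: cyclo_jones_0 has_degree_1)

lemma degree_cyclo_jones_neg1: "has_degree (cyclo_jones (- 1) k) 0"
  by (simp add: cyclo_jones_neg1 has_degree_1)

lemma degree_cyclo_jones_pos2:
  fixes e :: "nat \<Rightarrow> int"
  defines "e k \<equiv> (case k of 0 \<Rightarrow> 0 | Suc j \<Rightarrow> 4 + (\<Sum>i<j. 3 * int i +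
    7))"
  shows "has_degree (cyclo_jones 2 k) (e k)" and "e k \<le> e (Suc k)"
proof -
  have eS: "e (Suc (Suc k)) = e (Suc k) + (3 * int k + 7)" for k by (simp add: e_def)
  have "0 \<le> (\<Sum>i<j. 3 * int i + 7)" for j by (rule sum_nonneg) simp
  \<comment> \<open>Strict growth is essential: both coefficients of the recurrence have the same
    degree 3 k + 7, so the first term dominates only because the preceding cyclotomic coefficient
    has larger degree than the one before it.\<close>
  then have mono: "e k < e (Suc k)" for k
    by (cases k) (auto simp: e_def add_pos_nonneg)
  then show "e k \<le> e (Suc k)" by (rule less_imp_le)
  have "has_degree (cyclo_jones 2 k) (e k) \<and> has_degree (cyclo_jones 2 (Suc k)) (e (Suc k))"
  proof (induction k)
    case 0
    have "has_degree (- (qvar ^ 2 * (qvar ^ 2 + 1))) (int (2::nat) + int (2::nat))"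
      by (intro has_degree_uminus has_degree_mult has_degree_qpower has_degree_add[OF _ has_degree_1])
        simp
    then show ?case by (simp add: e_def cyclo_jones_0 has_degree_1 cyclo_jones_pos2_1 add.commute)
  next
    case (Suc k)
    define K where "K = qvar ^ k"
    have K: "has_degree K (int k)" unfolding K_def by (rule has_degree_qpower)
    have K2: "has_degree (K ^ 2) (int k + int k)" unfolding power2_eq_square by (rule has_degree_mult[OF
      K K])
    note q = has_degree_qpower
    have q1: "has_degree (qvar + 1) 1" by (rule has_degree_add[OF has_degree_qvar has_degree_1]) simp
    have a: "has_degree (qvar ^ 4 * K ^ 2 - qvar ^ 2 * K + (qvar + 1)) (int (4::nat) + (int k + int k))"
      by (rule has_degree_add[OF has_degree_diff[OF has_degree_mult[OF q K2] has_degree_mult[OF q K]]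
        q1]) simp_all
    have b: "has_degree (qvar * K - 1) (1 + int k)"
      by (rule has_degree_diff[OF has_degree_mult[OF has_degree_qvar K] has_degree_1]) simp
    have "has_degree (- (qvar ^ 3 * K * (qvar ^ 4 * K ^ 2 - qvar ^ 2 * K + (qvar + 1))) * cyclo_jones 2
      (Suc k)
        + qvar ^ 6 * K ^ 2 * (qvar * K - 1) * cyclo_jones 2 k)
      (int (3::nat) + int k + (int (4::nat) + (int k + int k)) + e (Suc k))"
      by (rule has_degree_add[OF has_degree_mult[OF has_degree_uminus[OF has_degree_mult[OF
        has_degree_mult[OF q K] a]]]
          has_degree_mult[OF has_degree_mult[OF has_degree_mult[OF q K2] b]]])
        (use Suc mono[of k] in auto)
    moreover have "cyclo_jones 2 (Suc (Suc k)) = - (qvar ^ 3 * K * (qvar ^ 4 * K ^ 2 - qvar ^ 2 * K +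
      (qvar + 1)))
       * cyclo_jones 2 (Suc k) + qvar ^ 6 * K ^ 2 * (qvar * K - 1) * cyclo_jones 2 k"
      unfolding cyclo_jones_pos2 K_def[symmetric] by (simp add: algebra_simps)
    ultimately show ?case using Suc by (simp add: eS add_ac)
  qed
  then show "has_degree (cyclo_jones 2 k) (e k)" by blast
qed

text \<open>In the recurrence the coefficient at k + 1 has degree 0 and the one at k has degree -1,
  so degree 0 propagates.\<close>

lemma degree_cyclo_jones_neg2: "has_degree (cyclo_jones (- 2) k) 0"
proof -
  have "has_degree (cyclo_jones (- 2) k) 0 \<and> has_degree (cyclo_jones (- 2) (Suc k)) 0"
  proof (induction k)
    case 0
    have "has_degree ((qvar ^ 2 + 1) * (1 / qvar ^ 2)) (int (2::nat) + - int (2::nat))"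
      by (intro has_degree_mult has_degree_inverse has_degree_qpower has_degree_add[OF _ has_degree_1])
        simp
    then show ?case by (simp add: cyclo_jones_0 has_degree_1 cyclo_jones_neg2_1 add.commute)
  next
    case (Suc k)
    define K where "K = qvar ^ k"
    have K: "has_degree K (int k)" unfolding K_def by (rule has_degree_qpower)
    have K2: "has_degree (K ^ 2) (int k + int k)" unfolding power2_eq_square by (rule has_degree_mult[OF
      K K])
    note q = has_degree_qpower
    have qi: "has_degree (1 / qvar) (- 1)" by (rule has_degree_inverse[OF has_degree_qvar])
    have i1: "has_degree (1 / (qvar ^ 2 * K)) (- (int (2::nat) + int k))"
      by (rule has_degree_inverse[OF has_degree_mult[OF q K]])
    have i2: "has_degree (1 / (qvar ^ 4 * K ^ 2)) (- (int (4::nat) + (int k + int k)))"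
      by (rule has_degree_inverse[OF has_degree_mult[OF q K2]])
    have a: "has_degree (1 + 1 / qvar - 1 / (qvar ^ 2 * K) + 1 / (qvar ^ 4 * K ^ 2)) 0"
      by (rule has_degree_add[OF has_degree_diff[OF has_degree_add[OF has_degree_1 qi] i1] i2]) simp_all
    have b: "has_degree (1 / qvar - 1 / (qvar ^ 2 * K)) (- 1)"
      by (rule has_degree_diff[OF qi i1]) simp
    have "has_degree (cyclo_jones (- 2) (Suc (Suc k))) (0 + 0)"
      unfolding cyclo_jones_neg2 K_def[symmetric]
      by (rule has_degree_diff[OF has_degree_mult[OF a] has_degree_mult[OF b]]) (use Suc in auto)
    then show ?case using Suc by simp
  qed
  then show ?thesis by blast
qed

section \<open>Reduction to the field with 11 elements\<close>

text \<open>The type of residues takes its modulus from the cardinality of a type.\<close>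

typedef eleven = "{..<11::nat}" by (rule exI[of _ 0]) simp

instance eleven :: prime_card
proof
  have "CARD(eleven) = 11"
    unfolding type_definition.card[OF type_definition_eleven] by simp
  moreover have "prime (11::nat)" by (simp add: prime_nat_numeral_eq)
  ultimately show "prime CARD(eleven)" by simp
qed

type_synonym gf11 = "eleven mod_ring"

lemma card_eleven: "CARD(eleven) = 11"
  unfolding type_definition.card[OF type_definition_eleven] by simp

lemma of_int_gf11_eq_0: "(of_int z :: gf11) = 0 \<longleftrightarrow> 11 dvd z"
  by (simp add: of_int_eq_0_iff_char_dvd card_eleven)

lemma gf11_cases: "\<exists>i\<in>{0..<11}. (x :: gf11) = of_int i"
proof -
  obtain i where "i < 11" "x = of_nat i"
    using surj_of_nat_mod_ring[of x] by (auto simp: card_eleven)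
  then show ?thesis by (intro bexI[of _ "int i"]) auto
qed

definition reduction :: "int \<Rightarrow> int poly poly \<Rightarrow> gf11" where
  "reduction a x = of_int (poly (map_poly (\<lambda>c. poly c 1) x) a)"

interpretation eval_1: map_poly_comm_ring_hom "\<lambda>c. poly c (1::int)" ..

lemma reduction_hom: "comm_ring_hom (reduction a)"
  by unfold_locales
    (simp_all add: reduction_def eval_1.hom_add eval_1.hom_mult)

lemma eval_1_q_shift: "map_poly (\<lambda>c. poly c 1) (q_shift x) = map_poly (\<lambda>c. poly c
  (1::int)) x"
  by (simp add: q_shift_def poly_hom.map_poly_pcompose poly_hom.map_poly_pCons_hom)

text \<open>The prime is q - 1, as a constant polynomial in Q. It is fixed by
  \<open>q_shift\<close>, so it can be pulled out of the right factor as well as the left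
  one.\<close>

lemma eval_1_factor:
  fixes f :: "int poly poly"
  assumes "f \<noteq> 0" "smult f A = jones.skew_mult C M"
  shows "\<exists>f' C' M'. f' \<noteq> 0 \<and> smult f' (map_poly (map_poly (\<lambda>c. poly c 1)) A)
    = C' * M'
           \<and> degree C' \<le> degree C \<and> degree M' \<le> degree M"
proof (rule reduce_factorization[where p = "[:[:-1, 1:]:]" and mult = jones.skew_mult])
  show h: "comm_ring_hom (map_poly (\<lambda>c. poly c (1::int)))" ..
  show "[:[:-1, 1:]:] dvd x" if "map_poly (\<lambda>c. poly c (1::int)) x = 0" for x
  proof -
    have "poly (coeff x i) 1 = 0" for i
      using arg_cong[OF that, of "\<lambda>p. coeff p i"] by simp
    then show ?thesis by (simp add: const_poly_dvd_iff poly_eq_0_iff_dvd)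
  qed
  show "map_poly (\<lambda>c. poly c (1::int)) [:[:-1, 1:]:] = 0" by simp
  show "\<exists>N. \<not> [:[:-1, 1:]:] ^ N dvd x" if "x \<noteq> 0" for x :: "int poly poly"
  proof -
    obtain i where i: "coeff x i \<noteq> 0" using \<open>x \<noteq> 0\<close> by (metis
      leading_coeff_0_iff)
    define N where "N = Suc (degree (coeff x i))"
    have "\<not> [:-1, 1:] ^ N dvd coeff x i"
    proof
      assume "[:-1, 1:] ^ N dvd coeff x i"
      from dvd_imp_degree_le[OF this i] show False by (simp add: N_def degree_linear_power del:
        power_Suc)
    qed
    then have "\<not> [:[:-1, 1:] ^ N:] dvd x" by (auto simp: const_poly_dvd_iff)
    then show ?thesis by (intro exI[of _ N]) (simp add: poly_const_pow)
  qed
  show "map_poly (map_poly (\<lambda>c. poly c 1)) (jones.skew_mult C M)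
      = map_poly (map_poly (\<lambda>c. poly c 1)) C * map_poly (map_poly (\<lambda>c. poly c 1)) M" for
        C M
    by (rule jones.map_poly_skew_mult[OF h eval_1_q_shift])
  have "q_shift [:[:-1, 1:]:] = [:[:-1, 1:]:]" by (simp add: q_shift_def)
  then show "jones.skew_mult C (smult [:[:-1, 1:]:] M) = smult [:[:-1, 1:]:] (jones.skew_mult C M)" for
    C M
    by (rule jones.skew_mult_smult_right)
qed (use assms in \<open>simp_all add: jones.skew_mult_smult_left\<close>)

lemma poly_factor:
  fixes f :: "int poly"
  assumes "f \<noteq> 0" "smult f A = C * M"
  shows "\<exists>f' C' M'. f' \<noteq> 0 \<and> smult f' (map_poly (\<lambda>x. poly x a) A) = C' * M'
           \<and> degree C' \<le> degree C \<and> degree M' \<le> degree M"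
proof (rule reduce_factorization[where p = "[:- a, 1:]" and mult = "(*)"])
  show "\<exists>N. \<not> [:- a, 1:] ^ N dvd x" if "x \<noteq> 0" for x :: "int poly"
  proof (intro exI[of _ "Suc (degree x)"] notI)
    assume "[:- a, 1:] ^ Suc (degree x) dvd x"
    from dvd_imp_degree_le[OF this that] show False by (simp add: degree_linear_power del: power_Suc)
  qed
  interpret p: map_poly_comm_ring_hom "\<lambda>x. poly x a" ..
  show "map_poly (\<lambda>x. poly x a) (C * M) = map_poly (\<lambda>x. poly x a) C * map_poly
    (\<lambda>x. poly x a) M" for C M
    by (rule p.hom_mult)
qed (use assms in \<open>auto simp: poly_eq_0_iff_dvd poly_hom.comm_ring_hom_axioms\<close>)

lemma mod_11_factor:
  fixes f :: int
  assumes "f \<noteq> 0" "smult f A = C * M"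
  shows "\<exists>f' C' M'. f' \<noteq> 0 \<and> smult f' (map_poly (of_int :: int \<Rightarrow> gf11)
    A) = C' * M'
           \<and> degree C' \<le> degree C \<and> degree M' \<le> degree M"
proof (rule reduce_factorization[where p = 11 and mult = "(*)"])
  show "\<exists>N. \<not> 11 ^ N dvd x" if "x \<noteq> 0" for x :: int
  proof (intro exI[of _ "nat \<bar>x\<bar>"] notI)
    assume "11 ^ nat \<bar>x\<bar> dvd x"
    then have "(11::int) ^ nat \<bar>x\<bar> \<le> \<bar>x\<bar>" using dvd_imp_le_int[OF that, of "11 ^
      nat \<bar>x\<bar>"] by simp
    moreover have "nat \<bar>x\<bar> < 11 ^ nat \<bar>x\<bar>" by (rule power_gt_expt) simp
    then have "int (nat \<bar>x\<bar>) < int (11 ^ nat \<bar>x\<bar>)" by (simp only: of_nat_less_iff)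
    ultimately show False by simp
  qed
  show "11 dvd x" if "(of_int x :: gf11) = 0" for x using that by (simp add: of_int_gf11_eq_0)
  show "(of_int 11 :: gf11) = 0" by (subst of_int_gf11_eq_0) simp
  show "map_poly (of_int :: int \<Rightarrow> gf11) (C * M) = map_poly of_int C * map_poly of_int M" for
    C M
    by (rule of_int_poly_hom.hom_mult)
qed (use assms in \<open>auto simp: of_int_hom.comm_ring_hom_axioms\<close>)

text \<open>Three reductions in a row, each keeping the degree bounds. At the end the scalar lies in
  a field and is absorbed into the left factor.\<close>

lemma reduction_factor:
  fixes f :: "int poly poly"
  assumes "f \<noteq> 0" "smult f A = jones.skew_mult C M"
  shows "\<exists>C' M'. map_poly (reduction a) A = C' * M' \<and> degree C' \<le> degree C \<and>
    degree M' \<le> degree M"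
proof -
  obtain f1 C1 M1 where 1: "f1 \<noteq> 0" "smult f1 (map_poly (map_poly (\<lambda>c. poly c 1)) A) = C1
    * M1"
    "degree C1 \<le> degree C" "degree M1 \<le> degree M"
    using eval_1_factor[OF assms] by blast
  obtain f2 C2 M2 where 2: "f2 \<noteq> 0"
    "smult f2 (map_poly (\<lambda>x. poly x a) (map_poly (map_poly (\<lambda>c. poly c 1)) A)) = C2 *
      M2"
    "degree C2 \<le> degree C1" "degree M2 \<le> degree M1"
    using poly_factor[OF 1(1,2)] by blast
  obtain f3 C3 M3 where 3: "f3 \<noteq> 0"
    "smult f3 (map_poly (of_int :: int \<Rightarrow> gf11) (map_poly (\<lambda>x. poly x a) (map_poly
      (map_poly (\<lambda>c. poly c 1)) A))) = C3 * M3"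
    "degree C3 \<le> degree C2" "degree M3 \<le> degree M2"
    using mod_11_factor[OF 2(1,2)] by blast
  have "map_poly (of_int :: int \<Rightarrow> gf11) (map_poly (\<lambda>x. poly x a) (map_poly (map_poly
    (\<lambda>c. poly c 1)) A))
      = map_poly (reduction a) A"
    by (rule poly_eqI) (simp add: coeff_map_poly reduction_def)
  then have "smult f3 (map_poly (reduction a) A) = C3 * M3" using 3(2) by simp
  then have "map_poly (reduction a) A = smult (1 / f3) C3 * M3"
    using 3(1) by (metis mult_smult_left nonzero_divide_eq_eq smult_1_left smult_smult mult.commute)
  moreover have "degree (smult (1 / f3) C3) \<le> degree C"
    using 1 2 3 degree_smult_le[of "1 / f3" C3] by linarith
  ultimately show ?thesis using 1 2 3 by (metis order_trans)
qed

section \<open>The minimality criterion\<close>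

lemma Poly_map:
  assumes "f 0 = 0"
  shows "Poly (map f L) = map_poly f (Poly L)"
  by (rule poly_eqI) (use assms in \<open>simp add: coeff_map_poly nth_default_map_eq[of f 0 0]\<close>)

text \<open>Reduction bounds the degrees of the factors only from above, by those of C and M, whose
  sum is at most d. By \<open>lead\<close> the reduced product still has degree d, so both bounds
  are attained and a proper factorization would stay proper, against \<open>irred\<close>.\<close>

lemma inhom_A_polynomial_criterion:
  fixes L :: "int poly poly list"
  assumes len: "length L = Suc d"
    and rec: "\<And>n. n \<ge> 1 \<Longrightarrow> (\<Sum>i<length (map (eval_at n) L). map (eval_at n)
      L ! i * colored_jones p (n + i)) = eval_at n b"
    and order0: "\<And>c b. c \<noteq> 0 \<Longrightarrow> \<not> jones.relation p [:c:] b"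
    and lead: "map (reduction a) L ! d \<noteq> 0"
    and irred: "\<And>C M. Poly (map (reduction a) L) = C * M \<Longrightarrow> 0 < degree C
      \<Longrightarrow> 0 < degree M \<Longrightarrow> False"
  shows "is_inhom_A_polynomial (colored_jones p) (Poly (map int_poly_ratfun2 L)) (int_poly_ratfun2 b)"
proof -
  define P where "P = Poly L"
  interpret red: comm_ring_hom "reduction a" by (rule reduction_hom)
  have mapP: "Poly (map f L) = map_poly f P" if "f 0 = 0" for f :: "int poly poly \<Rightarrow>
    'z::comm_monoid_add"
    unfolding P_def by (rule Poly_map[of f, OF that])
  have degle: "degree P \<le> d"
    unfolding P_def by (rule degree_le) (auto simp: coeff_Poly_eq nth_default_def len)
  have Pd: "coeff P d = L ! d" by (simp add: P_def coeff_Poly_eq nth_default_def len)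
  have redP: "Poly (map (reduction a) L) = map_poly (reduction a) P" by (rule mapP) simp
  have leadP: "reduction a (coeff P d) \<noteq> 0" using lead by (simp add: Pd len)
  have degP: "degree P = d"
  proof (rule antisym[OF degle])
    show "d \<le> degree P" by (rule le_degree) (use leadP in auto)
  qed
  have degR: "degree (map_poly (reduction a) P) = d"
  proof (rule antisym)
    show "degree (map_poly (reduction a) P) \<le> d"
      using degle degree_map_poly_le[of "reduction a" P] by linarith
    show "d \<le> degree (map_poly (reduction a) P)"
      by (rule le_degree) (use leadP in simp)
  qed
  have P0: "P \<noteq> 0" using leadP by auto
  have rel: "jones.relation p P b"
    unfolding jones.relation_def
  proof (intro allI impI)
    fix n :: nat assume n: "n \<ge> 1"
    interpret ev: comm_ring_hom "eval_at n" by (rule eval_at_hom)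
    have "jones.act p P n = (\<Sum>i\<le>d. eval_at n (coeff P i) * colored_jones p (n + i))"
      by (rule jones.act_extend[OF degle])
    also have "\<dots> = (\<Sum>i<length L. map (eval_at n) L ! i * colored_jones p (n + i))"
      unfolding len lessThan_Suc_atMost
      by (rule sum.cong) (auto simp: P_def coeff_Poly_eq nth_default_def len)
    finally show "jones.act p P n = eval_at n b" using rec[OF n] by simp
  qed
  have "degree P \<le> degree M" if "M \<noteq> 0" "jones.relation p M c" for M c
  proof (rule jones.minimal_degree[OF rel order0 _ that])
    fix f C M assume H: "f \<noteq> 0" "smult f P = jones.skew_mult C M" "0 < degree M" "degree M <
      degree P"
      "degree C \<le> degree P - degree M"
    obtain C' M' where CM: "map_poly (reduction a) P = C' * M'" "degree C' \<le> degree C" "degree M'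
      \<le> degree M"
      using reduction_factor[OF H(1,2)] by blast
    have "degree C' + degree M' = d"
    proof -
      have "coeff (C' * M') d \<noteq> 0" unfolding CM(1)[symmetric] using leadP by simp
      then have "C' * M' \<noteq> 0" by auto
      then have "degree (C' * M') = degree C' + degree M'" by (intro degree_mult_eq) auto
      then show ?thesis using degR unfolding CM(1) by simp
    qed
    then have "0 < degree C'" "0 < degree M'" using CM H(3-5) degP by linarith+
    then show False using irred[of C' M'] CM(1) redP by simp
  qed
  note min = this
  show ?thesis
    unfolding is_inhom_A_polynomial_def
  proof (intro conjI allI impI)
    have e: "Poly (map int_poly_ratfun2 L) = map_poly int_poly_ratfun2 P" by (rule mapP) simp
    show "Poly (map int_poly_ratfun2 L) \<noteq> 0" unfolding e using P0 by simp
    show "inhom_relation (Poly (map int_poly_ratfun2 L)) (int_poly_ratfun2 b) (colored_jones p)"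
      unfolding e by (rule inhom_relation_if_relation[OF rel])
    fix A' B' assume "A' \<noteq> 0 \<and> inhom_relation A' B' (colored_jones p)"
    then obtain M c where "M \<noteq> 0" "degree M = degree A'" "jones.relation p M c"
      using relation_if_inhom_relation[of A' B' p thesis] by blast
    then show "degree (Poly (map int_poly_ratfun2 L)) \<le> degree A'"
      unfolding e using min[of M c] by simp
  qed
qed

section \<open>Irreducibility\<close>

lemma degree_1_root:
  fixes M :: "'a::field poly"
  assumes "degree M = 1"
  shows "\<exists>x. poly M x = 0"
proof -
  have v: "coeff M 1 \<noteq> 0" using assms by (metis degree_0 leading_coeff_0_iff zero_neq_one)
  have "poly M x = coeff M 0 + coeff M 1 * x" for x by (simp add: poly_altdef assms)
  then show ?thesis using v by (intro exI[of _ "- coeff M 0 / coeff M 1"]) simp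
qed

lemma no_root_irreducible:
  fixes P :: "'a::field poly"
  assumes "\<And>x. poly P x \<noteq> 0" and "degree P \<le> 3" and "P = C * M" "0 < degree C" "0 <
    degree M"
  shows False
proof -
  have "C \<noteq> 0" "M \<noteq> 0" using assms(4,5) by auto
  then have "degree C + degree M = degree P" using assms(3) by (simp add: degree_mult_eq)
  then have "degree C = 1 \<or> degree M = 1" using assms(2,4,5) by linarith
  then obtain x where "poly C x = 0 \<or> poly M x = 0" using degree_1_root by blast
  then show False using assms(1)[of x] assms(3) by auto
qed

lemma atLeastLessThan_0_11: "{0..<11} = {0, 1, 2, 3, 4, 5, 6, 7, 8, 9, 10 :: int}"
proof (rule Set.set_eqI)
  fix x :: int
  show "x \<in> {0..<11} \<longleftrightarrow> x \<in> {0, 1, 2, 3, 4, 5, 6, 7, 8, 9, 10}"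
    unfolding atLeastLessThan_iff insert_iff empty_iff by arith
qed

text \<open>Turns root-freeness into eleven divisibility checks on integers.\<close>

lemma gf11_no_root:
  assumes "\<forall>i\<in>{0..<11}. \<not> 11 dvd poly P i"
  shows "poly (map_poly of_int P) (x :: gf11) \<noteq> 0"
proof -
  obtain i where "i \<in> {0..<11}" "x = of_int i" using gf11_cases by blast
  then show ?thesis using assms by (simp add: of_int_hom.poly_map_poly of_int_gf11_eq_0)
qed

lemma degree_2_expand:
  assumes "degree C = 2"
  shows "C = [:coeff C 0, coeff C 1, coeff C 2:]" "coeff C 2 \<noteq> 0"
proof -
  show "coeff C 2 \<noteq> 0" using assms by (metis degree_0 leading_coeff_0_iff zero_neq_numeral)
  show "C = [:coeff C 0, coeff C 1, coeff C 2:]"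
    by (rule poly_eqI) (use assms in \<open>auto simp: coeff_pCons coeff_eq_0 numeral_2_eq_2 split:
      nat.split\<close>)
qed

text \<open>A factorization of \<open>E\<^sup>4 + 6 E + 1\<close> into two quadratics with linear
  coefficients \<open>\<plusminus>a\<close> forces
  \<open>a\<^sup>2\<close> to be a root of the resolvent cubic \<open>s\<^sup>3 - 4 s -
    36\<close>.\<close>

lemma quartic_irreducible:
  fixes C M :: "gf11 poly"
  assumes P: "[:4, 2, 0, 0, 4:] = C * M" and pos: "0 < degree C" "0 < degree M"
  shows False
proof -
  have gf: "(4::gf11) \<noteq> 0"
    using of_int_gf11_eq_0[of 4] by simp
  have "C \<noteq> 0" "M \<noteq> 0" using pos by auto
  moreover have "degree (C * M) = 4" unfolding P[symmetric] using gf by simp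
  ultimately have deg: "degree C + degree M = 4" by (simp add: degree_mult_eq)
  have nr: "poly [:4, 2, 0, 0, 4:] x \<noteq> 0" for x :: gf11
    using gf11_no_root[of "[:4, 2, 0, 0, 4:]" x] by (simp add: atLeastLessThan_0_11)
  then have nr': "poly C x \<noteq> 0" "poly M x \<noteq> 0" for x
    unfolding P poly_mult by (metis mult_eq_0_iff)+
  have "degree C \<noteq> 1" "degree M \<noteq> 1"
    using degree_1_root nr' by blast+
  then have "degree C = 2" "degree M = 2" using deg pos by linarith+
  note C = degree_2_expand[OF this(1)] and M = degree_2_expand[OF this(2)]
  define c0 c1 c2 m0 m1 m2 where "c0 = coeff C 0" and "c1 = coeff C 1" and "c2 = coeff C 2"
    and "m0 = coeff M 0" and "m1 = coeff M 1" and "m2 = coeff M 2"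
  have "[:4, 2, 0, 0, 4:] = [:c0, c1, c2:] * [:m0, m1, m2:]"
    unfolding c0_def c1_def c2_def m0_def m1_def m2_def C(1)[symmetric] M(1)[symmetric] by (rule P)
  then have eqs: "c0 * m0 = 4" "c0 * m1 + c1 * m0 = 2" "c0 * m2 + c1 * m1 + c2 * m0 = 0"
    "c1 * m2 + c2 * m1 = 0" "c2 * m2 = 4"
    by (simp_all add: algebra_simps)
  \<comment> \<open>The factors are normalized to E^2 + s E + b and E^2 - s E + e; the opposite
    linear terms come from the missing E^3.\<close>
  define s where "s = c1 / c2"
  have nz: "c2 \<noteq> 0" "m2 \<noteq> 0" using C(2) M(2) by (simp_all add: c2_def m2_def)
  define b e where "b = c0 / c2" and "e = m0 / m2"
  have cc: "c1 = s * c2" "c0 = b * c2" "m0 = e * m2" using nz by (simp_all add: s_def b_def e_def)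
  have m1: "m1 = - s * m2"
  proof -
    have "c2 * m1 = c2 * (- s * m2)" using eqs(4) unfolding cc by (simp add: algebra_simps add_eq_0_iff)
    then show ?thesis using nz(1) by (metis mult_left_cancel)
  qed
  have f4: "c2 * m2 = 4" by fact
  have 1: "b * e = 1"
  proof -
    have "4 * (b * e) = 4 * 1" using eqs(1) f4 unfolding cc(2,3) by (simp add: algebra_simps)
    then show ?thesis using gf by (simp only: mult_cancel_left) simp
  qed
  \<comment> \<open>The linear coefficient gives 4 s (e - b) = 2. The doubled form avoids writing
    1/2 as 6.\<close>
  have 2: "2 * (s * (e - b)) = 1"
  proof -
    have "(c2 * m2) * (s * (e - b)) = 2"
      using eqs(2) unfolding cc(1) cc(2) cc(3) m1 by (simp add: algebra_simps)
    then have "2 * (2 * (s * (e - b))) = 2 * 1" unfolding f4 by simp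
    moreover have "(2::gf11) \<noteq> 0" using of_int_gf11_eq_0[of 2] by simp
    ultimately show ?thesis by (simp only: mult_cancel_left) simp
  qed
  have 3: "b + e = s ^ 2"
  proof -
    have "(c2 * m2) * (b + e - s ^ 2) = 0"
      using eqs(3) unfolding cc(1) cc(2) cc(3) m1 by (simp add: algebra_simps power2_eq_square)
    then have "4 * (b + e) = 4 * s ^ 2" unfolding f4 by (simp add: algebra_simps)
    then show ?thesis using gf by (simp only: mult_cancel_left) simp
  qed
  have "(e - b) ^ 2 = (b + e) ^ 2 - 4 * (b * e)"
    by (simp add: power2_eq_square algebra_simps)
  then have "(e - b) ^ 2 = s ^ 4 - 4" unfolding 1 3 by (simp flip: power_mult)
  moreover have "(2 * (s * (e - b))) ^ 2 = 4 * s ^ 2 * (e - b) ^ 2"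
    by (simp add: power_mult_distrib)
  moreover have "4 * (s ^ 6 - 4 * s ^ 2) = 4 * s ^ 2 * (s ^ 4 - 4)"
    by Groebner_Basis.algebra
  \<comment> \<open>This is the resolvent equation s^6 - 4 s^2 = 36 multiplied by 4, as 4 * 36 = 144
    = 1 mod 11. None of the eleven residues satisfies it.\<close>
  ultimately have "4 * (s ^ 6 - 4 * s ^ 2) = 1"
    unfolding 2 by (metis one_power2)
  moreover obtain i where i: "i \<in> {0..<11}" "s = of_int i" using gf11_cases by blast
  ultimately have "(of_int (4 * (i ^ 6 - 4 * i ^ 2) - 1) :: gf11) = 0" by simp
  then have "11 dvd 4 * (i ^ 6 - 4 * i ^ 2) - 1" by (simp only: of_int_gf11_eq_0)
  then show False using i(1) unfolding atLeastLessThan_0_11 by auto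
qed

lemma map_recurrence:
  assumes "comm_ring_hom h"
  shows "map h (recurrence_pos1 q Q) = recurrence_pos1 (h q) (h Q)"
    and "map h (recurrence_neg1 q Q) = recurrence_neg1 (h q) (h Q)"
    and "map h (recurrence_pos2 q Q) = recurrence_pos2 (h q) (h Q)"
    and "map h (recurrence_neg2 q Q) = recurrence_neg2 (h q) (h Q)"
    and "h (inhomogeneity_pos1 q Q) = inhomogeneity_pos1 (h q) (h Q)"
    and "h (inhomogeneity_neg1 q Q) = inhomogeneity_neg1 (h q) (h Q)"
    and "h (inhomogeneity_pos2 q Q) = inhomogeneity_pos2 (h q) (h Q)"
    and "h (inhomogeneity_neg2 q Q) = inhomogeneity_neg2 (h q) (h Q)"
proof -
  interpret comm_ring_hom h by fact
  note homs = hom_add hom_mult hom_minus hom_uminus hom_power hom_one hom_numeral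
  show "map h (recurrence_pos1 q Q) = recurrence_pos1 (h q) (h Q)"
    by (simp only: recurrence_pos1_def list.map homs)
  show "map h (recurrence_neg1 q Q) = recurrence_neg1 (h q) (h Q)"
    by (simp only: recurrence_neg1_def list.map homs)
  show "map h (recurrence_pos2 q Q) = recurrence_pos2 (h q) (h Q)"
    by (simp only: recurrence_pos2_def list.map homs)
  show "map h (recurrence_neg2 q Q) = recurrence_neg2 (h q) (h Q)"
    by (simp only: recurrence_neg2_def list.map homs)
  show "h (inhomogeneity_pos1 q Q) = inhomogeneity_pos1 (h q) (h Q)"
    by (simp only: inhomogeneity_pos1_def homs)
  show "h (inhomogeneity_neg1 q Q) = inhomogeneity_neg1 (h q) (h Q)"
    by (simp only: inhomogeneity_neg1_def homs)
  show "h (inhomogeneity_pos2 q Q) = inhomogeneity_pos2 (h q) (h Q)"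
    by (simp only: inhomogeneity_pos2_def homs)
  show "h (inhomogeneity_neg2 q Q) = inhomogeneity_neg2 (h q) (h Q)"
    by (simp only: inhomogeneity_neg2_def homs)
qed

definition qP :: "int poly poly" where "qP = [:[:0, 1:]:]"
definition QP :: "int poly poly" where "QP = [:0, 1:]"

lemma int_poly_ratfun2_vars: "int_poly_ratfun2 qP = qq" "int_poly_ratfun2 QP = QQ"
  by (simp_all add: int_poly_ratfun2_def qP_def QP_def qq_def QQ_def to_fract_def int_poly_ratfun_q)

lemma eval_at_vars: "eval_at n qP = qvar" "eval_at n QP = qvar ^ n"
  by (simp_all add: eval_at_def qP_def QP_def int_poly_ratfun_q)

lemma reduction_vars: "reduction a qP = of_int 1" "reduction a QP = of_int a"
  by (simp_all add: reduction_def qP_def QP_def)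

text \<open>Keeping \<open>of_int\<close> outside lets the specialization be computed in the
  integers and reduced mod 11 only afterwards.\<close>

lemma reduction_recurrence:
  "map (reduction a) (recurrence_pos1 qP QP) = map of_int (recurrence_pos1 1 a)"
  "map (reduction a) (recurrence_neg1 qP QP) = map of_int (recurrence_neg1 1 a)"
  "map (reduction a) (recurrence_pos2 qP QP) = map of_int (recurrence_pos2 1 a)"
  "map (reduction a) (recurrence_neg2 qP QP) = map of_int (recurrence_neg2 1 a)"
  by (simp_all only: map_recurrence[OF reduction_hom] map_recurrence[OF of_int_hom.comm_ring_hom_axioms]
    reduction_vars)

text \<open>The common factors 16 for p = -1 and 9 for p = 2 are units mod 11, so they do not affect
  irreducibility.\<close>

lemma recurrence_values:
  "recurrence_pos1 1 2 = [8, 1 :: int]"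
  "recurrence_neg1 1 3 = [144, - 544, 144 :: int]"
  "recurrence_pos2 1 2 = [1152, 540, 243, 9 :: int]"
  "recurrence_neg2 1 3 = [82944, - 4165632, 563200, - 495616, 82944 :: int]"
  by (simp_all add: recurrence_pos1_def recurrence_neg1_def recurrence_pos2_def recurrence_neg2_def)

lemma Poly_map_of_int: "Poly (map of_int xs) = map_poly (of_int :: int \<Rightarrow> gf11) (Poly xs)"
  by (rule Poly_map) simp

lemma of_int_gf11_cong: "11 dvd x - y \<Longrightarrow> (of_int x :: gf11) = of_int y"
  using of_int_gf11_eq_0[of "x - y"] by simp

lemma inhom_A_polynomial_pos1: "is_inhom_A_polynomial (colored_jones 1) A_1 B_1"
proof -
  have "is_inhom_A_polynomial (colored_jones 1)
     (Poly (map int_poly_ratfun2 (recurrence_pos1 qP QP))) (int_poly_ratfun2 (inhomogeneity_pos1 qP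
       QP))"
  proof (rule inhom_A_polynomial_criterion[where d = 1 and a = 2])
    show "\<not> jones.relation 1 [:c:] b" if "c \<noteq> 0" for c b
      by (rule no_order_0_relation[OF degree_cyclo_jones_pos1 _ that]) simp
    show "length (recurrence_pos1 qP QP) = Suc 1" by (simp add: recurrence_pos1_def)
    show "map (reduction 2) (recurrence_pos1 qP QP) ! 1 \<noteq> 0"
      unfolding reduction_recurrence recurrence_values by simp
    fix C M assume CM: "Poly (map (reduction 2) (recurrence_pos1 qP QP)) = C * M"
      and pos: "0 < degree C" "0 < degree M"
    have "degree (C * M) = 1"
      unfolding CM[symmetric] reduction_recurrence recurrence_values by simp
    moreover have "C \<noteq> 0" "M \<noteq> 0" using pos by auto
    ultimately show False using pos by (simp add: degree_mult_eq)
  qed (use jones_recurrence_pos1 in \<open>simp only: map_recurrence[OF eval_at_hom]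
    eval_at_vars\<close>)
  then show ?thesis
    unfolding map_recurrence[OF int_poly_ratfun2.comm_ring_hom_axioms] int_poly_ratfun2_vars
    by (simp only: A_1_def B_1_def recurrence_pos1_def inhomogeneity_pos1_def Poly.simps)
qed

lemma inhom_A_polynomial_neg1: "is_inhom_A_polynomial (colored_jones (- 1)) A_minus1 B_minus1"
proof -
  have "is_inhom_A_polynomial (colored_jones (- 1))
     (Poly (map int_poly_ratfun2 (recurrence_neg1 qP QP))) (int_poly_ratfun2 (inhomogeneity_neg1 qP
       QP))"
  proof (rule inhom_A_polynomial_criterion[where d = 2 and a = 3])
    show "\<not> jones.relation (- 1) [:c:] b" if "c \<noteq> 0" for c b
      by (rule no_order_0_relation[OF degree_cyclo_jones_neg1 _ that]) simp
    show "length (recurrence_neg1 qP QP) = Suc 2" by (simp add: recurrence_neg1_def)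
    show "map (reduction 3) (recurrence_neg1 qP QP) ! 2 \<noteq> 0"
      unfolding reduction_recurrence recurrence_values using of_int_gf11_eq_0[of 144] by simp
    fix C M assume CM: "Poly (map (reduction 3) (recurrence_neg1 qP QP)) = C * M"
      and pos: "0 < degree C" "0 < degree M"
    show False
    proof (rule no_root_irreducible[OF _ _ _ pos])
      \<comment> \<open>The quadratic is 16 (9 E^2 - 34 E + 9); the discriminant of the second
        factor is 832 = 7 mod 11, not a square.\<close>
      show "poly (map_poly of_int (Poly [144, - 544, 144])) x \<noteq> 0" for x :: gf11
        by (rule gf11_no_root) (simp add: atLeastLessThan_0_11)
      show "degree (map_poly (of_int :: int \<Rightarrow> gf11) (Poly [144, - 544, 144])) \<le> 3"
        by (rule order_trans[OF degree_map_poly_le]) simp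
      show "map_poly of_int (Poly [144, - 544, 144]) = C * M"
        using CM unfolding reduction_recurrence recurrence_values Poly_map_of_int .
    qed
  qed (use jones_recurrence_neg1 in \<open>simp only: map_recurrence[OF eval_at_hom]
    eval_at_vars\<close>)
  then show ?thesis
    unfolding map_recurrence[OF int_poly_ratfun2.comm_ring_hom_axioms] int_poly_ratfun2_vars
    by (simp only: A_minus1_def B_minus1_def recurrence_neg1_def inhomogeneity_neg1_def Poly.simps)
qed

lemma inhom_A_polynomial_pos2: "is_inhom_A_polynomial (colored_jones 2) A_2 B_2"
proof -
  have "is_inhom_A_polynomial (colored_jones 2)
     (Poly (map int_poly_ratfun2 (recurrence_pos2 qP QP))) (int_poly_ratfun2 (inhomogeneity_pos2 qP
       QP))"
  proof (rule inhom_A_polynomial_criterion[where d = 3 and a = 2])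
    show "\<not> jones.relation 2 [:c:] b" if "c \<noteq> 0" for c b
      by (rule no_order_0_relation[OF degree_cyclo_jones_pos2 that])
    show "length (recurrence_pos2 qP QP) = Suc 3" by (simp add: recurrence_pos2_def)
    show "map (reduction 2) (recurrence_pos2 qP QP) ! 3 \<noteq> 0"
      unfolding reduction_recurrence recurrence_values using of_int_gf11_eq_0[of 9] by simp
    fix C M assume CM: "Poly (map (reduction 2) (recurrence_pos2 qP QP)) = C * M"
      and pos: "0 < degree C" "0 < degree M"
    show False
    proof (rule no_root_irreducible[OF _ _ _ pos])
      \<comment> \<open>Up to the unit 9 this is E^3 + 5 E^2 + 5 E + 7 mod 11.\<close>
      show "poly (map_poly of_int (Poly [1152, 540, 243, 9])) x \<noteq> 0" for x :: gf11
        by (rule gf11_no_root) (simp add: atLeastLessThan_0_11)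
      show "degree (map_poly (of_int :: int \<Rightarrow> gf11) (Poly [1152, 540, 243, 9])) \<le> 3"
        by (rule order_trans[OF degree_map_poly_le]) simp
      show "map_poly of_int (Poly [1152, 540, 243, 9]) = C * M"
        using CM unfolding reduction_recurrence recurrence_values Poly_map_of_int .
    qed
  qed (use jones_recurrence_pos2 in \<open>simp only: map_recurrence[OF eval_at_hom]
    eval_at_vars\<close>)
  then show ?thesis
    unfolding map_recurrence[OF int_poly_ratfun2.comm_ring_hom_axioms] int_poly_ratfun2_vars
    by (simp only: A_2_def B_2_def recurrence_pos2_def inhomogeneity_pos2_def Poly.simps)
qed

lemma inhom_A_polynomial_neg2: "is_inhom_A_polynomial (colored_jones (- 2)) A_minus2 B_minus2"
proof -
  have "is_inhom_A_polynomial (colored_jones (- 2))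
     (Poly (map int_poly_ratfun2 (recurrence_neg2 qP QP))) (int_poly_ratfun2 (inhomogeneity_neg2 qP
       QP))"
  proof (rule inhom_A_polynomial_criterion[where d = 4 and a = 3])
    show "\<not> jones.relation (- 2) [:c:] b" if "c \<noteq> 0" for c b
      by (rule no_order_0_relation[OF degree_cyclo_jones_neg2 _ that]) simp
    show "length (recurrence_neg2 qP QP) = Suc 4" by (simp add: recurrence_neg2_def)
    \<comment> \<open>563200 and 495616 are divisible by 11, so the quartic becomes 4 (E^4 + 6 E +
      1). The missing cubic term is what makes the linear coefficients of two quadratic factors
      opposite.\<close>
    have red: "map (reduction 3) (recurrence_neg2 qP QP) = [4, 2, 0, 0, 4]"
      unfolding reduction_recurrence recurrence_values
      using of_int_gf11_cong[of 82944 4] of_int_gf11_cong[of "- 4165632" 2]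
        of_int_gf11_cong[of 563200 0] of_int_gf11_cong[of "- 495616" 0] by simp
    show "map (reduction 3) (recurrence_neg2 qP QP) ! 4 \<noteq> 0"
      unfolding red using of_int_gf11_eq_0[of 4] by simp
    fix C M assume CM: "Poly (map (reduction 3) (recurrence_neg2 qP QP)) = C * M"
      and pos: "0 < degree C" "0 < degree M"
    have "[:4, 2, 0, 0, 4:] = C * M" using CM unfolding red by simp
    then show False using pos by (rule quartic_irreducible)
  qed (use jones_recurrence_neg2 in \<open>simp only: map_recurrence[OF eval_at_hom]
    eval_at_vars\<close>)
  then show ?thesis
    unfolding map_recurrence[OF int_poly_ratfun2.comm_ring_hom_axioms] int_poly_ratfun2_vars
    by (simp only: A_minus2_def B_minus2_def recurrence_neg2_def inhomogeneity_neg2_def Poly.simps)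
qed

theorem theorem1:
  shows "is_inhom_A_polynomial (colored_jones 1) A_1 B_1
       \<and> is_inhom_A_polynomial (colored_jones (-1)) A_minus1 B_minus1
       \<and> is_inhom_A_polynomial (colored_jones 2) A_2 B_2
       \<and> is_inhom_A_polynomial (colored_jones (-2)) A_minus2 B_minus2"
  using inhom_A_polynomial_pos1 inhom_A_polynomial_neg1 inhom_A_polynomial_pos2 inhom_A_polynomial_neg2
  by blast

end
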